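(* Let $\alpha>0$, $\kappa\in(0,2]$, $c_Y>0$ and let $Y\in\mathbf{S}(\alpha,\kappa,c_Y)$. Then the limit \[ \mathcal{H}_{Y} := \lim_{T\to\infty}\frac{\mathcal{H}_Y(T)}{T^{\alpha/\kappa}} = \lim_{T\to\infty}\frac{\mathbf{E}\exp\left(\sup_{t\in[0,T]}\left(\sqrt{2}\,Y(t)-t^\alpha\right)\right)}{T^{\alpha/\kappa}} \] exists, $\mathcal{H}_Y\in(0,\infty)$, and \[ \mathcal{H}_Y=\frac{\kappa}{\alpha}\,(c_Y)^{1/\kappa}\,\mathcal{H}_{B_\kappa}, \] where $\mathcal{H}_{B_\kappa}$ is the classical Pickands constant.
   Context: Class $\mathbf{S}(\alpha,\kappa,c_Y)$ (with $\alpha>0$, $\kappa\in(0,2]$, $c_Y>0$): a centered Gaussian process $Y=\{Y(t):t\ge 0\}$ with a.s. continuous sample paths belongs to $\mathbf{S}(\alpha,\kappa,c_Y)$ if (S1) $Y$ is self-similar with index $\alpha/2$, i.e. for every $a>0$ the processes $\{Y(at):t\ge0\}$ and $\{a^{\alpha/2}Y(t):t\ge0\}$ have the same law, and $\mathbf{Var}(Y(1))=1$ (hence $\mathbf{Var}(Y(t))=t^\alpha$); (S2) $\mathbf{Var}(Y(1)-Y(1-h))=c_Y|h|^\kappa+o(|h|^\kappa)$ as $h\to0$. For such $Y$ and $T>0$, $\mathcal{H}_Y(T):=\mathbf{E}\exp\left(\sup_{t\in[0,T]}\left(\sqrt2\,Y(t)-t^\alpha\right)\right)$. For $\kappa\in(0,2]$,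 $B_\kappa=\{B_\kappa(t):t\ge0\}$ denotes fractional Brownian motion with Hurst parameter $\kappa/2$, i.e. the centered Gaussian process with a.s. continuous sample paths, stationary increments, $B_\kappa(0)=0$ and $\mathbf{Var}(B_\kappa(t))=t^\kappa$. The classical Pickands constant is $\mathcal{H}_{B_\kappa}=\lim_{T\to\infty}T^{-1}\,\mathbf{E}\exp\left(\sup_{t\in[0,T]}\left(\sqrt2 B_\kappa(t)-t^\kappa\right)\right)$, which is well known to exist in $(0,\infty)$. *)

theory Defs
  imports "HOL-Probability.Probability" "HOL-Library.Landau_Symbols"
begin

text \<open>The almost surely vanishing variable counts as a (degenerate) centered Gaussian.\<close>

definition centered_gaussian_rv :: "'a measure \<Rightarrow> ('a \<Rightarrow> real) \<Rightarrow> bool" where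
  "centered_gaussian_rv M X \<longleftrightarrow>
     X \<in> borel_measurable M \<and>
     ((AE \<omega> in M. X \<omega> = 0) \<or> (\<exists>\<sigma>>0. distributed M lborel X (normal_density 0 \<sigma>)))"

text \<open>Processes are families indexed by \<open>real\<close>, of which only the times \<open>t \<ge> 0\<close> matter.\<close>

definition process_law :: "'a measure \<Rightarrow> (real \<Rightarrow> 'a \<Rightarrow> real) \<Rightarrow> (real \<Rightarrow> real) measure" where
  "process_law M X = distr M (\<Pi>\<^sub>M t\<in>{0..}. borel) (\<lambda>\<omega>. \<lambda>t\<in>{0..}. X t \<omega>)"

locale centered_gaussian_process = prob_space M
  for M :: "'a measure" and Y :: "real \<Rightarrow> 'a \<Rightarrow> real" +
  assumes gaussian:
    "\<And>F a. finite F \<Longrightarrow> F \<subseteq> {0..} \<Longrightarrow> centered_gaussian_rv M (\<lambda>\<omega>. \<Sum>t\<in>F. a t * Y t \<omega>)"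
    and continuous_paths: "AE \<omega> in M. continuous_on {0..} (\<lambda>t. Y t \<omega>)"

locale class_S = centered_gaussian_process M Y
  for M :: "'a measure" and Y :: "real \<Rightarrow> 'a \<Rightarrow> real" and \<alpha> \<kappa> c :: real +
  assumes self_similar:
    "\<And>a. a > 0 \<Longrightarrow>
       process_law M (\<lambda>t. Y (a * t)) = process_law M (\<lambda>t \<omega>. a powr (\<alpha> / 2) * Y t \<omega>)"
    and variance_1: "variance (Y 1) = 1"
    and variance_increment:
    "(\<lambda>h. variance (\<lambda>\<omega>. Y 1 \<omega> - Y (1 - h) \<omega>) - c * \<bar>h\<bar> powr \<kappa>) \<in> o[at 0](\<lambda>h. \<bar>h\<bar> powr \<kappa>)"

text \<open>Here \<open>\<kappa>\<close> is twice the Hurst parameter.\<close>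

locale fractional_brownian_motion = centered_gaussian_process M B
  for M :: "'a measure" and B :: "real \<Rightarrow> 'a \<Rightarrow> real" and \<kappa> :: real +
  assumes stationary_increments:
    "\<And>s. s \<ge> 0 \<Longrightarrow>
       process_law M (\<lambda>t \<omega>. B (s + t) \<omega> - B s \<omega>) = process_law M (\<lambda>t \<omega>. B t \<omega> - B 0 \<omega>)"
    and start_0: "AE \<omega> in M. B 0 \<omega> = 0"
    and variance_eq: "\<And>t. t \<ge> 0 \<Longrightarrow> variance (B t) = t powr \<kappa>"

text \<open>
  The expectation is taken in \<open>[0,\<infinity>]\<close>. The nonnegative integral is insensitive to arbitrary
  (even non-measurable) changes of the integrand on a null set, whereas the Bochner integral would
  return \<open>0\<close> if the supremum failed to be measurable because of discontinuous paths in a null set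
  of an incomplete space.
\<close>

definition exp_sup :: "'a measure \<Rightarrow> (real \<Rightarrow> 'a \<Rightarrow> real) \<Rightarrow> real \<Rightarrow> real \<Rightarrow> ennreal" where
  "exp_sup M Y \<alpha> T =
     (\<integral>\<^sup>+ \<omega>. ennreal (exp (SUP t\<in>{0..T}. sqrt 2 * Y t \<omega> - t powr \<alpha>)) \<partial>M)"

text \<open>To be used for a fractional Brownian motion \<open>B\<close> with variance function \<open>t powr \<kappa>\<close>.\<close>

definition pickands_constant :: "'a measure \<Rightarrow> (real \<Rightarrow> 'a \<Rightarrow> real) \<Rightarrow> real \<Rightarrow> ennreal" where
  "pickands_constant M B \<kappa> = Lim at_top (\<lambda>T. exp_sup M B \<kappa> T / ennreal T)"

end

(*
  Put Z = sqrt 2 Y - Var Y, so that E exp (Z t) = 1.  Tilting the measure by exp (Z s) turns the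
  increments Z t - Z s into Gaussian variables whose law depends only on the variogram
  E (Y t - Y s)^2.  The time change tau = K t^(alpha/kappa), K = (kappa/alpha) c^(1/kappa), makes
  this variogram locally equal to |t - s|^kappa, the variogram of fractional Brownian motion, and
  globally comparable to it.  On a grid,

    E max_i exp (Z_i) = sum_i E_i [max_j exp (Z_j - Z_i) / sum_j exp (Z_j - Z_i)],

  E_i denoting the expectation tilted at i.  The functional in brackets is bounded by 1 and, up to
  a small error, depends only on a window around i, so its tilted expectation converges to the
  corresponding quantity for fractional Brownian motion.  The passage from the grid to the
  continuum costs, on each unit interval, an error that tends to 0 with the mesh, by dyadic
  chaining.  Hence the time-changed process and the fractional Brownian motion have the same
  limiting growth rate, and K is the factor produced by the time change.
*)
theory Submission
  imports Defs "HOL-Complex_Analysis.Conformal_Mappings" "HOL-Real_Asymp.Real_Asymp"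
begin

text \<open>Existence comes from the comparison itself: for a suitable mesh and window, the averages
  h(n)/n of both processes end up within \<epsilon> of one and the same number, which is computed
  from fractional Brownian motion alone. This yields a common limit, and the existence of the
  Pickands limit is a by-product.

  Tilting reduces weak convergence of windows to pointwise convergence of variograms: the variances
  cancel in the tilted moment generating function, and characteristic functions follow by analytic
  continuation. Since the functional is bounded by 1, no uniform integrability is required.

  Positivity of the limit needs an argument of its own, because the comparison alone could produce
  0: on a sufficiently coarse grid every summand stays above 1/2.\<close>

subsection \<open>Gaussian exponential moments\<close>

lemma power_le_fact_exp:
  fixes x :: real assumes "0 \<le> x" shows "x ^ k \<le> fact k * exp x"
proof -
  have "(\<lambda>n. x ^ n /\<^sub>R fact n) sums exp x" by (rule exp_converges)
  then have "(\<Sum>n\<in>{k}. x ^ n /\<^sub>R fact n) \<le> exp x"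
    using assms sum_le_suminf[of "\<lambda>n. x ^ n /\<^sub>R fact n" "{k}"] by (auto simp: sums_iff)
  then show ?thesis by (simp add: field_simps)
qed

lemma exp_abs_le: "exp \<bar>x::real\<bar> \<le> exp x + exp (- x)"
  by (cases "x \<ge> 0") auto

lemma square_le_exp: "(x::real)\<^sup>2 \<le> 2 * (exp x + exp (- x))"
  using power_le_fact_exp[of "\<bar>x\<bar>" 2] exp_abs_le[of x] by (simp add: fact_numeral)

text \<open>The function z -> E exp (z V) has a power series that converges everywhere, and it
  agrees with exp (m z + s z^2) on the real axis; evaluating both at the imaginary unit gives the
  characteristic function. It is needed because tilting describes increments only through
  exponential moments.\<close>

lemma (in prob_space) expectation_cos_of_mgf:
  fixes V :: "'a \<Rightarrow> real"
  assumes [measurable]: "V \<in> borel_measurable M"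
    and int: "\<And>y. integrable M (\<lambda>\<omega>. exp (y * V \<omega>))"
    and mgf: "\<And>y. expectation (\<lambda>\<omega>. exp (y * V \<omega>)) = exp (m * y + s * y\<^sup>2)"
  shows "expectation (\<lambda>\<omega>. cos (b + V \<omega>)) = exp (- s) * cos (b + m)"
proof -
  have int_abs: "integrable M (\<lambda>\<omega>. exp (r * \<bar>V \<omega>\<bar>))" if "r \<ge> 0" for r
  proof (rule Bochner_Integration.integrable_bound)
    show "integrable M (\<lambda>\<omega>. exp (r * V \<omega>) + exp ((- r) * V \<omega>))"
      by (intro Bochner_Integration.integrable_add int)
    show "AE \<omega> in M. norm (exp (r * \<bar>V \<omega>\<bar>)) \<le> norm (exp (r * V \<omega>) + exp ((- r) * V \<omega>))"
      using exp_abs_le[of "r * V _"] that by (auto simp: abs_mult)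
  qed auto
  have int_pow: "integrable M (\<lambda>\<omega>. \<bar>V \<omega>\<bar> ^ k)" for k
  proof (rule Bochner_Integration.integrable_bound)
    show "integrable M (\<lambda>\<omega>. fact k * exp (1 * \<bar>V \<omega>\<bar>))"
      by (intro integrable_mult_right int_abs) simp
    show "AE \<omega> in M. norm (\<bar>V \<omega>\<bar> ^ k) \<le> norm (fact k * exp (1 * \<bar>V \<omega>\<bar>) :: real)"
      using power_le_fact_exp[of "\<bar>V _\<bar>" k] by auto
  qed auto
  define F where "F z = expectation (\<lambda>\<omega>. exp (z * complex_of_real (V \<omega>)))" for z
  define t where "t z k \<omega> = (z * complex_of_real (V \<omega>)) ^ k /\<^sub>R fact k" for z k \<omega>
  define a where "a k = expectation (\<lambda>\<omega>. complex_of_real (V \<omega>) ^ k) /\<^sub>R fact k" for k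
  have t_meas[measurable]: "t z k \<in> borel_measurable M" for z k
    unfolding t_def by measurable
  have norm_t: "norm (t z k \<omega>) = (norm z ^ k / fact k) * \<bar>V \<omega>\<bar> ^ k" for z k \<omega>
    by (simp add: t_def norm_mult norm_power power_mult_distrib field_simps)
  have int_t: "integrable M (\<lambda>\<omega>. norm (t z k \<omega>))" for z k
    unfolding norm_t by (intro integrable_mult_right int_pow)
  have sums: "(\<lambda>k. a k * z ^ k) sums F z" for z
  proof -
    have "(\<lambda>k. expectation (t z k)) sums expectation (\<lambda>\<omega>. \<Sum>k. t z k \<omega>)"
    proof (rule sums_integral)
      show "integrable M (t z k)" for k
        using int_t[of z k] by (simp add: integrable_norm_iff)
      show "AE \<omega> in M. summable (\<lambda>k. norm (t z k \<omega>))"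
        unfolding t_def using summable_norm_exp by auto
      \<comment> \<open>Interchange of sum and expectation: partial sums of the absolute values are
        dominated by exp (|z| |V|), which is integrable by \<open>int_abs\<close>.\<close>
      show "summable (\<lambda>k. expectation (\<lambda>\<omega>. norm (t z k \<omega>)))"
      proof (rule summableI_nonneg_bounded)
        fix n
        have "(\<Sum>k<n. expectation (\<lambda>\<omega>. norm (t z k \<omega>))) = expectation (\<lambda>\<omega>. \<Sum>k<n. norm (t z k \<omega>))"
          using int_t by (subst Bochner_Integration.integral_sum) auto
        also have "\<dots> \<le> expectation (\<lambda>\<omega>. exp (norm z * \<bar>V \<omega>\<bar>))"
        proof (intro integral_mono Bochner_Integration.integrable_sum int_t int_abs)
          fix \<omega>
          have e: "(\<lambda>k. norm (t z k \<omega>)) sums exp (norm z * \<bar>V \<omega>\<bar>)"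
            using exp_converges[of "norm z * \<bar>V \<omega>\<bar>"]
            by (simp add: norm_t power_mult_distrib field_simps)
          show "(\<Sum>k<n. norm (t z k \<omega>)) \<le> exp (norm z * \<bar>V \<omega>\<bar>)"
            using e by (subst sums_unique[OF e], intro sum_le_suminf) (auto simp: sums_iff)
        qed simp
        finally show "(\<Sum>k<n. expectation (\<lambda>\<omega>. norm (t z k \<omega>)))
          \<le> expectation (\<lambda>\<omega>. exp (norm z * \<bar>V \<omega>\<bar>))" .
      qed simp
    qed
    moreover have "(\<Sum>k. t z k \<omega>) = exp (z * complex_of_real (V \<omega>))" for \<omega>
      unfolding t_def using exp_converges by (metis sums_unique)
    moreover have "expectation (t z k) = a k * z ^ k" for k
    proof -
      have "t z k = (\<lambda>\<omega>. (z ^ k / fact k) * complex_of_real (V \<omega>) ^ k)"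
        by (simp add: fun_eq_iff t_def power_mult_distrib scaleR_conv_of_real field_simps)
      then show ?thesis by (simp add: a_def scaleR_conv_of_real field_simps)
    qed
    ultimately show ?thesis by (simp add: F_def)
  qed
  have hol: "F holomorphic_on ball 0 2"
    by (rule power_series_holomorphic[where a = a]) (use sums in simp)
  have real_F: "F (of_real y) = exp (of_real m * of_real y + of_real s * (of_real y)\<^sup>2)" for y
  proof -
    have "F (of_real y) = expectation (\<lambda>\<omega>. complex_of_real (exp (y * V \<omega>)))"
      unfolding F_def by (intro arg_cong[where f = "integral\<^sup>L M"] ext) (metis exp_of_real of_real_mult)
    also have "\<dots> = of_real (exp (m * y + s * y\<^sup>2))"
      by (simp only: integral_complex_of_real mgf)
    finally show ?thesis by (simp flip: exp_of_real)
  qed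
  \<comment> \<open>Radius 2 makes the ball contain the point \<open>\<i>\<close>; its real points
    accumulate at 0, so the identity theorem applies.\<close>
  have "F \<i> - exp (of_real m * \<i> + of_real s * \<i>\<^sup>2) = 0"
  proof (rule analytic_continuation[where f = "\<lambda>z. F z - exp (of_real m * z + of_real s * z\<^sup>2)" and S = "ball 0 2" and U = "{z \<in> ball 0 2. Im z = 0}" and \<xi> = 0])
    show "(\<lambda>z. F z - exp (of_real m * z + of_real s * z\<^sup>2)) holomorphic_on ball 0 2"
      by (intro holomorphic_intros hol)
    show "(0::complex) islimpt {z \<in> ball 0 2. Im z = 0}"
      unfolding islimpt_approachable
    proof (intro allI impI)
      fix e :: real assume "e > 0"
      then show "\<exists>x'\<in>{z \<in> ball 0 2. Im z = 0}. x' \<noteq> 0 \<and> dist x' 0 < e"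
        by (intro bexI[of _ "of_real (min 1 (e / 2))"]) (auto simp: min_def)
    qed
    fix z assume z: "z \<in> {z \<in> ball 0 2. Im z = 0}"
    then have "z = of_real (Re z)" by (simp add: complex_eq_iff)
    then show "F z - exp (of_real m * z + of_real s * z\<^sup>2) = 0"
      using real_F[of "Re z"] by simp
  qed auto
  then have "cis b * F \<i> = cis b * exp (of_real m * \<i> - of_real s)" by simp
  also have "\<dots> = exp (- s) * cis (b + m)"
    by (simp add: exp_diff exp_minus cis_mult[symmetric] cis_conv_exp exp_of_real field_simps) (simp add: exp_add)
  finally have "Re (cis b * F \<i>) = exp (- s) * cos (b + m)" by simp
  moreover have "cis (b + V \<omega>) = cis b * exp (\<i> * complex_of_real (V \<omega>))" for \<omega>
    by (simp flip: cis_mult cis_conv_exp)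
  then have "cis b * F \<i> = expectation (\<lambda>\<omega>. cis (b + V \<omega>))"
    unfolding F_def by simp
  moreover have "integrable M (\<lambda>\<omega>. cis (b + V \<omega>))"
  proof (rule integrable_const_bound[where B = 1])
    show "(\<lambda>\<omega>. cis (b + V \<omega>)) \<in> borel_measurable M"
      unfolding cis_conv_exp by measurable
  qed simp
  then have "Re (expectation (\<lambda>\<omega>. cis (b + V \<omega>))) = expectation (\<lambda>\<omega>. cos (b + V \<omega>))"
    by (subst integral_Re[symmetric]) auto
  ultimately show ?thesis by simp
qed

lemma centered_gaussian_facts:
  assumes "prob_space M" and G: "centered_gaussian_rv M X"
  shows "integrable M (\<lambda>\<omega>. (X \<omega>)\<^sup>2)" and "(LINT \<omega>|M. X \<omega>) = 0"
    and "integrable M (\<lambda>\<omega>. exp (X \<omega>))"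
    and "(LINT \<omega>|M. exp (X \<omega>)) = exp ((LINT \<omega>|M. (X \<omega>)\<^sup>2) / 2)"
proof -
  interpret prob_space M by fact
  have [measurable]: "X \<in> borel_measurable M" using G by (simp add: centered_gaussian_rv_def)
  have "integrable M (\<lambda>\<omega>. (X \<omega>)\<^sup>2) \<and> (LINT \<omega>|M. X \<omega>) = 0 \<and> integrable M (\<lambda>\<omega>. exp (X \<omega>)) \<and>
    (LINT \<omega>|M. exp (X \<omega>)) = exp ((LINT \<omega>|M. (X \<omega>)\<^sup>2) / 2)"
  proof (cases "AE \<omega> in M. X \<omega> = 0")
    case True
    have i: "integrable M (\<lambda>\<omega>. f (X \<omega>)) \<and> (LINT \<omega>|M. f (X \<omega>)) = f 0"
      if [measurable]: "f \<in> borel_measurable borel" for f :: "real \<Rightarrow> real"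
    proof -
      have ae: "AE \<omega> in M. f (X \<omega>) = f 0" using True by eventually_elim simp
      have "(LINT \<omega>|M. f (X \<omega>)) = (LINT \<omega>|M. f 0)"
        by (rule integral_cong_AE) (use ae in auto)
      moreover have "integrable M (\<lambda>\<omega>. f (X \<omega>)) = integrable M (\<lambda>\<omega>. f 0)"
        by (rule integrable_cong_AE) (use ae in auto)
      ultimately show ?thesis by (simp add: prob_space)
    qed
    from i[of "\<lambda>x. x\<^sup>2"] i[of "\<lambda>x. x"] i[of exp] show ?thesis by simp
  next
    case False
    then obtain \<sigma> where \<sigma>: "\<sigma> > 0" and D: "distributed M lborel X (normal_density 0 \<sigma>)"
      using G by (auto simp: centered_gaussian_rv_def)
    note nn = normal_density_nonneg
    have i: "integrable M (\<lambda>\<omega>. f (X \<omega>)) = integrable lborel (\<lambda>x. normal_density 0 \<sigma> x * f x)"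
      and e: "(LINT \<omega>|M. f (X \<omega>)) = (LINT x|lborel. normal_density 0 \<sigma> x * f x)"
      if [measurable]: "f \<in> borel_measurable borel" for f :: "real \<Rightarrow> real"
      using distributed_integrable[OF D, of f] distributed_integral[OF D, of f] by auto
    \<comment> \<open>Completing the square: weighting by exp x moves the mean from 0 to
      \<open>\<sigma>\<^sup>2\<close> and gives the total mass
      \<open>exp (\<sigma>\<^sup>2 / 2)\<close>.\<close>
    have sq: "normal_density 0 \<sigma> x * exp x = exp (\<sigma>\<^sup>2 / 2) * normal_density (\<sigma>\<^sup>2) \<sigma> x" for x
    proof -
      have "- x\<^sup>2 / (2 * \<sigma>\<^sup>2) + x = \<sigma>\<^sup>2 / 2 - (x - \<sigma>\<^sup>2)\<^sup>2 / (2 * \<sigma>\<^sup>2)"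
        using \<sigma> by (simp add: field_simps power2_eq_square)
      then have "exp (- x\<^sup>2 / (2 * \<sigma>\<^sup>2)) * exp x = exp (\<sigma>\<^sup>2 / 2) * exp (- (x - \<sigma>\<^sup>2)\<^sup>2 / (2 * \<sigma>\<^sup>2))"
        by (simp add: exp_add[symmetric])
      then show ?thesis by (simp add: normal_density_def)
    qed
    have 2: "(LINT \<omega>|M. (X \<omega>)\<^sup>2) = \<sigma>\<^sup>2"
      using e[of "\<lambda>x. x\<^sup>2"] integral_normal_moment_even[OF \<sigma>, of 0 1] by simp
    have "integrable M (\<lambda>\<omega>. (X \<omega>)\<^sup>2)"
      using i[of "\<lambda>x. x\<^sup>2"] integrable_normal_moment[OF \<sigma>, of 0 2] by simp
    moreover have "(LINT \<omega>|M. X \<omega>) = 0"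
      using e[of "\<lambda>x. x"] integral_normal_moment_nz_1[OF \<sigma>, of 0] by simp
    moreover have "integrable M (\<lambda>\<omega>. exp (X \<omega>))"
      using i[of exp] \<sigma> by (simp add: sq)
    moreover have "(LINT \<omega>|M. exp (X \<omega>)) = exp (\<sigma>\<^sup>2 / 2)"
      using e[of exp] \<sigma> by (simp add: sq)
    ultimately show ?thesis using 2 by simp
  qed
  then show "integrable M (\<lambda>\<omega>. (X \<omega>)\<^sup>2)" and "(LINT \<omega>|M. X \<omega>) = 0"
    and "integrable M (\<lambda>\<omega>. exp (X \<omega>))"
    and "(LINT \<omega>|M. exp (X \<omega>)) = exp ((LINT \<omega>|M. (X \<omega>)\<^sup>2) / 2)" by auto
qed

subsection \<open>Convergence of expectations of Lipschitz functions\<close>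

text \<open>Real trigonometric polynomials with arbitrary frequencies; the phase \<open>b\<close>
  takes care of sines. Characteristic functions determine the expectation of every member, and the
  product formula for cosines makes the set an algebra, as Stone-Weierstrass requires.\<close>

inductive_set trig_span :: "'i set \<Rightarrow> (('i \<Rightarrow> real) \<Rightarrow> real) set" for I where
  cos: "(\<lambda>x. c * cos (b + (\<Sum>i\<in>I. a i * x i))) \<in> trig_span I"
| add: "f \<in> trig_span I \<Longrightarrow> g \<in> trig_span I \<Longrightarrow> (\<lambda>x. f x + g x) \<in> trig_span I"

lemma trig_span_const: "(\<lambda>_. c) \<in> trig_span I"
  using trig_span.cos[where c = c and b = 0 and a = "\<lambda>_. 0" and I = I] by simp

lemma trig_span_mult:
  assumes "f \<in> trig_span I" "g \<in> trig_span I"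
  shows "(\<lambda>x. f x * g x) \<in> trig_span I"
  using assms(1)
proof induction
  case (cos c b a)
  show ?case using assms(2)
  proof induction
    case (cos c' b' a')
    have "(\<lambda>x. c * cos (b + (\<Sum>i\<in>I. a i * x i)) * (c' * cos (b' + (\<Sum>i\<in>I. a' i * x i)))) =
      (\<lambda>x. (c * c' / 2) * cos ((b - b') + (\<Sum>i\<in>I. (a i - a' i) * x i)) +
           (c * c' / 2) * cos ((b + b') + (\<Sum>i\<in>I. (a i + a' i) * x i)))"
    proof
      fix x
      let ?s = "b + (\<Sum>i\<in>I. a i * x i)" and ?t = "b' + (\<Sum>i\<in>I. a' i * x i)"
      have m: "(b - b') + (\<Sum>i\<in>I. (a i - a' i) * x i) = ?s - ?t"
        by (simp add: left_diff_distrib sum_subtractf)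
      have p: "(b + b') + (\<Sum>i\<in>I. (a i + a' i) * x i) = ?s + ?t"
        by (simp add: distrib_right sum.distrib)
      show "c * cos ?s * (c' * cos ?t) =
        (c * c' / 2) * cos ((b - b') + (\<Sum>i\<in>I. (a i - a' i) * x i)) +
        (c * c' / 2) * cos ((b + b') + (\<Sum>i\<in>I. (a i + a' i) * x i))"
        unfolding m p cos_add cos_diff by (simp add: field_simps)
    qed
    then show ?case by (simp only: trig_span.intros)
  next
    case (add f g)
    then show ?case by (simp only: distrib_left trig_span.add)
  qed
next
  case (add f g)
  then show ?case by (simp only: distrib_right trig_span.add)
qed

lemma trig_span_expectation:
  assumes "f \<in> trig_span I" "finite I" "finite_measure P"
    and [measurable]: "\<And>i. i \<in> I \<Longrightarrow> X i \<in> borel_measurable P"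
  shows "integrable P (\<lambda>\<omega>. f (\<lambda>i. X i \<omega>))"
  using assms(1)
proof induction
  case (cos c b a)
  interpret finite_measure P by fact
  have [measurable]: "(\<lambda>\<omega>. \<Sum>i\<in>I. a i * X i \<omega>) \<in> borel_measurable P"
    by (intro borel_measurable_sum) auto
  show ?case
  proof (rule integrable_const_bound[where B = "\<bar>c\<bar>"])
    show "AE \<omega> in P. norm (c * cos (b + (\<Sum>i\<in>I. a i * X i \<omega>))) \<le> \<bar>c\<bar>"
      using mult_left_mono[OF abs_cos_le_one abs_ge_zero[of c]] by (simp add: abs_mult)
  qed measurable
next
  case (add f g)
  then show ?case by simp
qed

lemma tendsto_trig_span_expectation:
  assumes "f \<in> trig_span I" "finite I"
    and P: "\<And>m. prob_space (P m)" and Q: "prob_space Q"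
    and X: "\<And>m i. i \<in> I \<Longrightarrow> X m i \<in> borel_measurable (P m)"
    and Y: "\<And>i. i \<in> I \<Longrightarrow> Y i \<in> borel_measurable Q"
    and conv: "\<And>a b. ((\<lambda>m. LINT \<omega>|P m. cos (b + (\<Sum>i\<in>I. a i * X m i \<omega>))) \<longlongrightarrow>
      (LINT \<omega>|Q. cos (b + (\<Sum>i\<in>I. a i * Y i \<omega>)))) G"
  shows "((\<lambda>m. LINT \<omega>|P m. f (\<lambda>i. X m i \<omega>)) \<longlongrightarrow> (LINT \<omega>|Q. f (\<lambda>i. Y i \<omega>))) G"
  using assms(1)
proof induction
  case (cos c b a)
  show ?case by (simp add: conv tendsto_mult_left)
next
  case (add f g)
  have "integrable (P m) (\<lambda>\<omega>. f (\<lambda>i. X m i \<omega>))" "integrable (P m) (\<lambda>\<omega>. g (\<lambda>i. X m i \<omega>))" for m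
    by (rule trig_span_expectation[OF add.hyps(1) \<open>finite I\<close> prob_space.finite_measure[OF P] X],
        assumption, rule trig_span_expectation[OF add.hyps(2) \<open>finite I\<close> prob_space.finite_measure[OF P] X])
  moreover have "integrable Q (\<lambda>\<omega>. f (\<lambda>i. Y i \<omega>))" "integrable Q (\<lambda>\<omega>. g (\<lambda>i. Y i \<omega>))"
    by (rule trig_span_expectation[OF add.hyps(1) \<open>finite I\<close> prob_space.finite_measure[OF Q] Y],
        assumption, rule trig_span_expectation[OF add.hyps(2) \<open>finite I\<close> prob_space.finite_measure[OF Q] Y])
  ultimately show ?case using add.IH by (simp add: tendsto_add)
qed

lemma continuous_on_of_Lipschitz_coordinates:
  fixes F :: "('i::countable \<Rightarrow> real) \<Rightarrow> real"
  assumes lip: "\<And>x y. \<bar>F x - F y\<bar> \<le> L * (\<Sum>i\<in>I. \<bar>x i - y i\<bar>)"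
  shows "continuous_on S F"
  unfolding continuous_on_def
proof
  fix x assume "x \<in> S"
  have "continuous_on S (\<lambda>y. y i)" for i :: "'i::countable"
    by (rule continuous_on_subset[OF continuous_on_product_coordinates]) simp
  then have "((\<lambda>y. L * (\<Sum>i\<in>I. \<bar>y i - x i\<bar>)) \<longlongrightarrow> L * (\<Sum>i\<in>I. \<bar>x i - x i\<bar>)) (at x within S)"
    by (intro tendsto_intros)
      (use \<open>x \<in> S\<close> in \<open>simp add: continuous_on_def\<close>)
  then have "((\<lambda>y. F y - F x) \<longlongrightarrow> 0) (at x within S)"
    using lip by (intro tendsto_0_le[where K = 1 and g = "\<lambda>y. F y - F x" and f = "\<lambda>y. L * (\<Sum>i\<in>I. \<bar>y i - x i\<bar>)" and K = 1])
      (auto intro!: always_eventually order_trans[OF lip])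
  then show "(F \<longlongrightarrow> F x) (at x within S)"
    by (simp add: LIM_zero_iff)
qed

text \<open>Composing with the rescaled sine makes a polynomial approximation on a cube into a
  trigonometric approximation that is valid everywhere.\<close>

lemma trig_span_approx:
  fixes F :: "('i::countable \<Rightarrow> real) \<Rightarrow> real"
  assumes "finite I" and lip: "\<And>x y. \<bar>F x - F y\<bar> \<le> L * (\<Sum>i\<in>I. \<bar>x i - y i\<bar>)"
    and "\<epsilon> > 0"
  obtains f where "f \<in> trig_span I" "\<And>x. \<bar>F (\<lambda>i. \<rho> * sin (x i / \<rho>)) - f x\<bar> < \<epsilon>"
proof -
  define s where "s x = (\<lambda>i. if i \<in> I then sin (x i / \<rho>) else 0)" for x :: "'i::countable \<Rightarrow> real"
  \<comment> \<open>Coordinates outside \<open>I\<close> are pinned to 0, so that the cube is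
    compact and the coordinates in \<open>I\<close> separate its points.\<close>
  define S where "S = Pi\<^sub>E UNIV (\<lambda>i. if i \<in> I then {-1..1::real} else {0})"
  define R where "R = {f. continuous_on S f \<and> (\<lambda>x. f (s x)) \<in> trig_span I}"
  have s: "s x \<in> S" for x by (auto simp: s_def S_def PiE_def)
  have coord: "(\<lambda>y. y i) \<in> R" if "i \<in> I" for i
  proof -
    have "(\<lambda>x. s x i) = (\<lambda>x. 1 * cos (- (pi / 2) + (\<Sum>j\<in>I. (if j = i then 1 / \<rho> else 0) * x j)))"
      using that \<open>finite I\<close>
      by (simp add: s_def fun_eq_iff if_distrib[of "\<lambda>c. c * _"] sum.delta' sum.delta sin_cos_eq cong: if_cong)
        (simp add: cos_diff)
    then show ?thesis
      unfolding R_def using trig_span.cos[where c = 1 and b = "- (pi / 2)" and a = "\<lambda>j. if j = i then 1 / \<rho> else 0" and I = I]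
        continuous_on_subset[OF continuous_on_product_coordinates, of S i] by simp
  qed
  have "function_ring_on R S"
  proof
    have "compactin (product_topology (\<lambda>i. euclidean) UNIV) S"
      unfolding S_def by (subst compactin_PiE) auto
    then show "compact S" by (simp add: euclidean_product_topology)
    show "f \<in> R \<Longrightarrow> continuous_on S f" for f by (simp add: R_def)
    show "(\<lambda>x. f x + g x) \<in> R" if "f \<in> R" "g \<in> R" for f g
      using that by (auto simp: R_def intro: continuous_intros trig_span.add)
    show "(\<lambda>x. f x * g x) \<in> R" if "f \<in> R" "g \<in> R" for f g
      using that by (auto simp: R_def intro: continuous_intros trig_span_mult)
    show "(\<lambda>_. c) \<in> R" for c
      by (simp add: R_def trig_span_const)
    fix x y assume "x \<in> S" "y \<in> S" "x \<noteq> y"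
    then obtain i where i: "x i \<noteq> y i" by (auto simp: fun_eq_iff)
    have "i \<in> I"
    proof (rule ccontr)
      assume "i \<notin> I"
      then have "x i = 0" "y i = 0"
        using \<open>x \<in> S\<close> \<open>y \<in> S\<close> by (auto simp: S_def PiE_def Pi_iff split: if_splits)
      with i show False by simp
    qed
    then show "\<exists>f\<in>R. f x \<noteq> f y"
      using i by (intro bexI[of _ "\<lambda>y. y i"] coord)
  qed
  then interpret function_ring_on R S .
  define F' where "F' y = F (\<lambda>i. \<rho> * y i)" for y
  have lip': "\<bar>F' x - F' y\<bar> \<le> (L * \<bar>\<rho>\<bar>) * (\<Sum>i\<in>I. \<bar>x i - y i\<bar>)" for x y
    using lip[of "\<lambda>i. \<rho> * x i" "\<lambda>i. \<rho> * y i"]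
    by (simp add: F'_def right_diff_distrib[symmetric] abs_mult sum_distrib_left[symmetric] mult_ac)
  have "continuous_on S F'"
    by (rule continuous_on_of_Lipschitz_coordinates[OF lip'])
  from Stone_Weierstrass_basic[OF this \<open>\<epsilon> > 0\<close>] obtain f where
    f: "f \<in> R" "\<And>x. x \<in> S \<Longrightarrow> \<bar>F' x - f x\<bar> < \<epsilon>" by blast
  have "F (\<lambda>i. \<rho> * sin (x i / \<rho>)) = F' (s x)" for x
  proof -
    \<comment> \<open>The Lipschitz bound sums over \<open>I\<close> only, so \<open>F\<close>
      cannot see the coordinates that \<open>s\<close> sets to 0.\<close>
    have "\<bar>F (\<lambda>i. \<rho> * sin (x i / \<rho>)) - F (\<lambda>i. \<rho> * s x i)\<bar> \<le> L * (\<Sum>i\<in>I. 0)"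
      by (rule order_trans[OF lip]) (simp add: s_def)
    then show ?thesis by (simp add: F'_def)
  qed
  with f s show thesis by (intro that[of "\<lambda>x. f (s x)"]) (auto simp: R_def)
qed

text \<open>A quadratic error is wanted because second moments are what is bounded uniformly under
  the tilts.\<close>

lemma abs_diff_scaled_sin_le:
  fixes u \<rho> :: real assumes "\<rho> > 0"
  shows "\<bar>u - \<rho> * sin (u / \<rho>)\<bar> \<le> u\<^sup>2 / \<rho>"
proof -
  have "\<bar>sin (u / \<rho>) - u / \<rho>\<bar> \<le> (u / \<rho>)\<^sup>2 / 2"
    using Maclaurin_sin_bound[of "u / \<rho>" 2] by (simp add: numeral_2_eq_2 sin_coeff_def)
  also have "\<dots> \<le> (u / \<rho>)\<^sup>2" by simp
  finally have "\<rho> * \<bar>sin (u / \<rho>) - u / \<rho>\<bar> \<le> \<rho> * (u / \<rho>)\<^sup>2"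
    using assms by simp
  moreover have "\<rho> * \<bar>sin (u / \<rho>) - u / \<rho>\<bar> = \<bar>\<rho> * (sin (u / \<rho>) - u / \<rho>)\<bar>"
    using assms by (simp add: abs_mult)
  moreover have "\<rho> * (sin (u / \<rho>) - u / \<rho>) = - (u - \<rho> * sin (u / \<rho>))"
    using assms by (simp add: right_diff_distrib)
  ultimately show ?thesis using assms by (simp add: power2_eq_square)
qed

text \<open>The approximant \<open>f\<close> matches \<open>F\<close> at the sine-truncated point,
  not at the point itself. Truncation moves each coordinate by at most x^2 / \<rho>, so the second
  moment bound turns it into a small error in expectation; this takes the place of
  tightness.\<close>

lemma expectation_trig_approx:
  fixes F :: "('i::countable \<Rightarrow> real) \<Rightarrow> real"
  assumes "finite I" and lip: "\<And>x y. \<bar>F x - F y\<bar> \<le> L * (\<Sum>i\<in>I. \<bar>x i - y i\<bar>)"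
    and "L \<ge> 0" "\<rho> > 0" and bounded: "\<And>x. \<bar>F x\<bar> \<le> 1"
    and f: "f \<in> trig_span I" "\<And>x. \<bar>F (\<lambda>i. \<rho> * sin (x i / \<rho>)) - f x\<bar> < \<epsilon>"
    and "prob_space P"
    and X[measurable]: "\<And>i. i \<in> I \<Longrightarrow> X i \<in> borel_measurable P"
    and FX[measurable]: "(\<lambda>\<omega>. F (\<lambda>i. X i \<omega>)) \<in> borel_measurable P"
    and sq: "\<And>i. i \<in> I \<Longrightarrow> integrable P (\<lambda>\<omega>. (X i \<omega>)\<^sup>2)"
      "\<And>i. i \<in> I \<Longrightarrow> (LINT \<omega>|P. (X i \<omega>)\<^sup>2) \<le> C"
  shows "\<bar>(LINT \<omega>|P. F (\<lambda>i. X i \<omega>)) - (LINT \<omega>|P. f (\<lambda>i. X i \<omega>))\<bar> \<le> L * card I * C / \<rho> + \<epsilon>"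
proof -
  interpret prob_space P by fact
  have iF: "integrable P (\<lambda>\<omega>. F (\<lambda>i. X i \<omega>))"
    by (rule integrable_const_bound[where B = 1]) (use bounded in auto)
  have if': "integrable P (\<lambda>\<omega>. f (\<lambda>i. X i \<omega>))"
    by (rule trig_span_expectation) (use f \<open>finite I\<close> X finite_measure_axioms in auto)
  have isum: "integrable P (\<lambda>\<omega>. L * (\<Sum>i\<in>I. (X i \<omega>)\<^sup>2 / \<rho>))"
    using sq by (intro integrable_mult_right Bochner_Integration.integrable_sum integrable_divide) auto
  have "\<bar>(LINT \<omega>|P. F (\<lambda>i. X i \<omega>)) - (LINT \<omega>|P. f (\<lambda>i. X i \<omega>))\<bar> =
    \<bar>LINT \<omega>|P. F (\<lambda>i. X i \<omega>) - f (\<lambda>i. X i \<omega>)\<bar>"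
    using iF if' by simp
  also have "\<dots> \<le> (LINT \<omega>|P. \<bar>F (\<lambda>i. X i \<omega>) - f (\<lambda>i. X i \<omega>)\<bar>)"
    by (rule integral_abs_bound)
  also have "\<dots> \<le> (LINT \<omega>|P. L * (\<Sum>i\<in>I. (X i \<omega>)\<^sup>2 / \<rho>) + \<epsilon>)"
  proof (intro integral_mono)
    fix \<omega>
    have "\<bar>F (\<lambda>i. X i \<omega>) - F (\<lambda>i. \<rho> * sin (X i \<omega> / \<rho>))\<bar> \<le> L * (\<Sum>i\<in>I. (X i \<omega>)\<^sup>2 / \<rho>)"
      using \<open>L \<ge> 0\<close> \<open>\<rho> > 0\<close>
      by (intro order_trans[OF lip] mult_left_mono sum_mono abs_diff_scaled_sin_le) auto
    then show "\<bar>F (\<lambda>i. X i \<omega>) - f (\<lambda>i. X i \<omega>)\<bar> \<le> L * (\<Sum>i\<in>I. (X i \<omega>)\<^sup>2 / \<rho>) + \<epsilon>"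
      using f(2)[of "\<lambda>i. X i \<omega>"] by linarith
  qed (use iF if' isum in auto)
  also have "\<dots> = L * (\<Sum>i\<in>I. (LINT \<omega>|P. (X i \<omega>)\<^sup>2) / \<rho>) + \<epsilon>"
  proof -
    have "(LINT \<omega>|P. (\<Sum>i\<in>I. (X i \<omega>)\<^sup>2 / \<rho>)) = (\<Sum>i\<in>I. (LINT \<omega>|P. (X i \<omega>)\<^sup>2) / \<rho>)"
      by (subst Bochner_Integration.integral_sum) (use sq in auto)
    then show ?thesis using isum by (subst Bochner_Integration.integral_add) (auto simp: prob_space)
  qed
  also have "\<dots> \<le> L * (\<Sum>i\<in>I. C / \<rho>) + \<epsilon>"
    using \<open>L \<ge> 0\<close> \<open>\<rho> > 0\<close> sq by (intro add_right_mono mult_left_mono sum_mono divide_right_mono) auto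
  finally show ?thesis by (simp add: field_simps)
qed

text \<open>A form of Levy's continuity theorem with probability spaces that vary with
  \<open>m\<close>. The truncation level and the trigonometric approximant are chosen independently
  of \<open>m\<close>, so convergence on \<open>trig_span\<close> suffices.\<close>

theorem tendsto_expectation_Lipschitz:
  fixes F :: "('i::countable \<Rightarrow> real) \<Rightarrow> real"
  assumes "finite I" and lip: "\<And>x y. \<bar>F x - F y\<bar> \<le> L * (\<Sum>i\<in>I. \<bar>x i - y i\<bar>)"
    and L: "L \<ge> 0" and bounded: "\<And>x. \<bar>F x\<bar> \<le> 1"
    and P: "\<And>m. prob_space (P m)" and Q: "prob_space Q"
    and X: "\<And>m i. i \<in> I \<Longrightarrow> X m i \<in> borel_measurable (P m)"
    and Y: "\<And>i. i \<in> I \<Longrightarrow> Y i \<in> borel_measurable Q"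
    and FX: "\<And>m. (\<lambda>\<omega>. F (\<lambda>i. X m i \<omega>)) \<in> borel_measurable (P m)"
    and FY: "(\<lambda>\<omega>. F (\<lambda>i. Y i \<omega>)) \<in> borel_measurable Q"
    and sqX: "\<And>m i. i \<in> I \<Longrightarrow> integrable (P m) (\<lambda>\<omega>. (X m i \<omega>)\<^sup>2)"
      "\<And>m i. i \<in> I \<Longrightarrow> (LINT \<omega>|P m. (X m i \<omega>)\<^sup>2) \<le> C"
    and sqY: "\<And>i. i \<in> I \<Longrightarrow> integrable Q (\<lambda>\<omega>. (Y i \<omega>)\<^sup>2)"
      "\<And>i. i \<in> I \<Longrightarrow> (LINT \<omega>|Q. (Y i \<omega>)\<^sup>2) \<le> C"
    and conv: "\<And>a b. ((\<lambda>m. LINT \<omega>|P m. cos (b + (\<Sum>i\<in>I. a i * X m i \<omega>))) \<longlongrightarrow>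
      (LINT \<omega>|Q. cos (b + (\<Sum>i\<in>I. a i * Y i \<omega>)))) G"
  shows "((\<lambda>m. LINT \<omega>|P m. F (\<lambda>i. X m i \<omega>)) \<longlongrightarrow> (LINT \<omega>|Q. F (\<lambda>i. Y i \<omega>))) G"
proof (rule tendstoI)
  fix e :: real assume "e > 0"
  \<comment> \<open>Makes the truncation error at most e / 8; the absolute value and the added 1
    keep it positive whatever the sign of \<open>C\<close>.\<close>
  define \<rho> where "\<rho> = 8 * (\<bar>L * card I * C\<bar> + 1) / e"
  have "\<rho> > 0" using \<open>e > 0\<close> by (simp add: \<rho>_def)
  have "L * card I * C / \<rho> \<le> e / 8"
  proof -
    have "L * card I * C * 8 \<le> 8 * (\<bar>L * card I * C\<bar> + 1)"
      using abs_ge_self[of "L * card I * C"] by (simp only: distrib_left mult.commute[of _ 8])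
    also have "\<dots> = e * \<rho>" using \<open>e > 0\<close> by (simp add: \<rho>_def)
    finally show ?thesis using \<open>\<rho> > 0\<close> by (simp add: field_simps)
  qed
  obtain f where f: "f \<in> trig_span I" "\<And>x. \<bar>F (\<lambda>i. \<rho> * sin (x i / \<rho>)) - f x\<bar> < e / 8"
    using trig_span_approx[OF \<open>finite I\<close> lip, of "e / 8" \<rho>] \<open>e > 0\<close> by auto
  have 1: "\<bar>(LINT \<omega>|P m. F (\<lambda>i. X m i \<omega>)) - (LINT \<omega>|P m. f (\<lambda>i. X m i \<omega>))\<bar> \<le> e / 4" for m
    using expectation_trig_approx[OF \<open>finite I\<close> lip L \<open>\<rho> > 0\<close> bounded f P X FX sqX, of m]
      \<open>L * card I * C / \<rho> \<le> e / 8\<close> by linarith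
  have 2: "\<bar>(LINT \<omega>|Q. F (\<lambda>i. Y i \<omega>)) - (LINT \<omega>|Q. f (\<lambda>i. Y i \<omega>))\<bar> \<le> e / 4"
    using expectation_trig_approx[OF \<open>finite I\<close> lip L \<open>\<rho> > 0\<close> bounded f Q Y FY sqY]
      \<open>L * card I * C / \<rho> \<le> e / 8\<close> by linarith
  have "\<forall>\<^sub>F m in G. dist (LINT \<omega>|P m. f (\<lambda>i. X m i \<omega>)) (LINT \<omega>|Q. f (\<lambda>i. Y i \<omega>)) < e / 2"
    using tendstoD[OF tendsto_trig_span_expectation[OF f(1) \<open>finite I\<close> P Q X Y conv], of "e / 2"] \<open>e > 0\<close> by auto
  then show "\<forall>\<^sub>F m in G. dist (LINT \<omega>|P m. F (\<lambda>i. X m i \<omega>)) (LINT \<omega>|Q. F (\<lambda>i. Y i \<omega>)) < e"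
  proof (rule eventually_mono)
    fix m assume "dist (LINT \<omega>|P m. f (\<lambda>i. X m i \<omega>)) (LINT \<omega>|Q. f (\<lambda>i. Y i \<omega>)) < e / 2"
    then show "dist (LINT \<omega>|P m. F (\<lambda>i. X m i \<omega>)) (LINT \<omega>|Q. F (\<lambda>i. Y i \<omega>)) < e"
      using 1[of m] 2 unfolding dist_real_def by linarith
  qed
qed

subsection \<open>The ratio of maximum and sum\<close>

text \<open>Adding a constant to all coordinates does not change it, so it is a function of
  differences alone, and these are what the tilted measures describe.\<close>

definition max_ratio :: "'i set \<Rightarrow> ('i \<Rightarrow> real) \<Rightarrow> real" where
  "max_ratio I x = Max ((\<lambda>i. exp (x i)) ` I) / (\<Sum>i\<in>I. exp (x i))"

lemma Max_exp_pos:
  fixes x :: "'i \<Rightarrow> real"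
  assumes "finite I" "I \<noteq> {}" shows "Max ((\<lambda>i. exp (x i)) ` I) > 0"
  using assms by (subst Max_gr_iff) auto

lemma Max_le_sum_exp:
  fixes x :: "'i \<Rightarrow> real"
  assumes "finite I" "I \<noteq> {}" shows "Max ((\<lambda>i. exp (x i)) ` I) \<le> (\<Sum>i\<in>I. exp (x i))"
  using assms by (subst Max_le_iff) (auto intro: member_le_sum)

lemma sum_exp_pos:
  fixes x :: "'i \<Rightarrow> real"
  assumes "finite I" "I \<noteq> {}" shows "(\<Sum>i\<in>I. exp (x i)) > 0"
  using assms by (intro sum_pos) auto

lemma max_ratio_nonneg: "finite I \<Longrightarrow> I \<noteq> {} \<Longrightarrow> max_ratio I x \<ge> 0"
  unfolding max_ratio_def by (intro divide_nonneg_pos sum_exp_pos less_imp_le[OF Max_exp_pos])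

lemma max_ratio_le_1: "finite I \<Longrightarrow> I \<noteq> {} \<Longrightarrow> max_ratio I x \<le> 1"
  unfolding max_ratio_def using Max_le_sum_exp[of I x] sum_exp_pos[of I x]
  by (subst divide_le_eq_1_pos) auto

lemma max_ratio_singleton [simp]: "max_ratio {i} x = 1"
  by (simp add: max_ratio_def)

lemma max_ratio_reindex: "inj_on f I \<Longrightarrow> max_ratio (f ` I) x = max_ratio I (\<lambda>i. x (f i))"
  by (simp add: max_ratio_def image_image sum.reindex)

lemma Max_exp_shift:
  fixes x :: "'i \<Rightarrow> real"
  assumes "finite I" "I \<noteq> {}"
  shows "Max ((\<lambda>i. exp (x i - c)) ` I) = exp (- c) * Max ((\<lambda>i. exp (x i)) ` I)"
proof -
  have "exp (- c) * Max ((\<lambda>i. exp (x i)) ` I) = Max ((\<lambda>y. exp (- c) * y) ` ((\<lambda>i. exp (x i)) ` I))"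
    by (rule mono_Max_commute) (use assms in \<open>auto simp: mono_def\<close>)
  then show ?thesis by (simp add: image_image exp_diff exp_minus field_simps)
qed

lemma Max_exp_eq_sum:
  fixes x :: "'i \<Rightarrow> real"
  assumes "finite I" "I \<noteq> {}"
  shows "Max ((\<lambda>i. exp (x i)) ` I) = (\<Sum>j\<in>I. exp (x j) * max_ratio I (\<lambda>i. x i - x j))"
proof -
  have "max_ratio I (\<lambda>i. x i - x j) = max_ratio I x" for j
  proof -
    have "(\<Sum>i\<in>I. exp (x i - x j)) = exp (- x j) * (\<Sum>i\<in>I. exp (x i))"
      by (simp add: sum_distrib_left exp_diff exp_minus field_simps)
    then show ?thesis using Max_exp_shift[OF assms] by (simp add: max_ratio_def)
  qed
  then have "(\<Sum>j\<in>I. exp (x j) * max_ratio I (\<lambda>i. x i - x j)) = (\<Sum>j\<in>I. exp (x j)) * max_ratio I x"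
    by (simp add: sum_distrib_right)
  also have "\<dots> = Max ((\<lambda>i. exp (x i)) ` I)"
    using sum_exp_pos[OF assms, of x] by (simp add: max_ratio_def)
  finally show ?thesis by simp
qed

text \<open>If d is the l1 distance, maximum and sum each change by a factor between exp (-d) and
  exp d, hence the ratio by at most exp (2 d). Boundedness by 1 turns this factor into the additive
  error 2 d.\<close>

lemma max_ratio_Lipschitz:
  fixes x y :: "'i \<Rightarrow> real"
  assumes I: "finite I" "I \<noteq> {}"
  shows "\<bar>max_ratio I x - max_ratio I y\<bar> \<le> 2 * (\<Sum>i\<in>I. \<bar>x i - y i\<bar>)"
proof -
  have *: "max_ratio I x - max_ratio I y \<le> 2 * (\<Sum>i\<in>I. \<bar>x i - y i\<bar>)" for x y :: "'i \<Rightarrow> real"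
  proof -
    define d where "d = (\<Sum>i\<in>I. \<bar>x i - y i\<bar>)"
    have "\<bar>x i - y i\<bar> \<le> d" if "i \<in> I" for i
      unfolding d_def using that I by (intro member_le_sum[where f = "\<lambda>i. \<bar>x i - y i\<bar>"]) auto
    then have le: "exp (x i) \<le> exp d * exp (y i)" "exp (y i) \<le> exp d * exp (x i)" if "i \<in> I" for i
      using that by (force simp: exp_add[symmetric] abs_le_iff)+
    have 1: "Max ((\<lambda>i. exp (x i)) ` I) \<le> exp d * Max ((\<lambda>i. exp (y i)) ` I)"
    proof (subst Max_le_iff)
      show "\<forall>a\<in>(\<lambda>i. exp (x i)) ` I. a \<le> exp d * Max ((\<lambda>i. exp (y i)) ` I)"
      proof clarify
        fix i assume "i \<in> I"
        then have "exp (y i) \<le> Max ((\<lambda>i. exp (y i)) ` I)" using I by simp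
        then have "exp d * exp (y i) \<le> exp d * Max ((\<lambda>i. exp (y i)) ` I)" by simp
        with le(1)[OF \<open>i \<in> I\<close>] show "exp (x i) \<le> exp d * Max ((\<lambda>i. exp (y i)) ` I)" by linarith
      qed
    qed (use I in auto)
    have 2: "(\<Sum>i\<in>I. exp (y i)) \<le> exp d * (\<Sum>i\<in>I. exp (x i))"
      by (simp add: sum_distrib_left le sum_mono)
    have "max_ratio I x \<le> (exp d * Max ((\<lambda>i. exp (y i)) ` I)) / ((\<Sum>i\<in>I. exp (y i)) / exp d)"
      unfolding max_ratio_def
      using 1 2 I by (intro frac_le) (auto simp: field_simps intro!: mult_nonneg_nonneg less_imp_le[OF Max_exp_pos] sum_exp_pos)
    also have "\<dots> = exp (2 * d) * max_ratio I y"
      by (simp add: max_ratio_def exp_double power2_eq_square)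
    finally have "exp (- (2 * d)) * max_ratio I x \<le> max_ratio I y"
      by (simp add: exp_minus field_simps)
    moreover have "(1 - 2 * d) * max_ratio I x \<le> exp (- (2 * d)) * max_ratio I x"
      using exp_ge_add_one_self[of "- (2 * d)"] I by (intro mult_right_mono max_ratio_nonneg) auto
    moreover have "2 * d * max_ratio I x \<le> 2 * d * 1"
      using I by (intro mult_left_mono max_ratio_le_1) (auto simp: d_def sum_nonneg)
    ultimately show ?thesis by (simp add: d_def left_diff_distrib)
  qed
  from *[of x y] *[of y x] show ?thesis by (simp add: abs_minus_commute)
qed

text \<open>Let R be the mass outside \<open>J\<close> and b the mass inside. The sum grows by R and
  the maximum by at most R, which gives the error R / (b + R); each of its summands is at most s^2 /
  (1 + s^2) \<le> s with s = exp ((x i - x j) / 2). The square root matters: under the tilt at j the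
  full exponential of the increment has expectation 1, while that of its square root decays with the
  variogram.\<close>

lemma max_ratio_window:
  fixes x :: "'i \<Rightarrow> real"
  assumes "finite I" "J \<subseteq> I" "j \<in> J"
  shows "\<bar>max_ratio I x - max_ratio J x\<bar> \<le> (\<Sum>i\<in>I - J. exp ((x i - x j) / 2))"
proof -
  define y where "y i = exp (x i)" for i
  define a where "a = Max (y ` J)"
  define b where "b = (\<Sum>i\<in>J. y i)"
  define R where "R = (\<Sum>i\<in>I - J. y i)"
  have fin: "finite J" "J \<noteq> {}" "I \<noteq> {}" using assms finite_subset by auto
  have a: "0 < a" "a \<le> b" "y j \<le> b" and R: "R \<ge> 0" and y: "y i > 0" for i
    using Max_exp_pos[of J x] Max_le_sum_exp[of J x] fin assms(3)
    by (auto simp: a_def b_def y_def R_def intro!: sum_nonneg member_le_sum)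
  have bR: "(\<Sum>i\<in>I. y i) = b + R"
    unfolding b_def R_def using assms fin by (subst sum.subset_diff[of J I]) auto
  have lo: "a \<le> Max (y ` I)"
    unfolding a_def using assms fin by (intro Max_mono) auto
  have hi: "Max (y ` I) \<le> a + R"
  proof (subst Max_le_iff)
    show "\<forall>z\<in>y ` I. z \<le> a + R"
    proof clarify
      fix i assume i: "i \<in> I"
      show "y i \<le> a + R"
      proof (cases "i \<in> J")
        case True
        then have "y i \<le> a" unfolding a_def using fin by auto
        with R show ?thesis by simp
      next
        case False
        then have "y i \<le> R" unfolding R_def using i assms(1) less_imp_le[OF y] by (intro member_le_sum) auto
        with a show ?thesis by simp
      qed
    qed
  qed (use assms fin in auto)
  have eq: "max_ratio I x = Max (y ` I) / (b + R)" "max_ratio J x = a / b"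
    by (simp_all add: max_ratio_def bR flip: y_def a_def b_def)
  have "\<bar>Max (y ` I) / (b + R) - a / b\<bar> \<le> R / (b + R)"
  proof -
    have "Max (y ` I) / (b + R) - a / b \<le> (a + R) / (b + R) - a / b"
      using hi a R by (intro diff_right_mono divide_right_mono) auto
    also have "\<dots> = (R / (b + R)) * (1 - a / b)" using a R by (simp add: field_simps)
    also have "\<dots> \<le> (R / (b + R)) * 1" using a R by (intro mult_left_mono) auto
    finally have 1: "Max (y ` I) / (b + R) - a / b \<le> R / (b + R)" by simp
    have "a / b - Max (y ` I) / (b + R) \<le> a / b - a / (b + R)"
      using lo a R by (intro diff_left_mono divide_right_mono) auto
    also have "\<dots> = (R / (b + R)) * (a / b)" using a R by (simp add: field_simps)
    also have "\<dots> \<le> (R / (b + R)) * 1" using a R by (intro mult_left_mono) auto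
    finally show ?thesis using 1 by simp
  qed
  also have "R / (b + R) \<le> (\<Sum>i\<in>I - J. exp ((x i - x j) / 2))"
    unfolding R_def sum_divide_distrib
  proof (intro sum_mono)
    fix i assume i: "i \<in> I - J"
    define s where "s = exp ((x i - x j) / 2)"
    have s: "y i = s\<^sup>2 * y j" "s > 0" by (simp_all add: s_def y_def exp_double[symmetric] exp_add[symmetric] diff_divide_distrib)
    have "y i \<le> R" unfolding R_def using i assms(1) less_imp_le[OF y] by (intro member_le_sum) auto
    then have "y i / (b + (\<Sum>i\<in>I - J. y i)) \<le> s\<^sup>2 * y j / (y j + s\<^sup>2 * y j)"
      using a y s R less_imp_le[OF y[of j]] by (intro frac_le) (auto simp flip: R_def intro: add_mono add_pos_pos)
    also have "\<dots> = (s\<^sup>2 * y j) / ((1 + s\<^sup>2) * y j)" by (simp add: distrib_right)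
    also have "\<dots> = s\<^sup>2 / (1 + s\<^sup>2)" using y[of j] by simp
    also have "\<dots> \<le> s"
    proof -
      have "0 \<le> s * ((1 - s)\<^sup>2 + s)" using s by simp
      then have "s\<^sup>2 \<le> s * (1 + s\<^sup>2)" by (simp add: power2_eq_square algebra_simps)
      then show ?thesis using s by (simp add: divide_le_eq add_pos_nonneg)
    qed
    finally show "y i / (b + (\<Sum>i\<in>I - J. y i)) \<le> exp ((x i - x j) / 2)" by (simp add: s_def)
  qed
  finally show ?thesis by (simp add: eq)
qed

lemma borel_measurable_max_ratio [measurable]:
  assumes "finite I" and [measurable]: "\<And>i. i \<in> I \<Longrightarrow> X i \<in> borel_measurable M"
  shows "(\<lambda>\<omega>. max_ratio I (\<lambda>i. X i \<omega>)) \<in> borel_measurable M"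
  unfolding max_ratio_def using assms(1)
  by (intro borel_measurable_divide borel_measurable_Max borel_measurable_sum) auto

subsection \<open>Exponential tilting of Gaussian processes\<close>

context centered_gaussian_process
begin

definition linear_forms :: "('a \<Rightarrow> real) set" where
  "linear_forms = {U. \<exists>F a. finite F \<and> F \<subseteq> {0..} \<and> U = (\<lambda>\<omega>. \<Sum>t\<in>F. a t * Y t \<omega>)}"

lemma linear_forms_value: "t \<ge> 0 \<Longrightarrow> Y t \<in> linear_forms"
  unfolding linear_forms_def by (intro CollectI exI[of _ "{t}"] exI[of _ "\<lambda>_. 1"]) auto

lemma linear_forms_mult: 
  assumes "U \<in> linear_forms" shows "(\<lambda>\<omega>. c * U \<omega>) \<in> linear_forms"
proof -
  from assms obtain F a where "finite F" "F \<subseteq> {0..}" "U = (\<lambda>\<omega>. \<Sum>t\<in>F. a t * Y t \<omega>)"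
    unfolding linear_forms_def by auto
  then show ?thesis
    unfolding linear_forms_def
    by (intro CollectI exI[of _ F] exI[of _ "\<lambda>t. c * a t"]) (simp add: sum_distrib_left mult.assoc)
qed

lemma linear_forms_add: 
  assumes "U \<in> linear_forms" "V \<in> linear_forms" shows "(\<lambda>\<omega>. U \<omega> + V \<omega>) \<in> linear_forms"
proof -
  from assms obtain F a G b where *: "finite F" "F \<subseteq> {0..}" "U = (\<lambda>\<omega>. \<Sum>t\<in>F. a t * Y t \<omega>)"
      "finite G" "G \<subseteq> {0..}" "V = (\<lambda>\<omega>. \<Sum>t\<in>G. b t * Y t \<omega>)"
    unfolding linear_forms_def by auto
  have ext: "(\<Sum>t\<in>F. a t * Y t \<omega>) = (\<Sum>t\<in>F \<union> G. (if t \<in> F then a t else 0) * Y t \<omega>)"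
    "(\<Sum>t\<in>G. b t * Y t \<omega>) = (\<Sum>t\<in>F \<union> G. (if t \<in> G then b t else 0) * Y t \<omega>)" for \<omega>
    using * by (auto intro!: sum.mono_neutral_cong_left)
  show ?thesis
    unfolding linear_forms_def
    by (intro CollectI exI[of _ "F \<union> G"]
        exI[of _ "\<lambda>t. (if t \<in> F then a t else 0) + (if t \<in> G then b t else 0)"])
      (use * in \<open>simp add: ext distrib_right sum.distrib\<close>)
qed

lemma linear_forms_diff: 
  assumes "U \<in> linear_forms" "V \<in> linear_forms" shows "(\<lambda>\<omega>. U \<omega> - V \<omega>) \<in> linear_forms"
  using linear_forms_add[OF assms(1) linear_forms_mult[OF assms(2), of "-1"]] by simp

lemma linear_forms_zero: "(\<lambda>\<omega>. 0) \<in> linear_forms"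
  unfolding linear_forms_def by (intro CollectI exI[of _ "{}"]) auto

lemma linear_forms_sum: 
  "finite I \<Longrightarrow> (\<And>i. i \<in> I \<Longrightarrow> U i \<in> linear_forms) \<Longrightarrow> (\<lambda>\<omega>. \<Sum>i\<in>I. U i \<omega>) \<in> linear_forms"
  by (induction rule: finite_induct) (auto intro: linear_forms_zero linear_forms_add)

lemma gaussian_linear_form: "U \<in> linear_forms \<Longrightarrow> centered_gaussian_rv M U"
  unfolding linear_forms_def using gaussian by auto

lemma measurable_linear_form: "U \<in> linear_forms \<Longrightarrow> U \<in> borel_measurable M"
  using gaussian_linear_form by (auto simp: centered_gaussian_rv_def)

lemma measurable_value [measurable]: "t \<ge> 0 \<Longrightarrow> Y t \<in> borel_measurable M"
  by (intro measurable_linear_form linear_forms_value)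

lemmas linear_form_facts = centered_gaussian_facts[OF prob_space_axioms gaussian_linear_form]

lemma integrable_mult_linear_forms:
  assumes "U \<in> linear_forms" "V \<in> linear_forms"
  shows "integrable M (\<lambda>\<omega>. U \<omega> * V \<omega>)"
proof -
  have "integrable M (\<lambda>\<omega>. ((U \<omega> + V \<omega>)\<^sup>2 - (U \<omega>)\<^sup>2 - (V \<omega>)\<^sup>2) / 2)"
    using assms by (intro integrable_divide Bochner_Integration.integrable_diff linear_form_facts linear_forms_add)
  then show ?thesis by (simp add: power2_eq_square algebra_simps)
qed

definition v :: "real \<Rightarrow> real" where "v t = expectation (\<lambda>\<omega>. (Y t \<omega>)\<^sup>2)"
definition \<gamma> :: "real \<Rightarrow> real \<Rightarrow> real" where "\<gamma> s t = expectation (\<lambda>\<omega>. (Y s \<omega> - Y t \<omega>)\<^sup>2)"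
definition Z :: "real \<Rightarrow> 'a \<Rightarrow> real" where "Z t \<omega> = sqrt 2 * Y t \<omega> - v t"

lemma measurable_Z [measurable]: "t \<ge> 0 \<Longrightarrow> Z t \<in> borel_measurable M"
  unfolding Z_def by measurable

lemma \<gamma>_self [simp]: "\<gamma> t t = 0" by (simp add: \<gamma>_def)

lemma \<gamma>_nonneg: "\<gamma> s t \<ge> 0" by (simp add: \<gamma>_def)

lemma \<gamma>_commute: "\<gamma> s t = \<gamma> t s" by (simp add: \<gamma>_def power2_commute)

lemma integrable_Y_mult: "s \<ge> 0 \<Longrightarrow> t \<ge> 0 \<Longrightarrow> integrable M (\<lambda>\<omega>. Y s \<omega> * Y t \<omega>)"
  by (intro integrable_mult_linear_forms linear_forms_value)

lemma expectation_increment_mult_center: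
  assumes "t \<ge> 0" "c \<ge> 0"
  shows "expectation (\<lambda>\<omega>. Y c \<omega> * (Y t \<omega> - Y c \<omega>)) = (v t - v c - \<gamma> t c) / 2"
proof -
  note [simp] = integrable_Y_mult[OF assms] integrable_Y_mult[OF assms(2,1)]
    integrable_Y_mult[OF assms(1,1)] integrable_Y_mult[OF assms(2,2)]
  show ?thesis
    by (simp add: v_def \<gamma>_def power2_eq_square algebra_simps)
qed

lemma expectation_increment_mult:
  assumes "s \<ge> 0" "t \<ge> 0" "c \<ge> 0"
  shows "expectation (\<lambda>\<omega>. (Y s \<omega> - Y c \<omega>) * (Y t \<omega> - Y c \<omega>)) = (\<gamma> s c + \<gamma> t c - \<gamma> s t) / 2"
proof -
  have [simp]: "integrable M (\<lambda>\<omega>. Y x \<omega> * Y y \<omega>)" if "x \<in> {s, t, c}" "y \<in> {s, t, c}" for x y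
    using assms that by (intro integrable_Y_mult) auto
  show ?thesis
    by (simp add: \<gamma>_def power2_eq_square algebra_simps)
qed

text \<open>The second moment of the sum of \<open>b i * (Y (\<tau> i) - Y c)\<close>, with
  covariances of increments written through \<gamma> by polarization. It enters the tilted moment
  generating function without a factor 1/2 because \<open>Z\<close> carries the factor sqrt
  2.\<close>

definition qf :: "real \<Rightarrow> 'i set \<Rightarrow> ('i \<Rightarrow> real) \<Rightarrow> ('i \<Rightarrow> real) \<Rightarrow> real" where
  "qf c I \<tau> b = (\<Sum>i\<in>I. \<Sum>j\<in>I. b i * b j * ((\<gamma> (\<tau> i) c + \<gamma> (\<tau> j) c - \<gamma> (\<tau> i) (\<tau> j)) / 2))"

text \<open>Half the variance of the Gaussian exponent \<open>U\<close> is v c, plus twice the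
  covariance of \<open>Y c\<close> with \<open>V\<close>, plus the quadratic form. All terms with v
  cancel against the mean correction \<open>m\<close>, and only \<gamma> survives.\<close>

lemma tilted_mgf:
  fixes \<tau> b :: "'i \<Rightarrow> real"
  assumes "finite I" "c \<ge> 0" "\<And>i. i \<in> I \<Longrightarrow> \<tau> i \<ge> 0"
  shows "integrable M (\<lambda>\<omega>. exp (Z c \<omega> + (\<Sum>i\<in>I. b i * (Z (\<tau> i) \<omega> - Z c \<omega>))))" (is ?int)
    and "expectation (\<lambda>\<omega>. exp (Z c \<omega> + (\<Sum>i\<in>I. b i * (Z (\<tau> i) \<omega> - Z c \<omega>)))) =
      exp (qf c I \<tau> b - (\<Sum>i\<in>I. b i * \<gamma> (\<tau> i) c))" (is ?eq)
proof -
  define V where "V \<omega> = (\<Sum>i\<in>I. b i * (Y (\<tau> i) \<omega> - Y c \<omega>))" for \<omega>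
  define U where "U \<omega> = sqrt 2 * (Y c \<omega> + V \<omega>)" for \<omega>
  define m where "m = v c + (\<Sum>i\<in>I. b i * (v (\<tau> i) - v c))"
  have V: "V \<in> linear_forms"
    unfolding V_def[abs_def] using assms
    by (intro linear_forms_sum linear_forms_mult linear_forms_diff linear_forms_value) auto
  have Yc: "Y c \<in> linear_forms" using assms by (intro linear_forms_value)
  have U: "U \<in> linear_forms"
    unfolding U_def[abs_def] using V Yc by (intro linear_forms_mult linear_forms_add)
  have eq: "Z c \<omega> + (\<Sum>i\<in>I. b i * (Z (\<tau> i) \<omega> - Z c \<omega>)) = U \<omega> - m" for \<omega>
    by (simp add: Z_def U_def V_def m_def algebra_simps sum.distrib sum_subtractf sum_distrib_left)
  have inc: "(\<lambda>\<omega>. Y (\<tau> i) \<omega> - Y c \<omega>) \<in> linear_forms" if "i \<in> I" for i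
    using assms that by (intro linear_forms_diff linear_forms_value) auto
  have cV: "expectation (\<lambda>\<omega>. Y c \<omega> * V \<omega>) = (\<Sum>i\<in>I. b i * ((v (\<tau> i) - v c - \<gamma> (\<tau> i) c) / 2))"
  proof -
    have "expectation (\<lambda>\<omega>. Y c \<omega> * V \<omega>) =
      expectation (\<lambda>\<omega>. \<Sum>i\<in>I. b i * (Y c \<omega> * (Y (\<tau> i) \<omega> - Y c \<omega>)))"
      by (simp add: V_def sum_distrib_left mult_ac)
    also have "\<dots> = (\<Sum>i\<in>I. b i * expectation (\<lambda>\<omega>. Y c \<omega> * (Y (\<tau> i) \<omega> - Y c \<omega>)))"
      by (subst Bochner_Integration.integral_sum)
        (auto intro!: integrable_mult_right integrable_mult_linear_forms Yc inc)
    also have "\<dots> = (\<Sum>i\<in>I. b i * ((v (\<tau> i) - v c - \<gamma> (\<tau> i) c) / 2))"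
      using assms by (intro sum.cong) (auto simp: expectation_increment_mult_center)
    finally show ?thesis .
  qed
  have VV: "expectation (\<lambda>\<omega>. V \<omega> * V \<omega>) = qf c I \<tau> b"
  proof -
    have "expectation (\<lambda>\<omega>. V \<omega> * V \<omega>) = expectation (\<lambda>\<omega>. \<Sum>i\<in>I. \<Sum>j\<in>I.
        b i * b j * ((Y (\<tau> i) \<omega> - Y c \<omega>) * (Y (\<tau> j) \<omega> - Y c \<omega>)))"
      by (simp add: V_def sum_product mult_ac)
    also have "\<dots> = (\<Sum>i\<in>I. \<Sum>j\<in>I. expectation (\<lambda>\<omega>.
        b i * b j * ((Y (\<tau> i) \<omega> - Y c \<omega>) * (Y (\<tau> j) \<omega> - Y c \<omega>))))"
    proof -
      have i: "integrable M (\<lambda>\<omega>. b i * b j * ((Y (\<tau> i) \<omega> - Y c \<omega>) * (Y (\<tau> j) \<omega> - Y c \<omega>)))"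
        if "i \<in> I" "j \<in> I" for i j
        using that by (intro integrable_mult_right integrable_mult_linear_forms inc)
      then show ?thesis
        by (subst Bochner_Integration.integral_sum, simp, intro sum.cong refl Bochner_Integration.integral_sum)
    qed
    also have "\<dots> = qf c I \<tau> b"
      unfolding qf_def using assms by (intro sum.cong) (auto simp: expectation_increment_mult)
    finally show ?thesis .
  qed
  have UU: "expectation (\<lambda>\<omega>. (U \<omega>)\<^sup>2) / 2 = v c + 2 * expectation (\<lambda>\<omega>. Y c \<omega> * V \<omega>) + qf c I \<tau> b"
  proof -
    note [simp] = integrable_mult_linear_forms[OF Yc V] integrable_mult_linear_forms[OF Yc Yc]
      integrable_mult_linear_forms[OF V V]
    have "expectation (\<lambda>\<omega>. (U \<omega>)\<^sup>2) = expectation (\<lambda>\<omega>. 2 * (Y c \<omega> * Y c \<omega> + 2 * (Y c \<omega> * V \<omega>) + V \<omega> * V \<omega>))"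
      by (simp add: U_def power2_eq_square algebra_simps)
    also have "\<dots> = 2 * (v c + 2 * expectation (\<lambda>\<omega>. Y c \<omega> * V \<omega>) + qf c I \<tau> b)"
      by (simp add: VV v_def power2_eq_square)
    finally show ?thesis by simp
  qed
  show ?int
    unfolding eq exp_diff by (intro integrable_divide linear_form_facts U)
  have "expectation (\<lambda>\<omega>. exp (U \<omega> - m)) = exp (expectation (\<lambda>\<omega>. (U \<omega>)\<^sup>2) / 2) / exp m"
    unfolding exp_diff by (simp add: linear_form_facts U)
  also have "\<dots> = exp (qf c I \<tau> b - (\<Sum>i\<in>I. b i * \<gamma> (\<tau> i) c))"
  proof -
    have "2 * expectation (\<lambda>\<omega>. Y c \<omega> * V \<omega>) =
      (\<Sum>i\<in>I. b i * (v (\<tau> i) - v c)) - (\<Sum>i\<in>I. b i * \<gamma> (\<tau> i) c)"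
      unfolding cV sum_distrib_left sum_subtractf[symmetric]
      by (intro sum.cong) (simp_all add: field_simps)
    then show ?thesis by (simp add: UU m_def exp_diff[symmetric])
  qed
  finally show ?eq unfolding eq .
qed

section \<open>Moments and characteristic functions under the tilted measure\<close>

definition tilt :: "real \<Rightarrow> 'a measure" where
  "tilt c = density M (\<lambda>\<omega>. ennreal (exp (Z c \<omega>)))"

lemma expectation_exp_Z:
  assumes "c \<ge> 0"
  shows "integrable M (\<lambda>\<omega>. exp (Z c \<omega>))" "expectation (\<lambda>\<omega>. exp (Z c \<omega>)) = 1"
  using tilted_mgf[of "{}" c "\<lambda>_. 0" "\<lambda>_. 0"] assms by (auto simp: qf_def)

lemma tilt_prob_space: assumes "c \<ge> 0" shows "prob_space (tilt c)"
proof
  have "emeasure (tilt c) (space (tilt c)) = (\<integral>\<^sup>+ \<omega>. ennreal (exp (Z c \<omega>)) \<partial>M)"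
    using assms by (simp add: tilt_def emeasure_density cong: nn_integral_cong)
  also have "\<dots> = 1"
    using expectation_exp_Z[OF assms] by (subst nn_integral_eq_integral) auto
  finally show "emeasure (tilt c) (space (tilt c)) = 1" .
qed

lemma measurable_tilt [simp]: "borel_measurable (tilt c) = borel_measurable M"
  by (simp add: tilt_def measurable_def)

lemma integral_tilt:
  fixes f :: "'a \<Rightarrow> real"
  assumes "c \<ge> 0" "f \<in> borel_measurable M"
  shows "integral\<^sup>L (tilt c) f = expectation (\<lambda>\<omega>. exp (Z c \<omega>) * f \<omega>)"
    and "integrable (tilt c) f \<longleftrightarrow> integrable M (\<lambda>\<omega>. exp (Z c \<omega>) * f \<omega>)"
  using assms by (simp_all add: tilt_def integral_density integrable_density)

lemma tilt_exp:
  fixes \<tau> b :: "'i \<Rightarrow> real"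
  assumes "finite I" "c \<ge> 0" "\<And>i. i \<in> I \<Longrightarrow> \<tau> i \<ge> 0"
  shows "integrable (tilt c) (\<lambda>\<omega>. exp (\<Sum>i\<in>I. b i * (Z (\<tau> i) \<omega> - Z c \<omega>)))"
    and "(LINT \<omega>|tilt c. exp (\<Sum>i\<in>I. b i * (Z (\<tau> i) \<omega> - Z c \<omega>))) =
      exp (qf c I \<tau> b - (\<Sum>i\<in>I. b i * \<gamma> (\<tau> i) c))"
proof -
  have [measurable]: "(\<lambda>\<omega>. exp (\<Sum>i\<in>I. b i * (Z (\<tau> i) \<omega> - Z c \<omega>))) \<in> borel_measurable M"
    using assms by (intro borel_measurable_exp[THEN measurable_compose_rev] borel_measurable_sum) auto
  show "integrable (tilt c) (\<lambda>\<omega>. exp (\<Sum>i\<in>I. b i * (Z (\<tau> i) \<omega> - Z c \<omega>)))"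
    and "(LINT \<omega>|tilt c. exp (\<Sum>i\<in>I. b i * (Z (\<tau> i) \<omega> - Z c \<omega>))) =
      exp (qf c I \<tau> b - (\<Sum>i\<in>I. b i * \<gamma> (\<tau> i) c))"
    using tilted_mgf[OF assms(1,2), of \<tau> b, OF assms(3)] assms(2) by (simp_all add: integral_tilt exp_add)
qed

text \<open>Both factors on the right are continuous in finitely many values of \<gamma>, so
  pointwise convergence of variograms carries over to characteristic functions.\<close>

lemma tilt_cos:
  fixes \<tau> b :: "'i \<Rightarrow> real"
  assumes "finite I" "c \<ge> 0" "\<And>i. i \<in> I \<Longrightarrow> \<tau> i \<ge> 0"
  shows "(LINT \<omega>|tilt c. cos (x + (\<Sum>i\<in>I. b i * (Z (\<tau> i) \<omega> - Z c \<omega>)))) =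
      exp (- qf c I \<tau> b) * cos (x - (\<Sum>i\<in>I. b i * \<gamma> (\<tau> i) c))"
proof -
  interpret T: prob_space "tilt c" by (rule tilt_prob_space) fact
  have scale: "y * (\<Sum>i\<in>I. b i * (Z (\<tau> i) \<omega> - Z c \<omega>)) = (\<Sum>i\<in>I. (y * b i) * (Z (\<tau> i) \<omega> - Z c \<omega>))" for y \<omega>
    by (simp add: sum_distrib_left mult.assoc)
  have q: "qf c I \<tau> (\<lambda>i. y * b i) = qf c I \<tau> b * y\<^sup>2" for y
    by (simp add: qf_def sum_distrib_left sum_distrib_right power2_eq_square mult_ac)
  have "(LINT \<omega>|tilt c. cos (x + (\<Sum>i\<in>I. b i * (Z (\<tau> i) \<omega> - Z c \<omega>)))) =
    exp (- qf c I \<tau> b) * cos (x + - (\<Sum>i\<in>I. b i * \<gamma> (\<tau> i) c))"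
  proof (rule T.expectation_cos_of_mgf)
    show "(\<lambda>\<omega>. \<Sum>i\<in>I. b i * (Z (\<tau> i) \<omega> - Z c \<omega>)) \<in> borel_measurable (tilt c)"
      using assms by (auto intro!: borel_measurable_sum)
    show "integrable (tilt c) (\<lambda>\<omega>. exp (y * (\<Sum>i\<in>I. b i * (Z (\<tau> i) \<omega> - Z c \<omega>))))" for y
      unfolding scale by (intro tilt_exp assms)
    show "(LINT \<omega>|tilt c. exp (y * (\<Sum>i\<in>I. b i * (Z (\<tau> i) \<omega> - Z c \<omega>)))) =
      exp (- (\<Sum>i\<in>I. b i * \<gamma> (\<tau> i) c) * y + qf c I \<tau> b * y\<^sup>2)" for y
      unfolding scale using assms
      by (subst tilt_exp) (auto simp: q sum_distrib_left sum_distrib_right mult_ac)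
  qed
  then show ?thesis by simp
qed

text \<open>The two-point case, with \<open>bool\<close> as index type. For t = c the exponent is
  (y^2 - y) * \<gamma> s c, which vanishes at y = 1 and is most negative at y = 1 / 2.\<close>

lemma tilt_exp_increment:
  assumes "c \<ge> 0" "s \<ge> 0" "t \<ge> 0"
  shows "integrable (tilt c) (\<lambda>\<omega>. exp (y * (Z s \<omega> - Z t \<omega>)))"
    and "(LINT \<omega>|tilt c. exp (y * (Z s \<omega> - Z t \<omega>))) = exp (y\<^sup>2 * \<gamma> s t + y * (\<gamma> t c - \<gamma> s c))"
proof -
  define \<tau> where "\<tau> i = (if i then s else t)" for i
  define b where "b i = (if i then y else - y)" for i
  have eq: "(\<Sum>i\<in>UNIV. b i * (Z (\<tau> i) \<omega> - Z c \<omega>)) = y * (Z s \<omega> - Z t \<omega>)" for \<omega>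
    by (simp add: UNIV_bool b_def \<tau>_def algebra_simps)
  have q: "qf c UNIV \<tau> b = y\<^sup>2 * \<gamma> s t"
    by (simp add: qf_def UNIV_bool b_def \<tau>_def power2_eq_square algebra_simps \<gamma>_commute[of t s] add_divide_distrib diff_divide_distrib)
  have l: "(\<Sum>i\<in>UNIV. b i * \<gamma> (\<tau> i) c) = - (y * (\<gamma> t c - \<gamma> s c))"
    by (simp add: UNIV_bool b_def \<tau>_def algebra_simps)
  have \<tau>: "\<tau> i \<ge> 0" for i using assms by (simp add: \<tau>_def)
  show "integrable (tilt c) (\<lambda>\<omega>. exp (y * (Z s \<omega> - Z t \<omega>)))"
    and "(LINT \<omega>|tilt c. exp (y * (Z s \<omega> - Z t \<omega>))) = exp (y\<^sup>2 * \<gamma> s t + y * (\<gamma> t c - \<gamma> s c))"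
    using tilt_exp[where I = UNIV and \<tau> = \<tau> and b = b and c = c, OF finite assms(1) \<tau>] by (simp_all add: eq q l)
qed

text \<open>The bound \<open>square_le_exp\<close> is integrated by means of y = 1 and y = -1, where
  the exponent is 0 and 2 * \<gamma> t c.\<close>

lemma tilt_square:
  assumes "c \<ge> 0" "t \<ge> 0"
  shows "integrable (tilt c) (\<lambda>\<omega>. (Z t \<omega> - Z c \<omega>)\<^sup>2)"
    and "(LINT \<omega>|tilt c. (Z t \<omega> - Z c \<omega>)\<^sup>2) \<le> 2 * (1 + exp (2 * \<gamma> t c))"
proof -
  note e = tilt_exp_increment[OF assms(1,2,1), of 1] tilt_exp_increment[OF assms(1,2,1), of "-1"]
  show i: "integrable (tilt c) (\<lambda>\<omega>. (Z t \<omega> - Z c \<omega>)\<^sup>2)"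
  proof (rule Bochner_Integration.integrable_bound)
    show "integrable (tilt c) (\<lambda>\<omega>. 2 * (exp (1 * (Z t \<omega> - Z c \<omega>)) + exp (- 1 * (Z t \<omega> - Z c \<omega>))))"
      by (intro integrable_mult_right Bochner_Integration.integrable_add e)
    show "AE \<omega> in tilt c. norm ((Z t \<omega> - Z c \<omega>)\<^sup>2)
      \<le> norm (2 * (exp (1 * (Z t \<omega> - Z c \<omega>)) + exp (- 1 * (Z t \<omega> - Z c \<omega>))))"
    proof (rule always_eventually, rule allI)
      fix \<omega>
      show "norm ((Z t \<omega> - Z c \<omega>)\<^sup>2) \<le> norm (2 * (exp (1 * (Z t \<omega> - Z c \<omega>)) + exp (- 1 * (Z t \<omega> - Z c \<omega>))))"
        using square_le_exp[of "Z t \<omega> - Z c \<omega>"] by (simp del: minus_diff_eq)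
    qed
  qed (use assms in simp)
  have "(LINT \<omega>|tilt c. (Z t \<omega> - Z c \<omega>)\<^sup>2) \<le>
    (LINT \<omega>|tilt c. 2 * (exp (1 * (Z t \<omega> - Z c \<omega>)) + exp (- 1 * (Z t \<omega> - Z c \<omega>))))"
  proof (rule integral_mono[OF i])
    show "integrable (tilt c) (\<lambda>\<omega>. 2 * (exp (1 * (Z t \<omega> - Z c \<omega>)) + exp (- 1 * (Z t \<omega> - Z c \<omega>))))"
      by (intro integrable_mult_right Bochner_Integration.integrable_add e)
    show "(Z t \<omega> - Z c \<omega>)\<^sup>2 \<le> 2 * (exp (1 * (Z t \<omega> - Z c \<omega>)) + exp (- 1 * (Z t \<omega> - Z c \<omega>)))" for \<omega>
      using square_le_exp[of "Z t \<omega> - Z c \<omega>"] by (simp del: minus_diff_eq)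
  qed
  also have "\<dots> = 2 * (1 + exp (2 * \<gamma> t c))"
    unfolding integral_mult_right_zero Bochner_Integration.integral_add[OF e(1) e(3)] e(2,4) by simp
  finally show "(LINT \<omega>|tilt c. (Z t \<omega> - Z c \<omega>)\<^sup>2) \<le> 2 * (1 + exp (2 * \<gamma> t c))" .
qed

end

subsection \<open>Dyadic chaining\<close>

text \<open>When the level grows by one, the binary truncation of t stays put or moves to an
  adjacent dyadic point, so the increments are dominated by a geometric series; continuity carries
  the bound to t itself.\<close>

lemma dyadic_chaining:
  fixes z :: "real \<Rightarrow> real"
  assumes cont: "continuous_on {k..k + 1} z" and r: "0 < r" "r < 1" and "K \<ge> 0"
    and inc: "\<And>j i. i < 2 ^ j \<Longrightarrow> \<bar>z (k + (real i + 1) / 2 ^ j) - z (k + real i / 2 ^ j)\<bar> \<le> K * r ^ j"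
    and t: "t \<in> {k..k + 1}"
  shows "\<exists>i\<le>2 ^ m. \<bar>z t - z (k + real i / 2 ^ m)\<bar> \<le> K * r ^ m / (1 - r)"
proof -
  define x where "x = t - k"
  have x: "0 \<le> x" "x \<le> 1" using t by (auto simp: x_def)
  \<comment> \<open>At the right endpoint t = k + 1 this equals 2^j, which is why the conclusion
    allows i = 2^m.\<close>
  define n where "n j = nat \<lfloor>x * 2 ^ j\<rfloor>" for j :: nat
  define p where "p j = k + real (n j) / 2 ^ j" for j
  have n1: "real (n j) \<le> x * 2 ^ j" and n2: "x * 2 ^ j < real (n j) + 1" for j
    using x by (auto simp: n_def of_nat_floor)
  have n_le: "n j \<le> 2 ^ j" for j
  proof -
    have "x * 2 ^ j \<le> 1 * 2 ^ j" using x by (intro mult_right_mono) auto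
    with n1[of j] have "real (n j) \<le> real (2 ^ j)" unfolding of_nat_power of_nat_numeral by linarith
    then show ?thesis by (simp only: of_nat_le_iff)
  qed
  have step: "\<bar>z (p (Suc j)) - z (p j)\<bar> \<le> K * r ^ Suc j" for j
  proof -
    have "real (n (Suc j)) < 2 * real (n j) + 2" "2 * real (n j) < real (n (Suc j)) + 1"
      using n1[of "Suc j"] n2[of j] n2[of "Suc j"] n1[of j] by auto
    then have "n (Suc j) = 2 * n j \<or> n (Suc j) = 2 * n j + 1" by linarith
    then show ?thesis
    proof
      assume "n (Suc j) = 2 * n j"
      then have "p (Suc j) = p j" by (simp add: p_def)
      then show ?thesis using r \<open>K \<ge> 0\<close> by simp
    next
      assume n: "n (Suc j) = 2 * n j + 1"
      have "2 * n j < 2 ^ Suc j" using n_le[of "Suc j"] n by simp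
      from inc[OF this] have "\<bar>z (k + (real (2 * n j) + 1) / 2 ^ Suc j) - z (k + real (2 * n j) / 2 ^ Suc j)\<bar> \<le> K * r ^ Suc j" .
      moreover have "k + (real (2 * n j) + 1) / 2 ^ Suc j = p (Suc j)" by (simp add: p_def n)
      moreover have "k + real (2 * n j) / 2 ^ Suc j = p j" by (simp add: p_def)
      ultimately show ?thesis by simp
    qed
  qed
  have tel: "\<bar>z (p (m + l)) - z (p m)\<bar> \<le> K * r ^ m * (1 - r ^ l) / (1 - r)" for l
  proof (induction l)
    case (Suc l)
    have "\<bar>z (p (m + Suc l)) - z (p m)\<bar> \<le> K * r ^ (m + l) + K * r ^ m * (1 - r ^ l) / (1 - r)"
    proof -
      have "K * r ^ Suc (m + l) \<le> K * r ^ (m + l)"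
        using r \<open>K \<ge> 0\<close> by (intro mult_left_mono power_decreasing) auto
      with step[of "m + l"] Suc show ?thesis by simp
    qed
    also have "\<dots> = K * r ^ m * (1 - r ^ Suc l) / (1 - r)"
      using r by (simp add: field_simps power_add)
    finally show ?case .
  qed simp
  have "p \<longlonglongrightarrow> t"
  proof (rule real_tendsto_sandwich)
    have "k + x - 1 / 2 ^ j \<le> p j" for j
    proof -
      have "x \<le> (real (n j) + 1) / 2 ^ j" using n2[of j] by (simp add: pos_le_divide_eq)
      then show ?thesis by (simp add: p_def add_divide_distrib)
    qed
    then show "eventually (\<lambda>j. k + x - (1 / 2) ^ j \<le> p j) sequentially"
      by (simp add: power_one_over)
    show "eventually (\<lambda>j. p j \<le> t) sequentially"
      using n1 by (simp add: p_def x_def field_simps)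
    have "(\<lambda>j. k + x - (1 / 2) ^ j) \<longlonglongrightarrow> k + x - 0"
      by (intro tendsto_intros LIMSEQ_realpow_zero) auto
    then show "(\<lambda>j. k + x - (1 / 2) ^ j) \<longlonglongrightarrow> t" by (simp add: x_def)
  qed simp
  moreover have "p j \<in> {k..k + 1}" for j
  proof -
    have "real (n j) \<le> real (2 ^ j)" using n_le[of j] by (simp only: of_nat_le_iff)
    then have "real (n j) / 2 ^ j \<le> 1" by simp
    then show ?thesis by (simp add: p_def)
  qed
  ultimately have "(\<lambda>j. z (p j)) \<longlonglongrightarrow> z t"
    using cont t unfolding continuous_on_sequentially by (auto simp: o_def)
  then have "(\<lambda>l. z (p (m + l))) \<longlonglongrightarrow> z t"
    by (rule LIMSEQ_ignore_initial_segment[of _ _ m, unfolded add.commute[of _ m]])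
  then have "(\<lambda>l. \<bar>z (p (m + l)) - z (p m)\<bar>) \<longlonglongrightarrow> \<bar>z t - z (p m)\<bar>"
    by (intro tendsto_intros)
  moreover have "\<bar>z (p (m + l)) - z (p m)\<bar> \<le> K * r ^ m / (1 - r)" for l
  proof -
    have "K * r ^ m * (1 - r ^ l) / (1 - r) \<le> K * r ^ m * 1 / (1 - r)"
      using r \<open>K \<ge> 0\<close> by (intro divide_right_mono mult_left_mono) auto
    with tel[of l] show ?thesis by simp
  qed
  ultimately have "\<bar>z t - z (p m)\<bar> \<le> K * r ^ m / (1 - r)"
    by (intro LIMSEQ_le_const2) auto
  with n_le[of m] show ?thesis unfolding p_def by blast
qed

text \<open>If u r^j \<le> 1 the first summand suffices. Otherwise (u r^j)^p is at least 1 and u^p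
  \<le> p! exp u, so the second takes over. Its weight 4^-j beats the 2^j dyadic intervals of level
  j, which later allows a sum to replace a maximum over all of them.\<close>

lemma exp_mult_le_split:
  fixes u r l :: real
  assumes "0 \<le> u" "0 < r" "r < 1" "r ^ p \<le> 1 / 4" "l \<ge> 0"
  shows "exp (l * (u * r ^ j)) \<le> exp l + fact p * (1 / 4) ^ j * exp ((l + 1) * u)"
proof (cases "u * r ^ j \<le> 1")
  case True
  then have "exp (l * (u * r ^ j)) \<le> exp (l * 1)" using assms(5) by (simp add: mult_left_mono del: mult_1_right)
  then show ?thesis by (simp add: add_increasing2)
next
  case False
  have "1 \<le> (u * r ^ j) ^ p" using False by (intro one_le_power) auto
  also have "\<dots> = u ^ p * (r ^ p) ^ j" by (simp add: power_mult_distrib power_mult[symmetric] mult.commute)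
  also have "\<dots> \<le> (fact p * exp u) * (1 / 4) ^ j"
    using assms by (intro mult_mono power_le_fact_exp power_mono) auto
  finally have 1: "1 \<le> fact p * (1 / 4) ^ j * exp u" by (simp add: mult_ac)
  have "r ^ j \<le> 1" using assms by (intro power_le_one) auto
  then have "u * r ^ j \<le> u * 1" using assms by (intro mult_left_mono) auto
  then have "exp (l * (u * r ^ j)) \<le> exp (l * u) * 1" using assms(5) by (simp add: mult_left_mono)
  also have "\<dots> \<le> exp (l * u) * (fact p * (1 / 4) ^ j * exp u)"
    using 1 by (intro mult_left_mono) auto
  also have "\<dots> = fact p * (1 / 4) ^ j * exp ((l + 1) * u)"
    unfolding distrib_right mult_1_left exp_add by (simp add: mult_ac)
  finally show ?thesis by (simp add: add_increasing)
qed

text \<open>For the processes below, r^(2 j) is the scale of the standard deviation of an increment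
  at level j, so the quotients have bounded exponential moments. Chaining asks only for increments
  of order r^j; the spare factor r^j is what makes the moments summable over all dyadic
  points.\<close>

definition dyadic_quot :: "real \<Rightarrow> real \<Rightarrow> (real \<Rightarrow> real) \<Rightarrow> nat \<Rightarrow> nat \<Rightarrow> real" where
  "dyadic_quot r k z j i = \<bar>z (k + (real i + 1) / 2 ^ j) - z (k + real i / 2 ^ j)\<bar> / r ^ (2 * j)"

text \<open>This dominates an exponential moment of the Hoelder constant of \<open>z\<close> over the dyadic points
  of \<open>{k..k + 1}\<close>, which controls both the size of \<open>z\<close> and its oscillation at small scales.\<close>

definition holder_moment :: "nat \<Rightarrow> real \<Rightarrow> real \<Rightarrow> (real \<Rightarrow> real) \<Rightarrow> ennreal" where
  "holder_moment p r k z = ennreal (exp (2 / (1 - r) + 1)) +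
     (\<Sum>j. \<Sum>i<2 ^ j. ennreal (fact p * (1 / 4) ^ j * exp ((2 / (1 - r) + 2) * dyadic_quot r k z j i)))"

text \<open>A finite moment g bounds the dyadic increments by K r^j with K = ln g / l. Chaining from
  level m then contributes the factor r^m, and g absorbs the exponentials of K; an infinite moment
  leaves nothing to prove. The factor exp (z k) is kept apart so that it can become the density of a
  tilt.\<close>

lemma exp_le_dyadic_max:
  fixes z :: "real \<Rightarrow> real" and r k :: real and p :: nat
  assumes cont: "continuous_on {k..k + 1} z" and r: "0 < r" "r < 1" "r ^ p \<le> 1 / 4"
    and t: "t \<in> {k..k + 1}"
  shows "\<exists>i\<le>2 ^ m. ennreal (exp (z t)) \<le> ennreal (exp (z (k + real i / 2 ^ m)))
    + ennreal (r ^ m / (1 - r) * exp (z k)) * holder_moment p r k z"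
proof -
  \<comment> \<open>The share 2 / (1 - r) pays for exp (z t) \<le> exp (z k) * exp (2 / (1 - r) *
    K), the share 1 for K \<le> exp K.\<close>
  define l where "l = 2 / (1 - r) + 1"
  define u where "u = dyadic_quot r k z"
  define G where G: "G = holder_moment p r k z"
  have G_def: "G = ennreal (exp l) + (\<Sum>j. \<Sum>i<2 ^ j. ennreal (fact p * (1 / 4) ^ j * exp ((l + 1) * u j i)))"
    by (simp add: G holder_moment_def l_def u_def add.assoc)
  have u_def: "u j i = \<bar>z (k + (real i + 1) / 2 ^ j) - z (k + real i / 2 ^ j)\<bar> / r ^ (2 * j)" for j i
    by (simp add: u_def dyadic_quot_def)
  have "\<exists>i\<le>2 ^ m. ennreal (exp (z t)) \<le> ennreal (exp (z (k + real i / 2 ^ m)))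
    + ennreal (r ^ m / (1 - r) * exp (z k)) * G"
  proof (cases "G = \<top>")
    case True
    have "r ^ m / (1 - r) * exp (z k) > 0" using r by simp
    with True have "ennreal (r ^ m / (1 - r) * exp (z k)) * G = \<top>"
      using r by (simp add: ennreal_mult_top)
    then show ?thesis by (intro exI[of _ 0]) simp
  next
    case False
    then obtain g where g: "G = ennreal g" "g \<ge> 0" by (cases G) auto
    have l: "l \<ge> 1" using r by (simp add: l_def)
    have u: "u j i \<ge> 0" for j i using r by (simp add: u_def)
    have "ennreal (exp l) \<le> G" unfolding G_def by simp
    with g have gl: "exp l \<le> g" by (simp add: ennreal_le_iff)
    have g_term: "exp (l * (u j i * r ^ j)) \<le> g" if "i < 2 ^ j" for i j
    proof -
      define f where "f j = (\<Sum>i<2 ^ j. ennreal (fact p * (1 / 4) ^ j * exp ((l + 1) * u j i)))" for j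
      have "ennreal (fact p * (1 / 4) ^ j * exp ((l + 1) * u j i)) \<le> f j"
        unfolding f_def using that by (intro member_le_sum) auto
      also have "f j = sum f {j}" by simp
      also have "\<dots> \<le> (\<Sum>j. f j)" by (intro sum_le_suminf) auto
      finally have "ennreal (exp l) + ennreal (fact p * (1 / 4) ^ j * exp ((l + 1) * u j i)) \<le> G"
        unfolding G_def f_def by (intro add_left_mono)
      then have "exp l + fact p * (1 / 4) ^ j * exp ((l + 1) * u j i) \<le> g"
        using g by (simp add: ennreal_plus[symmetric] ennreal_le_iff del: ennreal_plus)
      with exp_mult_le_split[OF u[of j i] r, of l j] l show ?thesis by simp
    qed
    have "0 < g" "1 \<le> g" using gl l exp_gt_zero[of l] one_le_exp_iff[of l] by linarith+
    define K where "K = ln g / l"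
    have K: "K \<ge> 0" using \<open>1 \<le> g\<close> l by (simp add: K_def)
    have gK: "exp (l * K) = g" using l \<open>0 < g\<close> by (simp add: K_def)
    have inc: "\<bar>z (k + (real i + 1) / 2 ^ j) - z (k + real i / 2 ^ j)\<bar> \<le> K * r ^ j" if "i < 2 ^ j" for i j
    proof -
      have "l * (u j i * r ^ j) \<le> l * K" using g_term[OF that] by (simp add: gK[symmetric])
      then have "u j i * r ^ j \<le> K" using l by simp
      then have "u j i * r ^ j * r ^ j \<le> K * r ^ j" using r by (intro mult_right_mono) auto
      moreover have "u j i * r ^ j * r ^ j = \<bar>z (k + (real i + 1) / 2 ^ j) - z (k + real i / 2 ^ j)\<bar>"
        using r by (simp add: u_def power_mult power2_eq_square mult_2 power_add)
      ultimately show ?thesis by simp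
    qed
    \<comment> \<open>Chaining from level 0 starts at k or at k + 1; in the second case the
      increment over the whole interval costs another K, hence the factor 2.\<close>
    have diff0: "z t - z k \<le> 2 / (1 - r) * K"
    proof -
      obtain i where i: "i \<le> 2 ^ 0" "\<bar>z t - z (k + real i / 2 ^ 0)\<bar> \<le> K * r ^ 0 / (1 - r)"
        using dyadic_chaining[OF cont r(1,2) K inc t, of 0] by auto
      have "K \<le> K / (1 - r)" using r K by (simp add: field_simps mult_left_le)
      moreover have "\<bar>z (k + 1) - z k\<bar> \<le> K" using inc[of 0 0] by simp
      moreover have "i = 0 \<or> i = 1" using i by auto
      ultimately have "z t - z k \<le> K / (1 - r) + K / (1 - r)" using i(2) K by auto
      then show ?thesis by simp
    qed
    obtain i where i: "i \<le> 2 ^ m" "\<bar>z t - z (k + real i / 2 ^ m)\<bar> \<le> K * r ^ m / (1 - r)"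
      using dyadic_chaining[OF cont r(1,2) K inc t, of m] by auto
    define w where "w = z (k + real i / 2 ^ m)"
    \<comment> \<open>Convexity: exp lies above its tangent at z t.\<close>
    have "exp (z t) - exp w \<le> exp (z t) * (z t - w)"
      using mult_left_mono[OF exp_ge_add_one_self[of "w - z t"], of "exp (z t)"]
      by (simp add: exp_diff algebra_simps)
    also have "\<dots> \<le> exp (z t) * (K * r ^ m / (1 - r))"
      using i by (intro mult_left_mono) (auto simp: w_def)
    also have "\<dots> \<le> (exp (z k) * exp (2 / (1 - r) * K)) * (exp K * r ^ m / (1 - r))"
    proof (intro mult_mono divide_right_mono)
      show "exp (z t) \<le> exp (z k) * exp (2 / (1 - r) * K)"
        using diff0 by (simp add: exp_add[symmetric])
      show "K \<le> exp K" using exp_ge_add_one_self[of K] by linarith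
    qed (use r K in auto)
    also have "\<dots> = r ^ m / (1 - r) * exp (z k) * exp (l * K)"
      by (simp add: l_def distrib_right exp_add)
    finally have "exp (z t) \<le> exp w + r ^ m / (1 - r) * exp (z k) * g" by (simp add: gK)
    moreover have "ennreal (exp w + r ^ m / (1 - r) * exp (z k) * g) =
        ennreal (exp w) + ennreal (r ^ m / (1 - r) * exp (z k)) * G"
      using r g by (simp add: ennreal_mult'[symmetric] ennreal_plus[symmetric] del: ennreal_plus)
    ultimately have "ennreal (exp (z t)) \<le> ennreal (exp w) + ennreal (r ^ m / (1 - r) * exp (z k)) * G"
      using ennreal_leI by metis
    with i(1) show ?thesis unfolding w_def by blast
  qed
  then show ?thesis unfolding G .
qed

text \<open>Both the time-changed process and fractional Brownian motion are instances. The lower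
  bound makes distant grid points negligible, the upper bound drives chaining and second moments,
  the limit identifies windows far from the origin, and continuity of v makes the paths of
  \<open>Z\<close> continuous.\<close>

locale locally_fbm = centered_gaussian_process M Y
  for M :: "'a measure" and Y :: "real \<Rightarrow> 'a \<Rightarrow> real" and \<kappa> c C :: real +
  assumes \<kappa>_pos: "0 < \<kappa>" and c_pos: "0 < c" and C_pos: "0 < C"
    and \<gamma>_lower: "\<And>s t. s \<ge> 0 \<Longrightarrow> t \<ge> 0 \<Longrightarrow> c * \<bar>s - t\<bar> powr \<kappa> \<le> \<gamma> s t"
    and \<gamma>_upper: "\<And>s t. s \<ge> 0 \<Longrightarrow> t \<ge> 0 \<Longrightarrow> \<gamma> s t \<le> C * \<bar>s - t\<bar> powr \<kappa>"
    and \<gamma>_local: "\<And>u u'. ((\<lambda>s. \<gamma> (s + u) (s + u')) \<longlongrightarrow> \<bar>u - u'\<bar> powr \<kappa>) at_top"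
    and continuous_v: "continuous_on {0..} v"
begin

lemma AE_continuous_Z: "AE \<omega> in M. continuous_on {0..} (\<lambda>t. Z t \<omega>)"
  using continuous_paths
  by eventually_elim (auto simp: Z_def[abs_def] intro!: continuous_intros continuous_v)

text \<open>A difference of squared norms of a and b is the inner product of a - b and a + b, so
  Cauchy-Schwarz bounds it by a multiple of \<rho>. It is the drift that the tilt at x gives to Z s
  - Z t, which must stay on the scale of the standard deviation if normalized increments are to keep
  bounded exponential moments.\<close>

lemma \<gamma>_diff_le:
  assumes st: "s \<ge> 0" "t \<ge> 0" "x \<ge> 0" "\<bar>s - x\<bar> \<le> 1" "\<bar>t - x\<bar> \<le> 1"
    and \<rho>: "\<rho> > 0" "\<gamma> s t \<le> C * \<rho>\<^sup>2"
  shows "\<bar>\<gamma> t x - \<gamma> s x\<bar> \<le> 3 * C * \<rho>"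
proof -
  have *: "\<gamma> s x \<le> C" if "s \<ge> 0" "\<bar>s - x\<bar> \<le> 1" for s
  proof -
    have "C * \<bar>s - x\<bar> powr \<kappa> \<le> C * 1 powr \<kappa>"
      using that C_pos \<kappa>_pos by (intro mult_left_mono powr_mono2) auto
    with \<gamma>_upper[of s x] that st show ?thesis by simp
  qed
  define a where "a \<omega> = Y t \<omega> - Y x \<omega>" for \<omega>
  define b where "b \<omega> = Y s \<omega> - Y x \<omega>" for \<omega>
  have ab: "a \<in> linear_forms" "b \<in> linear_forms"
    unfolding a_def[abs_def] b_def[abs_def] using st by (auto intro!: linear_forms_diff linear_forms_value)
  note [simp] = integrable_mult_linear_forms[OF ab] integrable_mult_linear_forms[OF ab(1,1)]
    integrable_mult_linear_forms[OF ab(2,2)]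
  have E: "expectation (\<lambda>\<omega>. a \<omega> * a \<omega>) = \<gamma> t x" "expectation (\<lambda>\<omega>. b \<omega> * b \<omega>) = \<gamma> s x"
    by (simp_all add: a_def b_def \<gamma>_def power2_eq_square)
  have "\<gamma> s t = expectation (\<lambda>\<omega>. b \<omega> * b \<omega> - 2 * (a \<omega> * b \<omega>) + a \<omega> * a \<omega>)"
    unfolding \<gamma>_def by (intro arg_cong[where f = expectation] ext) (simp add: a_def b_def power2_eq_square algebra_simps)
  then have st_eq: "\<gamma> s t = \<gamma> s x - 2 * expectation (\<lambda>\<omega>. a \<omega> * b \<omega>) + \<gamma> t x"
    by (simp add: E)
  \<comment> \<open>Cauchy-Schwarz as a nonnegative quadratic in y, to be evaluated at 1 / \<rho>
    and -1 / \<rho>; this gives the constant 5 C / 2, which is rounded up to 3 C.\<close>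
  have sq: "0 \<le> y\<^sup>2 * \<gamma> s t + 2 * y * (\<gamma> t x - \<gamma> s x) + (\<gamma> t x + 2 * expectation (\<lambda>\<omega>. a \<omega> * b \<omega>) + \<gamma> s x)" for y
  proof -
    have "0 \<le> expectation (\<lambda>\<omega>. (y * (a \<omega> - b \<omega>) + (a \<omega> + b \<omega>))\<^sup>2)" by simp
    also have "\<dots> = expectation (\<lambda>\<omega>. (y + 1)\<^sup>2 * (a \<omega> * a \<omega>) + 2 * (1 - y\<^sup>2) * (a \<omega> * b \<omega>) + (1 - y)\<^sup>2 * (b \<omega> * b \<omega>))"
      by (intro arg_cong[where f = expectation] ext) (simp add: power2_eq_square algebra_simps)
    also have "\<dots> = (y + 1)\<^sup>2 * \<gamma> t x + 2 * (1 - y\<^sup>2) * expectation (\<lambda>\<omega>. a \<omega> * b \<omega>) + (1 - y)\<^sup>2 * \<gamma> s x"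
      by (simp add: E)
    finally show ?thesis unfolding st_eq by (simp add: power2_eq_square algebra_simps)
  qed
  have B: "\<gamma> t x + 2 * expectation (\<lambda>\<omega>. a \<omega> * b \<omega>) + \<gamma> s x \<le> 4 * C"
    using st_eq \<gamma>_nonneg[of s t] *[OF st(1,4)] *[OF st(2,5)] by linarith
  have y2: "(1 / \<rho>)\<^sup>2 * \<gamma> s t \<le> C" using \<rho> by (simp add: field_simps)
  have "\<bar>2 / \<rho> * (\<gamma> t x - \<gamma> s x)\<bar> \<le> 5 * C"
    using sq[of "1 / \<rho>"] sq[of "- (1 / \<rho>)"] B y2 by (simp add: abs_le_iff)
  then have "2 / \<rho> * \<bar>\<gamma> t x - \<gamma> s x\<bar> \<le> 5 * C" unfolding abs_mult using \<rho> by simp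
  then have "2 * \<bar>\<gamma> t x - \<gamma> s x\<bar> \<le> 5 * C * \<rho>" using \<rho> by (simp add: field_simps)
  moreover have "0 \<le> C * \<rho>" using C_pos \<rho> by simp
  ultimately show ?thesis by simp
qed

text \<open>In the exponent, y^2 C comes from the variance of the normalized increment and 3 y C
  from its drift; the factor 2 accounts for the two signs.\<close>

lemma tilt_exp_abs_increment:
  assumes st: "s \<ge> 0" "t \<ge> 0" "x \<ge> 0" "\<bar>s - x\<bar> \<le> 1" "\<bar>t - x\<bar> \<le> 1"
    and \<rho>: "\<rho> > 0" "\<gamma> s t \<le> C * \<rho>\<^sup>2" and "y \<ge> 0"
  shows "(\<integral>\<^sup>+\<omega>. ennreal (exp (y * (\<bar>Z s \<omega> - Z t \<omega>\<bar> / \<rho>))) \<partial>tilt x) \<le> ennreal (2 * exp (y\<^sup>2 * C + 3 * y * C))"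
proof -
  have e: "(\<integral>\<^sup>+\<omega>. ennreal (exp (a / \<rho> * (Z s \<omega> - Z t \<omega>))) \<partial>tilt x) \<le> ennreal (exp (y\<^sup>2 * C + 3 * y * C))"
    if "\<bar>a\<bar> = y" for a
  proof -
    have "(\<integral>\<^sup>+\<omega>. ennreal (exp (a / \<rho> * (Z s \<omega> - Z t \<omega>))) \<partial>tilt x) =
      ennreal (exp ((a / \<rho>)\<^sup>2 * \<gamma> s t + a / \<rho> * (\<gamma> t x - \<gamma> s x)))"
      using tilt_exp_increment[OF st(3,1,2), of "a / \<rho>"] by (subst nn_integral_eq_integral) auto
    also have "\<dots> \<le> ennreal (exp (y\<^sup>2 * C + 3 * y * C))"
    proof -
      have "(a / \<rho>)\<^sup>2 * \<gamma> s t = a\<^sup>2 * (\<gamma> s t / \<rho>\<^sup>2)" by (simp add: power_divide)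
      also have "\<dots> \<le> a\<^sup>2 * C" using \<rho> by (intro mult_left_mono) (auto simp: field_simps)
      also have "a\<^sup>2 = y\<^sup>2" using that by auto
      finally have 1: "(a / \<rho>)\<^sup>2 * \<gamma> s t \<le> y\<^sup>2 * C" .
      have "a / \<rho> * (\<gamma> t x - \<gamma> s x) \<le> \<bar>a / \<rho> * (\<gamma> t x - \<gamma> s x)\<bar>" by (rule abs_ge_self)
      also have "\<dots> = y / \<rho> * \<bar>\<gamma> t x - \<gamma> s x\<bar>" using \<rho> that by (simp add: abs_mult)
      also have "\<dots> \<le> y / \<rho> * (3 * C * \<rho>)"
        using \<gamma>_diff_le[OF st \<rho>] \<rho> \<open>y \<ge> 0\<close> by (intro mult_left_mono) auto
      also have "\<dots> = 3 * y * C" using \<rho> by simp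
      finally show ?thesis using 1 by (simp add: ennreal_leI)
    qed
    finally show ?thesis .
  qed
  have "(\<integral>\<^sup>+\<omega>. ennreal (exp (y * (\<bar>Z s \<omega> - Z t \<omega>\<bar> / \<rho>))) \<partial>tilt x) \<le>
    (\<integral>\<^sup>+\<omega>. ennreal (exp (y / \<rho> * (Z s \<omega> - Z t \<omega>))) + ennreal (exp (- y / \<rho> * (Z s \<omega> - Z t \<omega>))) \<partial>tilt x)"
  proof (rule nn_integral_mono)
    fix \<omega>
    have "y * (\<bar>Z s \<omega> - Z t \<omega>\<bar> / \<rho>) = \<bar>y / \<rho> * (Z s \<omega> - Z t \<omega>)\<bar>"
      using \<rho> \<open>y \<ge> 0\<close> by (simp add: abs_mult)
    then have "exp (y * (\<bar>Z s \<omega> - Z t \<omega>\<bar> / \<rho>)) \<le> exp (y / \<rho> * (Z s \<omega> - Z t \<omega>)) + exp (- y / \<rho> * (Z s \<omega> - Z t \<omega>))"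
      using exp_abs_le[of "y / \<rho> * (Z s \<omega> - Z t \<omega>)"] by simp
    then show "ennreal (exp (y * (\<bar>Z s \<omega> - Z t \<omega>\<bar> / \<rho>))) \<le>
      ennreal (exp (y / \<rho> * (Z s \<omega> - Z t \<omega>))) + ennreal (exp (- y / \<rho> * (Z s \<omega> - Z t \<omega>)))"
      by (simp add: ennreal_plus[symmetric] ennreal_leI del: ennreal_plus)
  qed
  also have "\<dots> = (\<integral>\<^sup>+\<omega>. ennreal (exp (y / \<rho> * (Z s \<omega> - Z t \<omega>))) \<partial>tilt x) +
      (\<integral>\<^sup>+\<omega>. ennreal (exp (- y / \<rho> * (Z s \<omega> - Z t \<omega>))) \<partial>tilt x)"
    using st by (intro nn_integral_add) auto
  also have "\<dots> \<le> ennreal (exp (y\<^sup>2 * C + 3 * y * C)) + ennreal (exp (y\<^sup>2 * C + 3 * y * C))"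
    using e[of y] e[of "- y"] \<open>y \<ge> 0\<close> by (intro add_mono) auto
  also have "\<dots> = ennreal (2 * exp (y\<^sup>2 * C + 3 * y * C))"
    by (simp add: ennreal_plus[symmetric] del: ennreal_plus)
  finally show ?thesis .
qed

end

subsection \<open>Comparison of the supremum with grid maxima\<close>

context centered_gaussian_process
begin

definition h :: "real \<Rightarrow> ennreal" where
  "h T = (\<integral>\<^sup>+ \<omega>. ennreal (exp (SUP t\<in>{0..T}. Z t \<omega>)) \<partial>M)"

definition grid_max :: "real \<Rightarrow> nat \<Rightarrow> 'a \<Rightarrow> real" where
  "grid_max \<eta> N \<omega> = Max ((\<lambda>i. exp (Z (\<eta> * real i) \<omega>)) ` {..N})"

definition g :: "real \<Rightarrow> nat \<Rightarrow> real" where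
  "g \<eta> N = expectation (grid_max \<eta> N)"

lemma measurable_grid_max [measurable]: "\<eta> \<ge> 0 \<Longrightarrow> grid_max \<eta> N \<in> borel_measurable M"
  unfolding grid_max_def[abs_def] by (intro borel_measurable_Max) auto

lemma grid_max_nonneg: "grid_max \<eta> N \<omega> \<ge> 0"
  unfolding grid_max_def by (rule less_imp_le[OF Max_exp_pos]) auto

lemma grid_max_ge: "i \<le> N \<Longrightarrow> exp (Z (\<eta> * real i) \<omega>) \<le> grid_max \<eta> N \<omega>"
  unfolding grid_max_def by (intro Max_ge) auto

lemma integrable_grid_max:
  assumes "\<eta> \<ge> 0" shows "integrable M (grid_max \<eta> N)"
proof (rule Bochner_Integration.integrable_bound)
  show "integrable M (\<lambda>\<omega>. \<Sum>i\<le>N. exp (Z (\<eta> * real i) \<omega>))"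
    using assms by (intro Bochner_Integration.integrable_sum expectation_exp_Z) auto
  show "AE \<omega> in M. norm (grid_max \<eta> N \<omega>) \<le> norm (\<Sum>i\<le>N. exp (Z (\<eta> * real i) \<omega>))"
    using grid_max_nonneg Max_le_sum_exp[of "{..N}" "\<lambda>i. Z (\<eta> * real i) _"]
    by (intro always_eventually allI) (simp add: sum_nonneg grid_max_def)
qed (use assms in measurable)

lemma nn_integral_grid_max:
  "\<eta> \<ge> 0 \<Longrightarrow> (\<integral>\<^sup>+ \<omega>. ennreal (grid_max \<eta> N \<omega>) \<partial>M) = ennreal (g \<eta> N)"
  unfolding g_def using grid_max_nonneg integrable_grid_max by (intro nn_integral_eq_integral) auto

end

lemma exp_SUP_attained:
  fixes z :: "real \<Rightarrow> real"
  assumes "continuous_on {0..} z" "T \<ge> 0"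
  obtains t where "t \<in> {0..T}" "(SUP t\<in>{0..T}. z t) = z t" "\<And>s. s \<in> {0..T} \<Longrightarrow> z s \<le> z t"
proof -
  have "continuous_on {0..T} z" by (rule continuous_on_subset[OF assms(1)]) auto
  then obtain t where t: "t \<in> {0..T}" "\<forall>s\<in>{0..T}. z s \<le> z t"
    using continuous_attains_sup[of "{0..T}" z] assms by auto
  then have "(SUP t\<in>{0..T}. z t) = z t" by (intro cSup_eq_maximum) auto
  with t that show thesis by auto
qed

section \<open>Sandwiching the supremum between grid maxima\<close>

context locally_fbm
begin

lemma h_mono:
  assumes "0 \<le> S" "S \<le> T" shows "h S \<le> h T"
  unfolding h_def
proof (rule nn_integral_mono_AE)
  show "AE \<omega> in M. ennreal (exp (SUP t\<in>{0..S}. Z t \<omega>)) \<le> ennreal (exp (SUP t\<in>{0..T}. Z t \<omega>))"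
    using AE_continuous_Z
  proof eventually_elim
    case (elim \<omega>)
    obtain s where s: "s \<in> {0..S}" "(SUP t\<in>{0..S}. Z t \<omega>) = Z s \<omega>"
      using exp_SUP_attained[OF elim \<open>0 \<le> S\<close>] by blast
    obtain t where t: "(SUP t\<in>{0..T}. Z t \<omega>) = Z t \<omega>" "\<And>s. s \<in> {0..T} \<Longrightarrow> Z s \<omega> \<le> Z t \<omega>"
      using exp_SUP_attained[OF elim, of T] assms by (metis order_trans)
    from s assms have "s \<in> {0..T}" by auto
    with s t show ?case by (simp add: ennreal_leI)
  qed
qed

lemma g_le_h:
  assumes "\<eta> \<ge> 0" "\<eta> * real N \<le> T" shows "ennreal (g \<eta> N) \<le> h T"
  unfolding h_def nn_integral_grid_max[OF assms(1), symmetric]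
proof (rule nn_integral_mono_AE)
  have "T \<ge> 0" using assms by (meson mult_nonneg_nonneg of_nat_0_le_iff order_trans)
  show "AE \<omega> in M. ennreal (grid_max \<eta> N \<omega>) \<le> ennreal (exp (SUP t\<in>{0..T}. Z t \<omega>))"
    using AE_continuous_Z
  proof eventually_elim
    case (elim \<omega>)
    obtain t where t: "(SUP t\<in>{0..T}. Z t \<omega>) = Z t \<omega>" "\<And>s. s \<in> {0..T} \<Longrightarrow> Z s \<omega> \<le> Z t \<omega>"
      using exp_SUP_attained[OF elim \<open>T \<ge> 0\<close>] by metis
    have "exp (Z (\<eta> * real i) \<omega>) \<le> exp (Z t \<omega>)" if "i \<le> N" for i
    proof -
      have "\<eta> * real i \<le> \<eta> * real N" using that assms by (intro mult_left_mono) auto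
      with assms have "\<eta> * real i \<in> {0..T}" by auto
      with t show ?thesis by simp
    qed
    then have "grid_max \<eta> N \<omega> \<le> exp (Z t \<omega>)" unfolding grid_max_def by (subst Max_le_iff) auto
    with t show ?case by (simp add: ennreal_leI)
  qed
qed

text \<open>Its square 2 powr (- \<kappa> / 2) is the factor by which the upper bound for the
  standard deviation of an increment shrinks when its length is halved.\<close>

definition chain_ratio :: real where "chain_ratio = 2 powr (- \<kappa> / 4)"

lemma chain_ratio: "0 < chain_ratio" "chain_ratio < 1"
  using \<kappa>_pos powr_less_mono[of "- \<kappa> / 4" 0 2] by (auto simp: chain_ratio_def)

lemma r_power: "(chain_ratio ^ (2 * j))\<^sup>2 = (1 / 2 ^ j) powr \<kappa>"
proof -
  have "(chain_ratio ^ (2 * j))\<^sup>2 = chain_ratio ^ (4 * j)"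
    unfolding power_mult[symmetric] by (simp add: mult_ac)
  also have "\<dots> = chain_ratio powr (4 * real j)"
    using powr_realpow[of chain_ratio "4 * j"] chain_ratio by simp
  also have "\<dots> = (2 powr (- real j)) powr \<kappa>"
    by (simp add: chain_ratio_def powr_powr mult.commute)
  also have "2 powr (- real j) = 1 / 2 ^ j"
    by (simp add: powr_minus powr_realpow field_simps)
  finally show ?thesis .
qed

definition chain_exp :: nat where "chain_exp = (SOME chain_exp. chain_ratio ^ chain_exp \<le> 1 / 4)"

lemma chain_exp: "chain_ratio ^ chain_exp \<le> 1 / 4"
proof -
  obtain n where "chain_ratio ^ n < 1 / 4" using real_arch_pow_inv[of "1 / 4" chain_ratio] chain_ratio by auto
  then show ?thesis unfolding chain_exp_def by (intro someI[of "\<lambda>chain_exp. chain_ratio ^ chain_exp \<le> 1 / 4" n]) simp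
qed

lemma measurable_dyadic_quot [measurable]:
  assumes "k \<ge> 0" shows "(\<lambda>\<omega>. dyadic_quot q k (\<lambda>t. Z t \<omega>) j i) \<in> borel_measurable M"
proof -
  have "Z (k + real i / 2 ^ j) \<in> borel_measurable M" "Z (k + (real i + 1) / 2 ^ j) \<in> borel_measurable M"
    using assms by (auto intro!: measurable_Z)
  then show ?thesis unfolding dyadic_quot_def
    by (intro borel_measurable_divide borel_measurable_abs borel_measurable_diff) auto
qed

lemma measurable_holder_moment [measurable]:
  "k \<ge> 0 \<Longrightarrow> (\<lambda>\<omega>. holder_moment chain_exp chain_ratio k (\<lambda>t. Z t \<omega>)) \<in> borel_measurable M"
  unfolding holder_moment_def by measurable

text \<open>The leading factor 2 of the second summand is the sum of 2^j * 4^-j over all levels; the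
  doubled exponential is the bound of \<open>tilt_exp_abs_increment\<close> at y = 2 / (1 -
  chain_ratio) + 2.\<close>

definition chain_const :: real where
  "chain_const = exp (2 / (1 - chain_ratio) + 1) +
     2 * (fact chain_exp * (2 * exp ((2 / (1 - chain_ratio) + 2)\<^sup>2 * C + 3 * (2 / (1 - chain_ratio) + 2) * C)))"

lemma chain_const_nonneg: "chain_const \<ge> 0" by (simp add: chain_const_def add_nonneg_nonneg)

text \<open>The tilt at k supplies the weight exp (Z k) that multiplies this moment in the pathwise
  bound. The estimate is uniform in k because only the upper bound on \<gamma> enters.\<close>

lemma holder_moment_le:
  assumes "k \<ge> 0"
  shows "(\<integral>\<^sup>+ \<omega>. holder_moment chain_exp chain_ratio k (\<lambda>t. Z t \<omega>) \<partial>tilt k) \<le> ennreal chain_const"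
proof -
  define y where "y = 2 / (1 - chain_ratio) + 2"
  define A where "A = 2 * exp (y\<^sup>2 * C + 3 * y * C)"
  define e where "e j i \<omega> = ennreal (fact chain_exp * (1 / 4) ^ j * exp (y * dyadic_quot chain_ratio k (\<lambda>t. Z t \<omega>) j i))"
    for j i \<omega>
  have [measurable]: "e j i \<in> borel_measurable M" for j i
    unfolding e_def[abs_def] using assms by measurable
  interpret T: prob_space "tilt k" by (rule tilt_prob_space) fact
  have "y \<ge> 0" using chain_ratio by (simp add: y_def)
  have bound: "(\<integral>\<^sup>+ \<omega>. e j i \<omega> \<partial>tilt k) \<le> ennreal (fact chain_exp * A * (1 / 4) ^ j)" if i: "i < 2 ^ j" for i j
  proof -
    define s where "s = k + (real i + 1) / 2 ^ j"
    define t where "t = k + real i / 2 ^ j"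
    have "real i + 1 \<le> 2 ^ j" using i by (metis Suc_leI of_nat_Suc of_nat_le_iff of_nat_numeral of_nat_power add.commute)
    then have "(real i + 1) / 2 ^ j \<le> 1" "real i / 2 ^ j \<le> 1"
      by (simp_all only: divide_le_eq_1_pos zero_less_power zero_less_numeral)
    then have st: "s \<ge> 0" "t \<ge> 0" "\<bar>s - k\<bar> \<le> 1" "\<bar>t - k\<bar> \<le> 1"
      using assms by (auto simp only: s_def t_def) (auto simp del: divide_le_eq_1_pos)
    have "s - t = 1 / 2 ^ j" by (simp add: s_def t_def add_divide_distrib)
    then have "\<gamma> s t \<le> C * (chain_ratio ^ (2 * j))\<^sup>2"
      using \<gamma>_upper[OF st(1,2)] by (simp add: r_power del: power_mult)
    from tilt_exp_abs_increment[OF st(1,2) assms st(3,4) _ this \<open>y \<ge> 0\<close>] chain_ratio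
    have *: "(\<integral>\<^sup>+ \<omega>. ennreal (exp (y * dyadic_quot chain_ratio k (\<lambda>t. Z t \<omega>) j i)) \<partial>tilt k) \<le> ennreal A"
      by (simp add: A_def dyadic_quot_def s_def t_def)
    have "(\<integral>\<^sup>+ \<omega>. e j i \<omega> \<partial>tilt k) =
      (\<integral>\<^sup>+ \<omega>. ennreal (fact chain_exp * (1 / 4) ^ j) * ennreal (exp (y * dyadic_quot chain_ratio k (\<lambda>t. Z t \<omega>) j i)) \<partial>tilt k)"
      by (simp add: e_def ennreal_mult')
    also have "\<dots> = ennreal (fact chain_exp * (1 / 4) ^ j) *
      (\<integral>\<^sup>+ \<omega>. ennreal (exp (y * dyadic_quot chain_ratio k (\<lambda>t. Z t \<omega>) j i)) \<partial>tilt k)"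
      using assms by (intro nn_integral_cmult) simp
    also have "\<dots> \<le> ennreal (fact chain_exp * (1 / 4) ^ j) * ennreal A"
      using * by (intro mult_left_mono) auto
    also have "\<dots> = ennreal (fact chain_exp * A * (1 / 4) ^ j)"
      by (subst ennreal_mult[symmetric]) (auto simp: A_def mult_ac)
    finally show ?thesis .
  qed
  have "(\<integral>\<^sup>+ \<omega>. holder_moment chain_exp chain_ratio k (\<lambda>t. Z t \<omega>) \<partial>tilt k) =
    (\<integral>\<^sup>+ \<omega>. ennreal (exp (2 / (1 - chain_ratio) + 1)) + (\<Sum>j. \<Sum>i<2 ^ j. e j i \<omega>) \<partial>tilt k)"
    by (simp add: holder_moment_def e_def y_def)
  also have "\<dots> = ennreal (exp (2 / (1 - chain_ratio) + 1)) + (\<Sum>j. \<Sum>i<2 ^ j. \<integral>\<^sup>+ \<omega>. e j i \<omega> \<partial>tilt k)"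
    by (simp add: nn_integral_add nn_integral_suminf nn_integral_sum T.emeasure_space_1)
  also have "\<dots> \<le> ennreal (exp (2 / (1 - chain_ratio) + 1)) + (\<Sum>j. \<Sum>i<(2::nat) ^ j. ennreal (fact chain_exp * A * (1 / 4) ^ j))"
    by (intro add_left_mono suminf_le sum_mono bound summableI) auto
  also have "(\<Sum>j. \<Sum>i<(2::nat) ^ j. ennreal (fact chain_exp * A * (1 / 4) ^ j)) = (\<Sum>j. ennreal (fact chain_exp * A * (1 / 2) ^ j))"
  proof (intro arg_cong[where f = suminf] ext)
    fix j :: nat
    have "(\<Sum>i<(2::nat) ^ j. ennreal (fact chain_exp * A * (1 / 4) ^ j)) = ennreal (\<Sum>i<(2::nat) ^ j. fact chain_exp * A * (1 / 4) ^ j)"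
      by (rule sum_ennreal) (simp add: A_def)
    also have "(\<Sum>i<(2::nat) ^ j. fact chain_exp * A * (1 / 4) ^ j) = fact chain_exp * A * (2 ^ j * (1 / 4) ^ j)" by simp
    also have "2 ^ j * (1 / 4) ^ j = (1 / 2 :: real) ^ j" by (simp add: power_mult_distrib[symmetric])
    finally show "(\<Sum>i<(2::nat) ^ j. ennreal (fact chain_exp * A * (1 / 4) ^ j)) = ennreal (fact chain_exp * A * (1 / 2) ^ j)" .
  qed
  also have "\<dots> = ennreal (fact chain_exp * A * 2)"
  proof (rule suminf_ennreal_eq)
    show "(\<lambda>j. fact chain_exp * A * (1 / 2) ^ j) sums (fact chain_exp * A * 2)"
      using sums_mult[OF geometric_sums[of "1 / 2 :: real"], of "fact chain_exp * A"] by simp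
  qed (simp add: A_def)
  also have "ennreal (exp (2 / (1 - chain_ratio) + 1)) + ennreal (fact chain_exp * A * 2) = ennreal chain_const"
    by (simp add: chain_const_def A_def y_def ennreal_plus[symmetric] mult_ac del: ennreal_plus)
  finally show ?thesis .
qed

text \<open>The unit interval that carries the maximum is random, so the chaining errors of all n
  intervals are added. The loss is harmless, since an error linear in n is acceptable.\<close>

lemma exp_SUP_le_grid_max:
  assumes "continuous_on {0..} (\<lambda>t. Z t \<omega>)" "n \<ge> 1"
  shows "ennreal (exp (SUP t\<in>{0..real n}. Z t \<omega>)) \<le> ennreal (grid_max (1 / 2 ^ m) (n * 2 ^ m) \<omega>) +
    (\<Sum>k<n. ennreal (chain_ratio ^ m / (1 - chain_ratio) * exp (Z (real k) \<omega>)) * holder_moment chain_exp chain_ratio (real k) (\<lambda>t. Z t \<omega>))"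
proof -
  obtain t where t: "t \<in> {0..real n}" "(SUP t\<in>{0..real n}. Z t \<omega>) = Z t \<omega>"
    by (rule exp_SUP_attained[OF assms(1) of_nat_0_le_iff])
  \<comment> \<open>The minimum with n - 1 assigns the endpoint t = n to the last unit
    interval.\<close>
  define k where "k = min (nat \<lfloor>t\<rfloor>) (n - 1)"
  have k: "k < n" "t \<in> {real k..real k + 1}"
  proof -
    show "k < n" using \<open>n \<ge> 1\<close> by (auto simp: k_def)
    have "real (nat \<lfloor>t\<rfloor>) \<le> t" using t by (simp add: of_nat_floor)
    then have "real k \<le> t" by (simp add: k_def min_def split: if_splits)
    moreover have "t < real (nat \<lfloor>t\<rfloor>) + 1" using t by auto
    then have "t \<le> real k + 1" using t \<open>n \<ge> 1\<close> by (auto simp: k_def min_def of_nat_diff)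
    ultimately show "t \<in> {real k..real k + 1}" by simp
  qed
  have "continuous_on {real k..real k + 1} (\<lambda>t. Z t \<omega>)"
    by (rule continuous_on_subset[OF assms(1)]) auto
  from exp_le_dyadic_max[OF this chain_ratio chain_exp k(2), of m] obtain i where i: "i \<le> 2 ^ m"
    "ennreal (exp (Z t \<omega>)) \<le> ennreal (exp (Z (real k + real i / 2 ^ m) \<omega>)) +
      ennreal (chain_ratio ^ m / (1 - chain_ratio) * exp (Z (real k) \<omega>)) * holder_moment chain_exp chain_ratio (real k) (\<lambda>t. Z t \<omega>)"
    by blast
  have "k * 2 ^ m + i \<le> n * 2 ^ m"
  proof -
    have "k * 2 ^ m + i \<le> (k + 1) * 2 ^ m" using i by simp
    also have "\<dots> \<le> n * 2 ^ m" using k by (intro mult_right_mono) auto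
    finally show ?thesis .
  qed
  from grid_max_ge[OF this, of "1 / 2 ^ m" \<omega>]
  have "exp (Z (real k + real i / 2 ^ m) \<omega>) \<le> grid_max (1 / 2 ^ m) (n * 2 ^ m) \<omega>"
    by (simp add: add_divide_distrib)
  then have 1: "ennreal (exp (Z (real k + real i / 2 ^ m) \<omega>)) \<le> ennreal (grid_max (1 / 2 ^ m) (n * 2 ^ m) \<omega>)"
    by (rule ennreal_leI)
  have 2: "ennreal (chain_ratio ^ m / (1 - chain_ratio) * exp (Z (real k) \<omega>)) * holder_moment chain_exp chain_ratio (real k) (\<lambda>t. Z t \<omega>) \<le>
    (\<Sum>k<n. ennreal (chain_ratio ^ m / (1 - chain_ratio) * exp (Z (real k) \<omega>)) * holder_moment chain_exp chain_ratio (real k) (\<lambda>t. Z t \<omega>))"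
    using k by (intro member_le_sum[where f = "\<lambda>k. ennreal (chain_ratio ^ m / (1 - chain_ratio) * exp (Z (real k) \<omega>)) * holder_moment chain_exp chain_ratio (real k) (\<lambda>t. Z t \<omega>)"]) auto
  show ?thesis unfolding t(2) using i(2) add_mono[OF 1 2] by (rule order_trans)
qed

text \<open>Divided by n, the error no longer depends on n and tends to 0 as m grows; this
  uniformity allows the mesh to be fixed before the length.\<close>

lemma h_le_g:
  assumes "n \<ge> 1"
  shows "h (real n) \<le> ennreal (g (1 / 2 ^ m) (n * 2 ^ m) + real n * (chain_const / (1 - chain_ratio) * chain_ratio ^ m))"
proof -
  have "h (real n) \<le> (\<integral>\<^sup>+ \<omega>. ennreal (grid_max (1 / 2 ^ m) (n * 2 ^ m) \<omega>) +
    (\<Sum>k<n. ennreal (chain_ratio ^ m / (1 - chain_ratio) * exp (Z (real k) \<omega>)) * holder_moment chain_exp chain_ratio (real k) (\<lambda>t. Z t \<omega>)) \<partial>M)"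
    unfolding h_def
    by (rule nn_integral_mono_AE) (use AE_continuous_Z assms exp_SUP_le_grid_max in \<open>auto elim: eventually_mono\<close>)
  also have "\<dots> = ennreal (g (1 / 2 ^ m) (n * 2 ^ m)) +
    (\<Sum>k<n. \<integral>\<^sup>+ \<omega>. ennreal (chain_ratio ^ m / (1 - chain_ratio) * exp (Z (real k) \<omega>)) * holder_moment chain_exp chain_ratio (real k) (\<lambda>t. Z t \<omega>) \<partial>M)"
    by (subst nn_integral_add) (auto simp: nn_integral_sum nn_integral_grid_max)
  also have "\<dots> \<le> ennreal (g (1 / 2 ^ m) (n * 2 ^ m)) + (\<Sum>k<n. ennreal (chain_ratio ^ m / (1 - chain_ratio) * chain_const))"
  proof (intro add_left_mono sum_mono)
    fix k
    have "(\<integral>\<^sup>+ \<omega>. ennreal (chain_ratio ^ m / (1 - chain_ratio) * exp (Z (real k) \<omega>)) * holder_moment chain_exp chain_ratio (real k) (\<lambda>t. Z t \<omega>) \<partial>M) =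
      (\<integral>\<^sup>+ \<omega>. ennreal (chain_ratio ^ m / (1 - chain_ratio)) * (ennreal (exp (Z (real k) \<omega>)) * holder_moment chain_exp chain_ratio (real k) (\<lambda>t. Z t \<omega>)) \<partial>M)"
      using chain_ratio by (intro nn_integral_cong, subst ennreal_mult) (auto simp: mult.assoc)
    also have "\<dots> = ennreal (chain_ratio ^ m / (1 - chain_ratio)) * (\<integral>\<^sup>+ \<omega>. ennreal (exp (Z (real k) \<omega>)) * holder_moment chain_exp chain_ratio (real k) (\<lambda>t. Z t \<omega>) \<partial>M)"
      by (rule nn_integral_cmult) measurable
    also have "\<dots> = ennreal (chain_ratio ^ m / (1 - chain_ratio)) * (\<integral>\<^sup>+ \<omega>. holder_moment chain_exp chain_ratio (real k) (\<lambda>t. Z t \<omega>) \<partial>tilt (real k))"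
      unfolding tilt_def by (subst nn_integral_density) auto
    also have "\<dots> \<le> ennreal (chain_ratio ^ m / (1 - chain_ratio)) * ennreal chain_const"
      by (intro mult_left_mono holder_moment_le) auto
    also have "\<dots> = ennreal (chain_ratio ^ m / (1 - chain_ratio) * chain_const)" using chain_ratio by (subst ennreal_mult) (auto simp: chain_const_nonneg)
    finally show "(\<integral>\<^sup>+ \<omega>. ennreal (chain_ratio ^ m / (1 - chain_ratio) * exp (Z (real k) \<omega>)) * holder_moment chain_exp chain_ratio (real k) (\<lambda>t. Z t \<omega>) \<partial>M)
      \<le> ennreal (chain_ratio ^ m / (1 - chain_ratio) * chain_const)" .
  qed
  also have "\<dots> = ennreal (g (1 / 2 ^ m) (n * 2 ^ m) + real n * (chain_const / (1 - chain_ratio) * chain_ratio ^ m))"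
  proof -
    have "g (1 / 2 ^ m) (n * 2 ^ m) \<ge> 0" unfolding g_def using grid_max_nonneg by simp
    moreover have "(\<Sum>k<n. ennreal (chain_ratio ^ m / (1 - chain_ratio) * chain_const)) = ennreal (real n * (chain_const / (1 - chain_ratio) * chain_ratio ^ m))"
      using chain_ratio chain_const_nonneg by (subst sum_ennreal) (auto simp: mult_ac)
    ultimately show ?thesis using chain_ratio chain_const_nonneg by (simp add: ennreal_plus[symmetric] del: ennreal_plus)
  qed
  finally show ?thesis .
qed

end

subsection \<open>Growth of grid maxima\<close>

text \<open>Induction against 2 / (w + 1) - 2 / (n + 1), whose increment 2 / ((n + 1) (n + 2))
  dominates 1 / (n + 1)^2.\<close>

lemma sum_inverse_squares_le: "(\<Sum>l\<in>{w + 1..n}. 1 / (real l)\<^sup>2) \<le> 2 / (real w + 1)"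
proof (cases "n \<ge> w")
  case True
  then have "(\<Sum>l\<in>{w + 1..n}. 1 / (real l)\<^sup>2) \<le> 2 / (real w + 1) - 2 / (real n + 1)"
  proof (induction n rule: dec_induct)
    case (step n)
    have "1 / (real n + 1)\<^sup>2 \<le> 2 / (real n + 1) - 2 / (real n + 2)"
      by (simp add: divide_simps power2_eq_square)
    with step show ?case by (simp add: add.commute)
  qed simp
  then show ?thesis by (smt (verit) divide_nonneg_nonneg of_nat_0_le_iff)
qed auto

text \<open>On each side of the window, the distance from i is an injective function of j. Truncated
  subtraction in the left end of the window agrees with the tail condition j + w < i.\<close>

lemma sum_off_window_le:
  fixes f :: "nat \<Rightarrow> real"
  assumes "\<And>l. f l \<ge> 0"
  shows "(\<Sum>j\<in>{..N} - {i - w..i + w}. f (if j \<le> i then i - j else j - i)) \<le>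
    (\<Sum>l\<in>{w + 1..i}. f l) + (\<Sum>l\<in>{w + 1..N}. f l)"
proof -
  let ?f = "\<lambda>j. f (if j \<le> i then i - j else j - i)"
  define S where "S = {j. j \<le> N \<and> j + w < i}"
  define S' where "S' = {j. j \<le> N \<and> i + w < j}"
  have fin: "finite S" "finite S'" by (auto simp: S_def S'_def)
  have "{..N} - {i - w..i + w} = S \<union> S'" "S \<inter> S' = {}" by (auto simp: S_def S'_def)
  then have "sum ?f ({..N} - {i - w..i + w}) = sum ?f S + sum ?f S'"
    using fin by (simp add: sum.union_disjoint)
  moreover have "sum ?f S \<le> (\<Sum>l\<in>{w + 1..i}. f l)"
  proof -
    have "sum ?f S = (\<Sum>l\<in>(\<lambda>j. i - j) ` S. f l)"
      by (subst sum.reindex) (auto simp: S_def inj_on_def intro!: sum.cong)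
    also have "\<dots> \<le> (\<Sum>l\<in>{w + 1..i}. f l)"
      by (intro sum_mono2) (auto simp: S_def assms)
    finally show ?thesis .
  qed
  moreover have "sum ?f S' \<le> (\<Sum>l\<in>{w + 1..N}. f l)"
  proof -
    have "sum ?f S' = (\<Sum>l\<in>(\<lambda>j. j - i) ` S'. f l)"
      by (subst sum.reindex) (auto simp: S'_def inj_on_def intro!: sum.cong)
    also have "\<dots> \<le> (\<Sum>l\<in>{w + 1..N}. f l)"
      by (intro sum_mono2) (auto simp: S'_def assms)
    finally show ?thesis .
  qed
  ultimately show ?thesis by simp
qed

text \<open>An inverse square is summable and scales simply with the mesh, which is all that the
  tails of a window require.\<close>

lemma stretched_exp_le_inverse_square:
  fixes c \<kappa> :: real
  assumes "c > 0" "\<kappa> > 0"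
  obtains A where "A > 0" "\<And>x. x > 0 \<Longrightarrow> exp (- (c * x powr \<kappa>)) \<le> A / x\<^sup>2"
proof -
  define q where "q = nat \<lceil>2 / \<kappa>\<rceil>"
  have q: "2 \<le> \<kappa> * real q"
  proof -
    have "2 / \<kappa> \<le> real q" using assms by (simp add: q_def of_nat_ceiling)
    then show ?thesis using assms by (simp add: field_simps)
  qed
  define A where "A = max 1 (fact q / c ^ q)"
  have "exp (- (c * x powr \<kappa>)) \<le> A / x\<^sup>2" if "x > 0" for x
  proof (cases "x \<ge> 1")
    case True
    have "x\<^sup>2 = x powr 2" using that by simp
    also have "\<dots> \<le> x powr (\<kappa> * real q)" using True q by (intro powr_mono) auto
    also have "\<dots> = (x powr \<kappa>) ^ q" using that by (simp add: powr_powr[symmetric] powr_realpow)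
    finally have "x\<^sup>2 * c ^ q \<le> (x powr \<kappa>) ^ q * c ^ q" using assms by (intro mult_right_mono) auto
    also have "\<dots> = (c * x powr \<kappa>) ^ q" by (simp add: power_mult_distrib)
    also have "\<dots> \<le> fact q * exp (c * x powr \<kappa>)" using assms by (intro power_le_fact_exp) auto
    finally have "exp (- (c * x powr \<kappa>)) \<le> (fact q / c ^ q) / x\<^sup>2"
      using that assms by (simp add: exp_minus field_simps)
    also have "\<dots> \<le> A / x\<^sup>2" by (intro divide_right_mono) (auto simp: A_def)
    finally show ?thesis .
  next
    case False
    have "exp (- (c * x powr \<kappa>)) \<le> 1" using assms by simp
    also have "1 \<le> 1 / x\<^sup>2" using False that by (simp add: power_le_one)
    also have "\<dots> \<le> A / x\<^sup>2" by (intro divide_right_mono) (auto simp: A_def)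
    finally show ?thesis .
  qed
  moreover have "A > 0" by (simp add: A_def)
  ultimately show thesis using that by blast
qed

context centered_gaussian_process
begin

definition center_ratio :: "real \<Rightarrow> nat set \<Rightarrow> nat \<Rightarrow> real" where
  "center_ratio \<eta> J i = (LINT \<omega>|tilt (\<eta> * real i). max_ratio J (\<lambda>j. Z (\<eta> * real j) \<omega> - Z (\<eta> * real i) \<omega>))"

lemma measurable_center_ratio [measurable]:
  "\<eta> \<ge> 0 \<Longrightarrow> finite J \<Longrightarrow> (\<lambda>\<omega>. max_ratio J (\<lambda>j. Z (\<eta> * real j) \<omega> - Z (\<eta> * real i) \<omega>)) \<in> borel_measurable M"
  by (intro borel_measurable_max_ratio) auto

lemma integrable_center_ratio:
  assumes "\<eta> \<ge> 0" "finite J" "J \<noteq> {}"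
  shows "integrable (tilt (\<eta> * real i)) (\<lambda>\<omega>. max_ratio J (\<lambda>j. Z (\<eta> * real j) \<omega> - Z (\<eta> * real i) \<omega>))"
proof -
  interpret T: prob_space "tilt (\<eta> * real i)" using assms by (intro tilt_prob_space) auto
  show ?thesis
    using assms by (intro T.integrable_const_bound[where B = 1])
      (auto simp: max_ratio_nonneg max_ratio_le_1)
qed

lemma center_ratio_bounds:
  assumes "\<eta> \<ge> 0" "finite J" "J \<noteq> {}"
  shows "0 \<le> center_ratio \<eta> J i" "center_ratio \<eta> J i \<le> 1"
proof -
  interpret T: prob_space "tilt (\<eta> * real i)" using assms by (intro tilt_prob_space) auto
  show "0 \<le> center_ratio \<eta> J i"
    unfolding center_ratio_def using assms by (intro Bochner_Integration.integral_nonneg) (simp add: max_ratio_nonneg)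
  have "center_ratio \<eta> J i \<le> (LINT \<omega>|tilt (\<eta> * real i). 1)"
    unfolding center_ratio_def using assms
    by (intro integral_mono integrable_center_ratio) (auto simp: max_ratio_le_1)
  then show "center_ratio \<eta> J i \<le> 1" by (simp add: T.prob_space)
qed

lemma g_eq_sum:
  assumes "\<eta> \<ge> 0" shows "g \<eta> N = (\<Sum>i\<le>N. center_ratio \<eta> {..N} i)"
proof -
  have "g \<eta> N = expectation (\<lambda>\<omega>. \<Sum>i\<le>N. exp (Z (\<eta> * real i) \<omega>) *
    max_ratio {..N} (\<lambda>j. Z (\<eta> * real j) \<omega> - Z (\<eta> * real i) \<omega>))"
    unfolding g_def grid_max_def by (subst Max_exp_eq_sum) auto
  also have "\<dots> = (\<Sum>i\<le>N. expectation (\<lambda>\<omega>. exp (Z (\<eta> * real i) \<omega>) *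
    max_ratio {..N} (\<lambda>j. Z (\<eta> * real j) \<omega> - Z (\<eta> * real i) \<omega>)))"
  proof (rule Bochner_Integration.integral_sum)
    fix i
    show "integrable M (\<lambda>\<omega>. exp (Z (\<eta> * real i) \<omega>) *
      max_ratio {..N} (\<lambda>j. Z (\<eta> * real j) \<omega> - Z (\<eta> * real i) \<omega>))"
      using integrable_center_ratio[OF assms, of "{..N}" i] assms by (simp add: integral_tilt)
  qed
  also have "\<dots> = (\<Sum>i\<le>N. center_ratio \<eta> {..N} i)"
    unfolding center_ratio_def using assms by (intro sum.cong) (auto simp: integral_tilt)
  finally show ?thesis .
qed

text \<open>This integrates \<open>max_ratio_window\<close>; the rate 1 / 4 is the largest value of
  y - y^2, attained at y = 1 / 2.\<close>

lemma center_ratio_window: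
  assumes "\<eta> \<ge> 0" "finite I" "J \<subseteq> I" "i \<in> J"
  shows "\<bar>center_ratio \<eta> I i - center_ratio \<eta> J i\<bar> \<le>
    (\<Sum>j\<in>I - J. exp (- \<gamma> (\<eta> * real j) (\<eta> * real i) / 4))"
proof -
  have fin: "finite J" "J \<noteq> {}" "I \<noteq> {}" using assms finite_subset by auto
  note int = integrable_center_ratio[OF assms(1) fin(1,2), of i] integrable_center_ratio[OF assms(1,2) fin(3), of i]
  have e: "integrable (tilt (\<eta> * real i)) (\<lambda>\<omega>. exp ((Z (\<eta> * real j) \<omega> - Z (\<eta> * real i) \<omega>) / 2))"
    "(LINT \<omega>|tilt (\<eta> * real i). exp ((Z (\<eta> * real j) \<omega> - Z (\<eta> * real i) \<omega>) / 2)) =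
      exp (- \<gamma> (\<eta> * real j) (\<eta> * real i) / 4)" for j
    using tilt_exp_increment[of "\<eta> * real i" "\<eta> * real j" "\<eta> * real i" "1 / 2"] assms
    by (auto simp: power2_eq_square)
  have "\<bar>center_ratio \<eta> I i - center_ratio \<eta> J i\<bar> =
    \<bar>(LINT \<omega>|tilt (\<eta> * real i). max_ratio I (\<lambda>j. Z (\<eta> * real j) \<omega> - Z (\<eta> * real i) \<omega>) -
      max_ratio J (\<lambda>j. Z (\<eta> * real j) \<omega> - Z (\<eta> * real i) \<omega>))\<bar>"
    unfolding center_ratio_def using int by simp
  also have "\<dots> \<le> (LINT \<omega>|tilt (\<eta> * real i). \<bar>max_ratio I (\<lambda>j. Z (\<eta> * real j) \<omega> - Z (\<eta> * real i) \<omega>) -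
      max_ratio J (\<lambda>j. Z (\<eta> * real j) \<omega> - Z (\<eta> * real i) \<omega>)\<bar>)"
    by (rule integral_abs_bound)
  also have "\<dots> \<le> (LINT \<omega>|tilt (\<eta> * real i). (\<Sum>j\<in>I - J. exp ((Z (\<eta> * real j) \<omega> - Z (\<eta> * real i) \<omega>) / 2)))"
  proof (rule integral_mono)
    fix \<omega>
    show "\<bar>max_ratio I (\<lambda>j. Z (\<eta> * real j) \<omega> - Z (\<eta> * real i) \<omega>) -
      max_ratio J (\<lambda>j. Z (\<eta> * real j) \<omega> - Z (\<eta> * real i) \<omega>)\<bar> \<le>
      (\<Sum>j\<in>I - J. exp ((Z (\<eta> * real j) \<omega> - Z (\<eta> * real i) \<omega>) / 2))"
      using max_ratio_window[OF assms(2-4), of "\<lambda>j. Z (\<eta> * real j) \<omega> - Z (\<eta> * real i) \<omega>"] by simp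
  qed (use int in \<open>auto intro!: Bochner_Integration.integrable_sum e\<close>)
  also have "\<dots> = (\<Sum>j\<in>I - J. exp (- \<gamma> (\<eta> * real j) (\<eta> * real i) / 4))"
    by (subst Bochner_Integration.integral_sum) (auto intro: e simp: e(2))
  finally show ?thesis .
qed

end

section \<open>Truncation to windows with uniform error\<close>

context locally_fbm
begin

text \<open>It is determined by c and \<kappa>, hence depends neither on the mesh nor on the
  position of the window. The rate c / 4 combines the lower bound on \<gamma> with the rate of
  \<open>center_ratio_window\<close>.\<close>

definition decay_const :: real where
  "decay_const = (SOME decay_const. decay_const > 0 \<and> (\<forall>x>0. exp (- (c / 4 * x powr \<kappa>)) \<le> decay_const / x\<^sup>2))"

lemma decay_const: "decay_const > 0" "\<And>x. x > 0 \<Longrightarrow> exp (- (c / 4 * x powr \<kappa>)) \<le> decay_const / x\<^sup>2"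
proof -
  have "decay_const > 0 \<and> (\<forall>x>0. exp (- (c / 4 * x powr \<kappa>)) \<le> decay_const / x\<^sup>2)"
    unfolding decay_const_def
    by (rule someI_ex) (use stretched_exp_le_inverse_square[of "c / 4" \<kappa>] c_pos \<kappa>_pos in \<open>metis zero_less_divide_iff zero_less_numeral\<close>)
  then show "decay_const > 0" "\<And>x. x > 0 \<Longrightarrow> exp (- (c / 4 * x powr \<kappa>)) \<le> decay_const / x\<^sup>2" by auto
qed

lemma center_ratio_window_le:
  assumes "\<eta> > 0" "w \<le> i" "i + w \<le> N \<or> w = 0 \<and> i \<le> N"
  shows "\<bar>center_ratio \<eta> {..N} i - center_ratio \<eta> {i - w..i + w} i\<bar> \<le> 4 * decay_const / (\<eta>\<^sup>2 * (real w + 1))"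
proof -
  have "\<bar>center_ratio \<eta> {..N} i - center_ratio \<eta> {i - w..i + w} i\<bar> \<le>
    (\<Sum>j\<in>{..N} - {i - w..i + w}. exp (- \<gamma> (\<eta> * real j) (\<eta> * real i) / 4))"
    using assms by (intro center_ratio_window) auto
  also have "\<dots> \<le> (\<Sum>j\<in>{..N} - {i - w..i + w}. decay_const / \<eta>\<^sup>2 * (1 / (real (if j \<le> i then i - j else j - i))\<^sup>2))"
  proof (intro sum_mono)
    fix j assume j: "j \<in> {..N} - {i - w..i + w}"
    define l where "l = (if j \<le> i then i - j else j - i)"
    have l: "l > 0" "\<bar>\<eta> * real j - \<eta> * real i\<bar> = \<eta> * real l"
      using j assms by (auto simp: l_def right_diff_distrib[symmetric] abs_mult)
    have "c * (\<eta> * real l) powr \<kappa> \<le> \<gamma> (\<eta> * real j) (\<eta> * real i)"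
      using \<gamma>_lower[of "\<eta> * real j" "\<eta> * real i"] assms l by auto
    then have "exp (- \<gamma> (\<eta> * real j) (\<eta> * real i) / 4) \<le> exp (- (c / 4 * (\<eta> * real l) powr \<kappa>))" by simp
    also have "\<dots> \<le> decay_const / (\<eta> * real l)\<^sup>2" using assms l by (intro decay_const) auto
    also have "\<dots> = decay_const / \<eta>\<^sup>2 * (1 / (real l)\<^sup>2)" by (simp add: power_mult_distrib)
    finally show "exp (- \<gamma> (\<eta> * real j) (\<eta> * real i) / 4) \<le>
      decay_const / \<eta>\<^sup>2 * (1 / (real (if j \<le> i then i - j else j - i))\<^sup>2)" unfolding l_def .
  qed
  also have "\<dots> \<le> decay_const / \<eta>\<^sup>2 * ((\<Sum>l\<in>{w + 1..i}. 1 / (real l)\<^sup>2) + (\<Sum>l\<in>{w + 1..N}. 1 / (real l)\<^sup>2))"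
    unfolding sum_distrib_left[symmetric] using decay_const
    by (intro mult_left_mono sum_off_window_le) auto
  also have "\<dots> \<le> decay_const / \<eta>\<^sup>2 * (2 / (real w + 1) + 2 / (real w + 1))"
    using decay_const by (intro mult_left_mono add_mono sum_inverse_squares_le) auto
  also have "\<dots> = 4 * decay_const / (\<eta>\<^sup>2 * (real w + 1))" by simp
  finally show ?thesis .
qed

text \<open>A one-point window has ratio 1, and on a coarse grid all the other points together lower
  it by at most 1 / 2. This is the source of positivity of the limit.\<close>

lemma g_lower:
  assumes "\<eta> > 0" "8 * decay_const \<le> \<eta>\<^sup>2" shows "(real N + 1) / 2 \<le> g \<eta> N"
proof -
  have "1 / 2 \<le> center_ratio \<eta> {..N} i" if "i \<le> N" for i
  proof -
    interpret T: prob_space "tilt (\<eta> * real i)" using assms by (intro tilt_prob_space) auto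
    have "center_ratio \<eta> {i} i = 1" by (simp add: center_ratio_def T.prob_space)
    moreover have "4 * decay_const / \<eta>\<^sup>2 \<le> 1 / 2" using assms by (simp add: field_simps)
    moreover have "\<bar>center_ratio \<eta> {..N} i - center_ratio \<eta> {i} i\<bar> \<le> 4 * decay_const / \<eta>\<^sup>2"
      using center_ratio_window_le[of \<eta> 0 i N] assms that by simp
    ultimately show ?thesis by linarith
  qed
  then have "(\<Sum>i\<le>N. 1 / 2) \<le> (\<Sum>i\<le>N. center_ratio \<eta> {..N} i)" by (intro sum_mono) auto
  then show ?thesis using g_eq_sum[of \<eta> N] assms by simp
qed

text \<open>Away from both ends a summand differs from \<open>D\<close> by at most \<epsilon> for
  the window and \<epsilon> for the limit. \<open>K\<close> counts the exceptional indices, at most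
  i0 + w at the start and w at the end, each costing at most 1.\<close>

lemma g_asymp:
  assumes "\<eta> > 0" "4 * decay_const / (\<eta>\<^sup>2 * (real w + 1)) \<le> \<epsilon>" "\<epsilon> > 0" "0 \<le> D" "D \<le> 1"
    and lim: "(\<lambda>i. center_ratio \<eta> {i - w..i + w} i) \<longlonglongrightarrow> D"
  shows "\<exists>K. \<forall>N. \<bar>g \<eta> N - (real N + 1) * D\<bar> \<le> (real N + 1) * (2 * \<epsilon>) + K"
proof -
  obtain i0 where i0: "\<And>i. i \<ge> i0 \<Longrightarrow> \<bar>center_ratio \<eta> {i - w..i + w} i - D\<bar> < \<epsilon>"
    using LIMSEQ_D[OF lim \<open>\<epsilon> > 0\<close>] by auto
  have "\<bar>g \<eta> N - (real N + 1) * D\<bar> \<le> (real N + 1) * (2 * \<epsilon>) + (real (i0 + w) + real w)" for N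
  proof -
    have bound: "\<bar>center_ratio \<eta> {..N} i - D\<bar> \<le> 2 * \<epsilon> + (if i < i0 + w then 1 else 0) + (if N < i + w then 1 else 0)"
      if "i \<le> N" for i
    proof (cases "i < i0 + w \<or> N < i + w")
      case True
      have "\<bar>center_ratio \<eta> {..N} i - D\<bar> \<le> 1"
        using center_ratio_bounds[of \<eta> "{..N}" i] assms by (auto simp: abs_le_iff)
      with True \<open>\<epsilon> > 0\<close> show ?thesis by auto
    next
      case False
      then have "\<bar>center_ratio \<eta> {..N} i - center_ratio \<eta> {i - w..i + w} i\<bar> \<le> \<epsilon>"
        using center_ratio_window_le[of \<eta> w i N] assms by auto
      moreover have "\<bar>center_ratio \<eta> {i - w..i + w} i - D\<bar> < \<epsilon>" using False by (intro i0) auto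
      ultimately show ?thesis using False by auto
    qed
    have "g \<eta> N - (real N + 1) * D = (\<Sum>i\<le>N. center_ratio \<eta> {..N} i - D)"
      using g_eq_sum[of \<eta> N] assms by (simp add: sum_subtractf)
    also have "\<bar>\<dots>\<bar> \<le> (\<Sum>i\<le>N. \<bar>center_ratio \<eta> {..N} i - D\<bar>)" by (rule sum_abs)
    also have "\<dots> \<le> (\<Sum>i\<le>N. 2 * \<epsilon> + (if i < i0 + w then 1 else 0) + (if N < i + w then 1 else 0))"
      by (intro sum_mono bound) auto
    also have "\<dots> = (real N + 1) * (2 * \<epsilon>) + real (card {i\<in>{..N}. i < i0 + w}) + real (card {i\<in>{..N}. N < i + w})"
      by (simp add: sum.distrib sum.If_cases Int_def)
    also have "\<dots> \<le> (real N + 1) * (2 * \<epsilon>) + real (i0 + w) + real w"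
    proof -
      have "card {i\<in>{..N}. i < i0 + w} \<le> card {..<i0 + w}" by (intro card_mono) auto
      moreover have "card {i\<in>{..N}. N < i + w} \<le> card {N + 1 - w..<N + 1}" by (intro card_mono) auto
      ultimately show ?thesis by simp
    qed
    finally show ?thesis by simp
  qed
  then show ?thesis by blast
qed

end

subsection \<open>Existence and universality of the limit\<close>

context locally_fbm
begin

text \<open>After a shift by w the window is i + {0..2 w} with center i + w. The index set is then
  fixed and only the tilted measures vary, as \<open>tendsto_expectation_Lipschitz\<close>
  requires.\<close>

lemma center_ratio_tendsto:
  fixes N :: "'b measure"
  assumes "centered_gaussian_process N W" and "\<eta> > 0"
    and \<gamma>_W: "\<And>s t. s \<ge> 0 \<Longrightarrow> t \<ge> 0 \<Longrightarrow> centered_gaussian_process.\<gamma> N W s t = \<bar>s - t\<bar> powr \<kappa>"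
  shows "(\<lambda>i. center_ratio \<eta> {i - w..i + w} i) \<longlonglongrightarrow>
    centered_gaussian_process.center_ratio N W \<eta> {..2 * w} w"
proof -
  interpret W: centered_gaussian_process N W by fact
  define I where "I = {..2 * w}"
  have I: "finite I" "I \<noteq> {}" by (auto simp: I_def)
  \<comment> \<open>One second moment bound for both processes: the variogram has the factor C for
    the given one and 1 for \<open>W\<close>, at distances of at most \<eta> w.\<close>
  define K where "K = 2 * (1 + exp (2 * (max C 1 * (\<eta> * real w) powr \<kappa>)))"
  have dist_le: "\<bar>\<eta> * real (i + l) - \<eta> * real (i + w)\<bar> powr \<kappa> \<le> (\<eta> * real w) powr \<kappa>" if "l \<in> I" for i l
  proof (rule powr_mono2)
    have "\<eta> * real (i + l) - \<eta> * real (i + w) = \<eta> * (real l - real w)" by (simp add: algebra_simps)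
    also have "\<bar>\<dots>\<bar> = \<eta> * \<bar>real l - real w\<bar>" using \<open>\<eta> > 0\<close> by (simp add: abs_mult)
    also have "\<dots> \<le> \<eta> * real w" using that \<open>\<eta> > 0\<close> by (intro mult_left_mono) (auto simp: I_def)
    finally show "\<bar>\<eta> * real (i + l) - \<eta> * real (i + w)\<bar> \<le> \<eta> * real w" .
  qed (use \<kappa>_pos in auto)
  have K: "2 * (1 + exp (2 * x)) \<le> K" if "x \<le> max C 1 * (\<eta> * real w) powr \<kappa>" for x
    using that by (simp add: K_def)
  have local: "(\<lambda>i. \<gamma> (\<eta> * real (i + l)) (\<eta> * real (i + l'))) \<longlonglongrightarrow> W.\<gamma> (\<eta> * real l) (\<eta> * real l')" for l l'
  proof -
    have "filterlim (\<lambda>i. \<eta> * real i) at_top sequentially"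
      using \<open>\<eta> > 0\<close> by (intro filterlim_tendsto_pos_mult_at_top[OF tendsto_const _ filterlim_real_sequentially])
    from filterlim_compose[OF \<gamma>_local[of "\<eta> * real l" "\<eta> * real l'"] this] show ?thesis
      using \<gamma>_W[of "\<eta> * real l" "\<eta> * real l'"] \<open>\<eta> > 0\<close> by (simp add: distrib_left)
  qed
  have "(\<lambda>i. LINT \<omega>|tilt (\<eta> * real (i + w)). max_ratio I (\<lambda>l. Z (\<eta> * real (i + l)) \<omega> - Z (\<eta> * real (i + w)) \<omega>))
    \<longlonglongrightarrow> (LINT \<omega>|W.tilt (\<eta> * real w). max_ratio I (\<lambda>l. W.Z (\<eta> * real l) \<omega> - W.Z (\<eta> * real w) \<omega>))"
  proof (rule tendsto_expectation_Lipschitz[OF I(1) max_ratio_Lipschitz[OF I]])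
    show "\<bar>max_ratio I x\<bar> \<le> 1" for x :: "nat \<Rightarrow> real"
      using max_ratio_nonneg[OF I, of x] max_ratio_le_1[OF I, of x] by simp
    show "prob_space (tilt (\<eta> * real (i + w)))" for i
      using \<open>\<eta> > 0\<close> by (intro tilt_prob_space) auto
    show "prob_space (W.tilt (\<eta> * real w))"
      using \<open>\<eta> > 0\<close> by (intro W.tilt_prob_space) auto
    show "(\<lambda>\<omega>. Z (\<eta> * real (i + l)) \<omega> - Z (\<eta> * real (i + w)) \<omega>) \<in> borel_measurable (tilt (\<eta> * real (i + w)))" for i l
      using \<open>\<eta> > 0\<close> by simp
    show "(\<lambda>\<omega>. W.Z (\<eta> * real l) \<omega> - W.Z (\<eta> * real w) \<omega>) \<in> borel_measurable (W.tilt (\<eta> * real w))" for l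
      using \<open>\<eta> > 0\<close> by simp
    show "(\<lambda>\<omega>. max_ratio I (\<lambda>l. Z (\<eta> * real (i + l)) \<omega> - Z (\<eta> * real (i + w)) \<omega>)) \<in> borel_measurable (tilt (\<eta> * real (i + w)))" for i
      using \<open>\<eta> > 0\<close> I by (intro borel_measurable_max_ratio) auto
    show "(\<lambda>\<omega>. max_ratio I (\<lambda>l. W.Z (\<eta> * real l) \<omega> - W.Z (\<eta> * real w) \<omega>)) \<in> borel_measurable (W.tilt (\<eta> * real w))"
      using \<open>\<eta> > 0\<close> I by (intro borel_measurable_max_ratio) auto
    show "integrable (tilt (\<eta> * real (i + w))) (\<lambda>\<omega>. (Z (\<eta> * real (i + l)) \<omega> - Z (\<eta> * real (i + w)) \<omega>)\<^sup>2)" for i l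
      using \<open>\<eta> > 0\<close> by (intro tilt_square) auto
    show "integrable (W.tilt (\<eta> * real w)) (\<lambda>\<omega>. (W.Z (\<eta> * real l) \<omega> - W.Z (\<eta> * real w) \<omega>)\<^sup>2)" for l
      using \<open>\<eta> > 0\<close> by (intro W.tilt_square) auto
    show "(LINT \<omega>|tilt (\<eta> * real (i + w)). (Z (\<eta> * real (i + l)) \<omega> - Z (\<eta> * real (i + w)) \<omega>)\<^sup>2) \<le> K"
      if "l \<in> I" for i l
    proof -
      have "\<gamma> (\<eta> * real (i + l)) (\<eta> * real (i + w)) \<le> C * \<bar>\<eta> * real (i + l) - \<eta> * real (i + w)\<bar> powr \<kappa>"
        using \<open>\<eta> > 0\<close> by (intro \<gamma>_upper) auto
      also have "\<dots> \<le> max C 1 * (\<eta> * real w) powr \<kappa>"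
        using dist_le[OF that] by (intro mult_mono) auto
      finally show ?thesis
        using tilt_square(2)[of "\<eta> * real (i + w)" "\<eta> * real (i + l)"] \<open>\<eta> > 0\<close> by (intro order_trans[OF _ K]) auto
    qed
    show "(LINT \<omega>|W.tilt (\<eta> * real w). (W.Z (\<eta> * real l) \<omega> - W.Z (\<eta> * real w) \<omega>)\<^sup>2) \<le> K"
      if "l \<in> I" for l
    proof -
      have "W.\<gamma> (\<eta> * real l) (\<eta> * real w) = 1 * \<bar>\<eta> * real (0 + l) - \<eta> * real (0 + w)\<bar> powr \<kappa>"
        using \<open>\<eta> > 0\<close> by (simp add: \<gamma>_W)
      also have "\<dots> \<le> max C 1 * (\<eta> * real w) powr \<kappa>"
        by (intro mult_mono dist_le that) auto
      finally show ?thesis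
        using W.tilt_square(2)[of "\<eta> * real w" "\<eta> * real l"] \<open>\<eta> > 0\<close> by (intro order_trans[OF _ K]) auto
    qed
    show "(\<lambda>i. LINT \<omega>|tilt (\<eta> * real (i + w)). cos (b + (\<Sum>l\<in>I. a l * (Z (\<eta> * real (i + l)) \<omega> - Z (\<eta> * real (i + w)) \<omega>))))
      \<longlonglongrightarrow> (LINT \<omega>|W.tilt (\<eta> * real w). cos (b + (\<Sum>l\<in>I. a l * (W.Z (\<eta> * real l) \<omega> - W.Z (\<eta> * real w) \<omega>))))" for a b
    proof -
      have "(\<lambda>i. exp (- qf (\<eta> * real (i + w)) I (\<lambda>l. \<eta> * real (i + l)) a) *
          cos (b - (\<Sum>l\<in>I. a l * \<gamma> (\<eta> * real (i + l)) (\<eta> * real (i + w)))))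
        \<longlonglongrightarrow> exp (- W.qf (\<eta> * real w) I (\<lambda>l. \<eta> * real l) a) *
          cos (b - (\<Sum>l\<in>I. a l * W.\<gamma> (\<eta> * real l) (\<eta> * real w)))"
        unfolding qf_def W.qf_def by (intro tendsto_intros local) auto
      moreover have "(LINT \<omega>|tilt (\<eta> * real (i + w)). cos (b + (\<Sum>l\<in>I. a l * (Z (\<eta> * real (i + l)) \<omega> - Z (\<eta> * real (i + w)) \<omega>)))) =
        exp (- qf (\<eta> * real (i + w)) I (\<lambda>l. \<eta> * real (i + l)) a) *
          cos (b - (\<Sum>l\<in>I. a l * \<gamma> (\<eta> * real (i + l)) (\<eta> * real (i + w))))" for i
        using \<open>\<eta> > 0\<close> I by (intro tilt_cos) auto
      moreover have "(LINT \<omega>|W.tilt (\<eta> * real w). cos (b + (\<Sum>l\<in>I. a l * (W.Z (\<eta> * real l) \<omega> - W.Z (\<eta> * real w) \<omega>)))) =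
        exp (- W.qf (\<eta> * real w) I (\<lambda>l. \<eta> * real l) a) *
          cos (b - (\<Sum>l\<in>I. a l * W.\<gamma> (\<eta> * real l) (\<eta> * real w)))"
        using \<open>\<eta> > 0\<close> I by (intro W.tilt_cos) auto
      ultimately show ?thesis by simp
    qed
  qed simp
  moreover have "center_ratio \<eta> {i + w - w..i + w + w} (i + w) =
    (LINT \<omega>|tilt (\<eta> * real (i + w)). max_ratio I (\<lambda>l. Z (\<eta> * real (i + l)) \<omega> - Z (\<eta> * real (i + w)) \<omega>))" for i
  proof -
    have "{i + w - w..i + w + w} = (+) i ` {0..2 * w}"
      unfolding image_add_atLeastAtMost by (simp add: mult_2)
    then have "{i + w - w..i + w + w} = (+) i ` I" by (simp add: I_def atLeast0AtMost)
    then show ?thesis unfolding center_ratio_def by (simp only: max_ratio_reindex inj_on_add)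
  qed
  \<comment> \<open>Passing to i + w avoids the truncated subtraction in the finitely many windows
    with i < w.\<close>
  ultimately show ?thesis
    by (intro LIMSEQ_offset[of "\<lambda>i. center_ratio \<eta> {i - w..i + w} i" w]) (simp add: W.center_ratio_def I_def)
qed

section \<open>Linear growth of the expected supremum\<close>

lemma h_finite:
  assumes "T \<ge> 0" shows "h T < \<top>"
proof -
  have "h T \<le> h (real (nat \<lceil>T\<rceil> + 1))" using assms by (intro h_mono) linarith+
  also have "\<dots> < \<top>"
    using h_le_g[of "nat \<lceil>T\<rceil> + 1" 0] by (rule le_less_trans) simp_all
  finally show ?thesis .
qed

lemma enn2real_h_bounds:
  assumes "n \<ge> 1"
  shows "g (1 / 2 ^ m) (n * 2 ^ m) \<le> enn2real (h (real n))"
    and "enn2real (h (real n)) \<le> g (1 / 2 ^ m) (n * 2 ^ m) + real n * (chain_const / (1 - chain_ratio) * chain_ratio ^ m)"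
proof -
  have g: "g \<eta> N \<ge> 0" for \<eta> N unfolding g_def using grid_max_nonneg by simp
  have "h (real n) < \<top>" by (rule h_finite) simp
  then obtain x where x: "h (real n) = ennreal x" "x \<ge> 0" by (cases "h (real n)") auto
  have "ennreal (g (1 / 2 ^ m) (n * 2 ^ m)) \<le> h (real n)" by (rule g_le_h) auto
  with x show "g (1 / 2 ^ m) (n * 2 ^ m) \<le> enn2real (h (real n))" by simp
  have "0 \<le> g (1 / 2 ^ m) (n * 2 ^ m) + real n * (chain_const / (1 - chain_ratio) * chain_ratio ^ m)"
    using g chain_ratio chain_const_nonneg by (intro add_nonneg_nonneg mult_nonneg_nonneg) auto
  with h_le_g[OF assms, of m] x
  show "enn2real (h (real n)) \<le> g (1 / 2 ^ m) (n * 2 ^ m) + real n * (chain_const / (1 - chain_ratio) * chain_ratio ^ m)"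
    by (simp add: ennreal_le_iff)
qed

text \<open>The quantifiers come in the order of the choices: first the mesh, to control chaining;
  then the window, whose error is multiplied by the 2^m grid points per unit of time; last n, which
  washes out the ends of the grid.\<close>

lemma h_asymp:
  fixes D :: "nat \<Rightarrow> nat \<Rightarrow> real"
  assumes lim: "\<And>m w. (\<lambda>i. center_ratio (1 / 2 ^ m) {i - w..i + w} i) \<longlonglongrightarrow> D m w"
    and D: "\<And>m w. 0 \<le> D m w" "\<And>m w. D m w \<le> 1" and "\<epsilon> > 0"
  shows "\<forall>\<^sub>F m in sequentially. \<forall>\<^sub>F w in sequentially. \<forall>\<^sub>F n in sequentially.
    \<bar>enn2real (h (real n)) / real n - 2 ^ m * D m w\<bar> \<le> \<epsilon>"
proof -
  have "(\<lambda>m. chain_const / (1 - chain_ratio) * chain_ratio ^ m) \<longlonglongrightarrow> chain_const / (1 - chain_ratio) * 0"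
    using chain_ratio by (intro tendsto_intros LIMSEQ_realpow_zero) auto
  then have "\<forall>\<^sub>F m in sequentially. chain_const / (1 - chain_ratio) * chain_ratio ^ m < \<epsilon> / 4"
    using \<open>\<epsilon> > 0\<close> by (intro order_tendstoD) auto
  then show ?thesis
  proof eventually_elim
    case (elim m)
    define \<eta> where "\<eta> = 1 / (2 ^ m :: real)"
    \<comment> \<open>Each of the 2^m grid points per unit of time costs 2 e, in total \<epsilon> /
      4.\<close>
    define e where "e = \<epsilon> / (8 * 2 ^ m)"
    have "\<eta> > 0" "e > 0" using \<open>\<epsilon> > 0\<close> by (auto simp: \<eta>_def e_def)
    have "(\<lambda>w. (4 * decay_const / \<eta>\<^sup>2) * inverse (real (Suc w))) \<longlonglongrightarrow> (4 * decay_const / \<eta>\<^sup>2) * 0"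
      by (intro tendsto_mult_left LIMSEQ_inverse_real_of_nat)
    then have "\<forall>\<^sub>F w in sequentially. (4 * decay_const / \<eta>\<^sup>2) * inverse (real (Suc w)) < e"
      using \<open>e > 0\<close> by (intro order_tendstoD) auto
    then show ?case
    proof eventually_elim
      case (elim w)
      then have "4 * decay_const / (\<eta>\<^sup>2 * (real w + 1)) \<le> e" by (simp add: field_simps)
      from g_asymp[OF \<open>\<eta> > 0\<close> this \<open>e > 0\<close> D lim[of m w, folded \<eta>_def]]
      obtain K where K: "\<And>N. \<bar>g \<eta> N - (real N + 1) * D m w\<bar> \<le> (real N + 1) * (2 * e) + K" by blast
      \<comment> \<open>Contributions that do not grow with n: 2 e from the extra grid point, K from
        the ends, and 1 from D \<le> 1.\<close>
      have "(\<lambda>n. (2 * e + K + 1) / real n) \<longlonglongrightarrow> 0"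
        by (rule lim_const_over_n)
      then have "\<forall>\<^sub>F n in sequentially. (2 * e + K + 1) / real n < \<epsilon> / 2"
        using \<open>\<epsilon> > 0\<close> by (intro order_tendstoD) auto
      then show ?case
        using eventually_ge_at_top[of 1]
      proof eventually_elim
        case (elim n)
        define x where "x = enn2real (h (real n))"
        define N where "N = n * 2 ^ m"
        define \<delta> where "\<delta> = chain_const / (1 - chain_ratio) * chain_ratio ^ m"
        have N: "real N = real n * 2 ^ m" by (simp add: N_def)
        have 1: "g \<eta> N \<le> x" "x \<le> g \<eta> N + real n * \<delta>"
          using enn2real_h_bounds[OF elim(2), of m] by (auto simp: x_def \<eta>_def N_def \<delta>_def)
        have 2: "real n * \<delta> \<le> real n * (\<epsilon> / 4)"
          using \<open>chain_const / (1 - chain_ratio) * chain_ratio ^ m < \<epsilon> / 4\<close> by (intro mult_left_mono) (auto simp: \<delta>_def)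
        have 3: "real N * (2 * e) = real n * (\<epsilon> / 4)" by (simp add: N e_def)
        have "(real N + 1) * (2 * e) = real n * (\<epsilon> / 4) + 2 * e"
          unfolding distrib_right 3 by simp
        moreover have "(real N + 1) * D m w = real N * D m w + D m w" by (simp add: distrib_right)
        ultimately have "\<bar>x - real N * D m w\<bar> \<le> real n * (\<epsilon> / 4) + (real n * (\<epsilon> / 4) + 2 * e + K + 1)"
          using K[of N] 1 2 D[of m w] unfolding abs_le_iff by linarith
        also have "\<dots> = real n * (\<epsilon> / 2) + (2 * e + K + 1)" by simp
        also have "\<dots> \<le> real n * (\<epsilon> / 2) + real n * (\<epsilon> / 2)"
          using elim by (simp add: field_simps)
        also have "\<dots> = real n * \<epsilon>" by simp
        finally have "\<bar>x - real N * D m w\<bar> / real n \<le> \<epsilon>"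
          using elim by (simp add: pos_divide_le_eq mult.commute)
        moreover have "x / real n - 2 ^ m * D m w = (x - real N * D m w) / real n"
          using elim by (simp add: N field_simps)
        ultimately show ?case by (simp only: x_def abs_divide abs_of_nat)
      qed
    qed
  qed
qed

text \<open>A grid of integer spacing q, large enough for \<open>g_lower\<close>, has at least n / q
  points in the interval, each contributing at least 1 / 2.\<close>

lemma h_div_lower:
  obtains a where "a > 0" "\<And>n. n \<ge> 1 \<Longrightarrow> a \<le> enn2real (h (real n)) / real n"
proof -
  obtain q :: nat where q: "real q \<ge> max 1 (8 * decay_const)" using real_arch_simple by blast
  then have q1: "q \<ge> 1" by auto
  have "8 * decay_const \<le> real q * 1" using q by simp
  also have "\<dots> \<le> (real q)\<^sup>2" using q1 unfolding power2_eq_square by (intro mult_left_mono) auto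
  finally have qA: "8 * decay_const \<le> (real q)\<^sup>2" .
  have "1 / (2 * real q) \<le> enn2real (h (real n)) / real n" if "n \<ge> 1" for n
  proof -
    have "real n / real q \<le> real (n div q) + 1"
    proof -
      have "n < q * (n div q + 1)" using q1 by (metis dividend_less_times_div mult.commute add.commute Suc_eq_plus1 mult_Suc_right less_le_trans zero_less_one)
      then have "real n \<le> real (q * (n div q + 1))" by (simp only: of_nat_le_iff)
      then show ?thesis using q1 by (simp add: field_simps)
    qed
    then have "real n / (2 * real q) \<le> (real (n div q) + 1) / 2" by simp
    also have "\<dots> \<le> g (real q) (n div q)" using q1 qA by (intro g_lower) auto
    also have "\<dots> \<le> enn2real (h (real n))"
    proof -
      have "q * (n div q) \<le> n" by simp
      then have "real q * real (n div q) \<le> real n" by (metis of_nat_le_iff of_nat_mult)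
      then have "ennreal (g (real q) (n div q)) \<le> h (real n)" by (intro g_le_h) auto
      then have "enn2real (ennreal (g (real q) (n div q))) \<le> enn2real (h (real n))"
        using h_finite[of "real n"] by (intro enn2real_mono) auto
      moreover have "g (real q) (n div q) \<ge> 0" unfolding g_def using grid_max_nonneg by simp
      ultimately show ?thesis by simp
    qed
    finally show ?thesis using that q1 by (simp add: field_simps)
  qed
  moreover have "1 / (2 * real q) > 0" using q1 by simp
  ultimately show thesis using that by blast
qed

text \<open>Monotonicity of \<open>h\<close> traps the value at a real T between those at the
  neighbouring integers, whose quotients by T tend to 1.\<close>

lemma tendsto_h_div:
  assumes lim: "(\<lambda>n. enn2real (h (real n)) / real n) \<longlonglongrightarrow> l"
  shows "((\<lambda>T. h T / ennreal T) \<longlongrightarrow> ennreal l) at_top"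
proof -
  define a where "a n = enn2real (h (real n)) / real n" for n :: nat
  have floor_top: "filterlim (\<lambda>T::real. nat \<lfloor>T\<rfloor>) sequentially at_top"
    by (intro filterlim_compose[OF filterlim_nat_sequentially filterlim_floor_sequentially])
  have floor_top': "filterlim (\<lambda>T::real. nat \<lfloor>T\<rfloor> + 1) sequentially at_top"
    using filterlim_compose[OF filterlim_Suc floor_top] by simp
  have r1: "((\<lambda>T. real (nat \<lfloor>T\<rfloor>) / T) \<longlongrightarrow> 1) at_top"
    by real_asymp
  have r2: "((\<lambda>T. real (nat \<lfloor>T\<rfloor> + 1) / T) \<longlongrightarrow> 1) at_top"
    by real_asymp
  have "((\<lambda>T. enn2real (h T) / T) \<longlongrightarrow> l) at_top"
  proof (rule real_tendsto_sandwich)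
    show "((\<lambda>T. a (nat \<lfloor>T\<rfloor>) * (real (nat \<lfloor>T\<rfloor>) / T)) \<longlongrightarrow> l) at_top"
      using tendsto_mult[OF filterlim_compose[OF lim floor_top] r1] by (simp add: a_def)
    show "((\<lambda>T. a (nat \<lfloor>T\<rfloor> + 1) * (real (nat \<lfloor>T\<rfloor> + 1) / T)) \<longlongrightarrow> l) at_top"
      using tendsto_mult[OF filterlim_compose[OF lim floor_top'] r2] by (simp add: a_def)
    show "\<forall>\<^sub>F T in at_top. a (nat \<lfloor>T\<rfloor>) * (real (nat \<lfloor>T\<rfloor>) / T) \<le> enn2real (h T) / T"
      using eventually_ge_at_top[of 1]
    proof eventually_elim
      case (elim T)
      then have "h (real (nat \<lfloor>T\<rfloor>)) \<le> h T" by (intro h_mono) auto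
      then have "enn2real (h (real (nat \<lfloor>T\<rfloor>))) \<le> enn2real (h T)"
        using h_finite[of T] elim by (intro enn2real_mono) auto
      then have "enn2real (h (real (nat \<lfloor>T\<rfloor>))) / T \<le> enn2real (h T) / T"
        using elim by (intro divide_right_mono) auto
      moreover have "real (nat \<lfloor>T\<rfloor>) \<noteq> 0" using elim by linarith
      ultimately show ?case by (simp add: a_def)
    qed
    show "\<forall>\<^sub>F T in at_top. enn2real (h T) / T \<le> a (nat \<lfloor>T\<rfloor> + 1) * (real (nat \<lfloor>T\<rfloor> + 1) / T)"
      using eventually_ge_at_top[of 1]
    proof eventually_elim
      case (elim T)
      have "T \<le> real (nat \<lfloor>T\<rfloor> + 1)" using elim by linarith
      then have "h T \<le> h (real (nat \<lfloor>T\<rfloor> + 1))" using elim by (intro h_mono) auto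
      then have "enn2real (h T) \<le> enn2real (h (real (nat \<lfloor>T\<rfloor> + 1)))"
        using h_finite[of "real (nat \<lfloor>T\<rfloor> + 1)"] by (intro enn2real_mono) auto
      then have "enn2real (h T) / T \<le> enn2real (h (real (nat \<lfloor>T\<rfloor> + 1))) / T"
        using elim by (intro divide_right_mono) auto
      moreover have "real (nat \<lfloor>T\<rfloor> + 1) \<noteq> 0" by simp
      ultimately show ?case unfolding a_def by (simp del: of_nat_add)
    qed
  qed
  then have "((\<lambda>T. ennreal (enn2real (h T) / T)) \<longlongrightarrow> ennreal l) at_top" by (rule tendsto_ennrealI)
  moreover have "\<forall>\<^sub>F T in at_top. ennreal (enn2real (h T) / T) = h T / ennreal T"
    using eventually_gt_at_top[of 0]
    by eventually_elim (use h_finite in \<open>simp add: divide_ennreal[symmetric]\<close>)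
  ultimately show ?thesis by (rule Lim_transform_eventually)
qed

end

text \<open>The numbers \<open>D\<close> are read off \<open>W\<close> at the fixed center w, yet
  \<open>h_asymp\<close> holds with them for both processes, since
  \<open>center_ratio_tendsto\<close> also applies to \<open>W\<close> with itself as limit.
  Positivity of \<open>l\<close> comes from the coarse grid for \<open>W\<close>.\<close>

theorem common_limit:
  assumes "locally_fbm M X \<kappa> c C" "locally_fbm N W \<kappa> c' C'"
    and \<gamma>_W: "\<And>s t. s \<ge> 0 \<Longrightarrow> t \<ge> 0 \<Longrightarrow> centered_gaussian_process.\<gamma> N W s t = \<bar>s - t\<bar> powr \<kappa>"
  obtains l where "l > 0"
    "((\<lambda>T. centered_gaussian_process.h M X T / ennreal T) \<longlongrightarrow> ennreal l) at_top"
    "((\<lambda>T. centered_gaussian_process.h N W T / ennreal T) \<longlongrightarrow> ennreal l) at_top"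
proof -
  interpret X: locally_fbm M X \<kappa> c C by fact
  interpret W: locally_fbm N W \<kappa> c' C' by fact
  define D where "D m w = W.center_ratio (1 / 2 ^ m) {..2 * w} w" for m w
  define a where "a n = enn2real (X.h (real n)) / real n" for n
  define b where "b n = enn2real (W.h (real n)) / real n" for n
  have D: "0 \<le> D m w" "D m w \<le> 1" for m w
    unfolding D_def by (intro W.center_ratio_bounds; auto)+
  have X_lim: "(\<lambda>i. X.center_ratio (1 / 2 ^ m) {i - w..i + w} i) \<longlonglongrightarrow> D m w" for m w
    unfolding D_def by (rule X.center_ratio_tendsto[OF W.centered_gaussian_process_axioms _ \<gamma>_W]) auto
  have W_lim: "(\<lambda>i. W.center_ratio (1 / 2 ^ m) {i - w..i + w} i) \<longlonglongrightarrow> D m w" for m w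
    unfolding D_def by (rule W.center_ratio_tendsto[OF W.centered_gaussian_process_axioms _ \<gamma>_W]) auto
  have close: "\<exists>d. \<forall>\<^sub>F n in sequentially. \<bar>a n - d\<bar> \<le> \<epsilon> \<and> \<bar>b n - d\<bar> \<le> \<epsilon>" if "\<epsilon> > 0" for \<epsilon>
  proof -
    have "\<forall>\<^sub>F m in sequentially. \<forall>\<^sub>F w in sequentially. \<forall>\<^sub>F n in sequentially.
      \<bar>a n - 2 ^ m * D m w\<bar> \<le> \<epsilon> \<and> \<bar>b n - 2 ^ m * D m w\<bar> \<le> \<epsilon>"
      using X.h_asymp[OF X_lim D \<open>\<epsilon> > 0\<close>] W.h_asymp[OF W_lim D \<open>\<epsilon> > 0\<close>]
      by (simp add: a_def b_def eventually_conj_iff)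
    then obtain m where "\<forall>\<^sub>F w in sequentially. \<forall>\<^sub>F n in sequentially.
      \<bar>a n - 2 ^ m * D m w\<bar> \<le> \<epsilon> \<and> \<bar>b n - 2 ^ m * D m w\<bar> \<le> \<epsilon>"
      using eventually_happens by fastforce
    then obtain w where "\<forall>\<^sub>F n in sequentially.
      \<bar>a n - 2 ^ m * D m w\<bar> \<le> \<epsilon> \<and> \<bar>b n - 2 ^ m * D m w\<bar> \<le> \<epsilon>"
      using eventually_happens by fastforce
    then show ?thesis by blast
  qed
  have "Cauchy b"
  proof (rule metric_CauchyI)
    fix e :: real assume "e > 0"
    then obtain d where "\<forall>\<^sub>F n in sequentially. \<bar>a n - d\<bar> \<le> e / 3 \<and> \<bar>b n - d\<bar> \<le> e / 3"
      using close[of "e / 3"] by auto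
    then obtain n0 where n0: "\<And>n. n \<ge> n0 \<Longrightarrow> \<bar>b n - d\<bar> \<le> e / 3"
      by (auto simp: eventually_sequentially)
    have "dist (b n) (b n') < e" if "n \<ge> n0" "n' \<ge> n0" for n n'
      using n0[OF that(1)] n0[OF that(2)] \<open>e > 0\<close> unfolding dist_real_def by linarith
    then show "\<exists>M. \<forall>m\<ge>M. \<forall>n\<ge>M. dist (b m) (b n) < e" by blast
  qed
  then obtain l where l: "b \<longlonglongrightarrow> l" using Cauchy_convergent convergent_def by blast
  have "(\<lambda>n. a n - b n) \<longlonglongrightarrow> 0"
  proof (rule tendstoI)
    fix e :: real assume "e > 0"
    then obtain d where "\<forall>\<^sub>F n in sequentially. \<bar>a n - d\<bar> \<le> e / 3 \<and> \<bar>b n - d\<bar> \<le> e / 3"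
      using close[of "e / 3"] by auto
    then show "\<forall>\<^sub>F n in sequentially. dist (a n - b n) 0 < e"
    proof eventually_elim
      case (elim n)
      with \<open>e > 0\<close> show ?case unfolding dist_real_def by linarith
    qed
  qed
  from tendsto_add[OF this l] have "a \<longlonglongrightarrow> l" by simp
  obtain a0 where a0: "a0 > 0" "\<And>n. n \<ge> 1 \<Longrightarrow> a0 \<le> b n"
    using W.h_div_lower unfolding b_def by blast
  have "a0 \<le> l" using a0 by (intro LIMSEQ_le_const[OF l]) auto
  with a0 have "l > 0" by simp
  moreover have "((\<lambda>T. X.h T / ennreal T) \<longlongrightarrow> ennreal l) at_top"
    using \<open>a \<longlonglongrightarrow> l\<close> unfolding a_def by (rule X.tendsto_h_div)
  moreover have "((\<lambda>T. W.h T / ennreal T) \<longlongrightarrow> ennreal l) at_top"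
    using l unfolding b_def by (rule W.tendsto_h_div)
  ultimately show thesis using that by blast
qed

subsection \<open>Variograms of the two processes\<close>

lemma process_law_increment:
  assumes "process_law M U = process_law M V" "s \<ge> 0" "t \<ge> 0"
    and "\<And>t. t \<ge> 0 \<Longrightarrow> U t \<in> borel_measurable M" "\<And>t. t \<ge> 0 \<Longrightarrow> V t \<in> borel_measurable M"
  shows "(LINT \<omega>|M. (U s \<omega> - U t \<omega>)\<^sup>2) = (LINT \<omega>|M. (V s \<omega> - V t \<omega>)\<^sup>2)"
    and "(LINT \<omega>|M. (U t \<omega>)\<^sup>2) = (LINT \<omega>|M. (V t \<omega>)\<^sup>2)"
proof -
  have 1: "(LINT x|process_law M U. f x) = (LINT \<omega>|M. f (\<lambda>t\<in>{0..}. U t \<omega>))"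
    if [measurable]: "f \<in> borel_measurable (\<Pi>\<^sub>M t\<in>{0..}. borel)" and [measurable]: "\<And>t. t \<ge> 0 \<Longrightarrow> U t \<in> borel_measurable M"
    for f :: "(real \<Rightarrow> real) \<Rightarrow> real" and U :: "real \<Rightarrow> 'a \<Rightarrow> real"
    unfolding process_law_def
    by (intro integral_distr that measurable_restrict) auto
  have c: "(\<lambda>x. x t) \<in> borel_measurable (\<Pi>\<^sub>M t\<in>{0::real..}. (borel :: real measure))" if "t \<ge> 0" for t
    using that by (intro measurable_component_singleton) auto
  show "(LINT \<omega>|M. (U s \<omega> - U t \<omega>)\<^sup>2) = (LINT \<omega>|M. (V s \<omega> - V t \<omega>)\<^sup>2)"
    using 1[of "\<lambda>x. (x s - x t)\<^sup>2" U] 1[of "\<lambda>x. (x s - x t)\<^sup>2" V] c assms by simp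
  show "(LINT \<omega>|M. (U t \<omega>)\<^sup>2) = (LINT \<omega>|M. (V t \<omega>)\<^sup>2)"
    using 1[of "\<lambda>x. (x t)\<^sup>2" U] 1[of "\<lambda>x. (x t)\<^sup>2" V] c assms by simp
qed

lemma (in centered_gaussian_process) variance_linear_form:
  "U \<in> linear_forms \<Longrightarrow> variance U = expectation (\<lambda>\<omega>. (U \<omega>)\<^sup>2)"
  by (simp add: linear_form_facts)

section \<open>The variogram of fractional Brownian motion\<close>

context fractional_brownian_motion
begin

lemma v_eq: "t \<ge> 0 \<Longrightarrow> v t = t powr \<kappa>"
  using variance_eq[of t] variance_linear_form[OF linear_forms_value, of t] by (simp add: v_def)

lemma \<gamma>_eq:
  assumes "s \<ge> 0" "t \<ge> 0" shows "\<gamma> s t = \<bar>s - t\<bar> powr \<kappa>"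
proof -
  have *: "\<gamma> (s + u) s = u powr \<kappa>" if "s \<ge> 0" "u \<ge> 0" for s u
  proof -
    have "(LINT \<omega>|M. (B (s + u) \<omega> - B s \<omega>)\<^sup>2) = (LINT \<omega>|M. (B u \<omega> - B 0 \<omega>)\<^sup>2)"
      using that by (intro process_law_increment(2)[OF stationary_increments]) auto
    also have "\<dots> = v u"
      unfolding v_def using start_0 that by (intro integral_cong_AE) (auto elim: eventually_mono)
    finally show ?thesis using that by (simp add: \<gamma>_def v_eq)
  qed
  show ?thesis
  proof (cases "t \<le> s")
    case True
    then show ?thesis using *[of t "s - t"] assms by simp
  next
    case False
    then show ?thesis using *[of s "t - s"] assms by (simp add: \<gamma>_commute[of s t])
  qed
qed

lemma is_locally_fbm:
  assumes "\<kappa> > 0" shows "locally_fbm M B \<kappa> 1 1"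
proof unfold_locales
  show "((\<lambda>s. \<gamma> (s + u) (s + u')) \<longlongrightarrow> \<bar>u - u'\<bar> powr \<kappa>) at_top" for u u'
  proof (rule tendsto_eventually)
    show "\<forall>\<^sub>F s in at_top. \<gamma> (s + u) (s + u') = \<bar>u - u'\<bar> powr \<kappa>"
      using eventually_ge_at_top[of "max (- u) (- u')"] by eventually_elim (simp add: \<gamma>_eq)
  qed
  have "continuous_on {0..} (\<lambda>t::real. t powr \<kappa>)"
    using assms by (intro continuous_on_powr' continuous_intros) auto
  then show "continuous_on {0..} v"
    by (simp add: v_eq cong: continuous_on_cong_simp)
qed (use assms in \<open>auto simp: \<gamma>_eq\<close>)

lemma exp_sup_eq_h: "exp_sup M B \<kappa> T = h T"
  unfolding exp_sup_def h_def Z_def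
  by (intro nn_integral_cong arg_cong[where f = "\<lambda>x. ennreal (exp x)"] SUP_cong) (auto simp: v_eq)

end

section \<open>Scaling and bounds for the variogram in the class S\<close>

context class_S
begin

lemma increment_scale:
  assumes "a > 0" "s \<ge> 0" "t \<ge> 0"
  shows "\<gamma> (a * s) (a * t) = a powr \<alpha> * \<gamma> s t" "v (a * t) = a powr \<alpha> * v t"
proof -
  have sq: "(a powr (\<alpha> / 2))\<^sup>2 = a powr \<alpha>"
    by (simp add: power2_eq_square powr_add[symmetric])
  have m: "t \<ge> 0 \<Longrightarrow> Y (a * t) \<in> borel_measurable M" "t \<ge> 0 \<Longrightarrow> (\<lambda>\<omega>. a powr (\<alpha> / 2) * Y t \<omega>) \<in> borel_measurable M" for t
    using \<open>a > 0\<close> by auto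
  have "\<gamma> (a * s) (a * t) = (LINT \<omega>|M. (a powr (\<alpha> / 2) * Y s \<omega> - a powr (\<alpha> / 2) * Y t \<omega>)\<^sup>2)"
    unfolding \<gamma>_def by (rule process_law_increment(1)[OF self_similar[OF \<open>a > 0\<close>] assms(2,3) m])
  also have "\<dots> = (LINT \<omega>|M. a powr \<alpha> * (Y s \<omega> - Y t \<omega>)\<^sup>2)"
    by (simp add: sq[symmetric] power_mult_distrib[symmetric] right_diff_distrib)
  finally show "\<gamma> (a * s) (a * t) = a powr \<alpha> * \<gamma> s t" by (simp add: \<gamma>_def)
  have "v (a * t) = (LINT \<omega>|M. (a powr (\<alpha> / 2) * Y t \<omega>)\<^sup>2)"
    unfolding v_def by (rule process_law_increment(2)[OF self_similar[OF \<open>a > 0\<close>] assms(2,3) m])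
  then show "v (a * t) = a powr \<alpha> * v t"
    by (simp add: v_def power_mult_distrib sq)
qed

lemma v_1: "v 1 = 1"
  using variance_1 variance_linear_form[OF linear_forms_value, of 1] by (simp add: v_def)

lemma v_eq:
  assumes "\<alpha> > 0" "t \<ge> 0" shows "v t = t powr \<alpha>"
proof (cases "t = 0")
  case True
  \<comment> \<open>Scaling by 2 fixes the time 0 but multiplies v by 2 powr \<alpha>, which forces
    v 0 = 0, the value of \<open>0 powr \<alpha>\<close>.\<close>
  have "v (2 * 0) = 2 powr \<alpha> * v 0" by (rule increment_scale) auto
  moreover have "(2::real) powr \<alpha> \<noteq> 1" using assms powr_less_mono[of 0 \<alpha> 2] by auto
  ultimately show ?thesis using True assms by simp
next
  case False
  then show ?thesis using increment_scale(2)[of t 0 1] assms v_1 by simp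
qed

text \<open>A quantitative form of \<open>\<gamma> 1 x > 0\<close>, uniform away from \<open>x = 1\<close>.\<close>

lemma \<gamma>_1_lower:
  assumes "\<alpha> > 0" "0 \<le> x" "0 < l"
  shows "(1 - l) * (1 - x powr \<alpha> / l) \<le> \<gamma> 1 x"
proof -
  note [simp] = integrable_Y_mult[of 1 1] integrable_Y_mult[of 1 x] integrable_Y_mult[of x x]
  have E: "expectation (\<lambda>\<omega>. Y 1 \<omega> * Y 1 \<omega>) = 1" "expectation (\<lambda>\<omega>. Y x \<omega> * Y x \<omega>) = x powr \<alpha>"
    using v_1 v_eq[OF assms(1,2)] by (simp_all add: v_def power2_eq_square)
  define e where "e = expectation (\<lambda>\<omega>. Y 1 \<omega> * Y x \<omega>)"
  have \<gamma>: "\<gamma> 1 x = 1 - 2 * e + x powr \<alpha>"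
  proof -
    have "\<gamma> 1 x = expectation (\<lambda>\<omega>. Y 1 \<omega> * Y 1 \<omega> - 2 * (Y 1 \<omega> * Y x \<omega>) + Y x \<omega> * Y x \<omega>)"
      unfolding \<gamma>_def by (intro arg_cong[where f = expectation] ext) (simp add: power2_eq_square algebra_simps)
    then show ?thesis using assms by (simp add: E e_def)
  qed
  \<comment> \<open>Nonnegativity of this second moment bounds the covariance \<open>e\<close> from
    above; the resulting lower bound for \<gamma> is positive as soon as x powr \<alpha> < l <
    1.\<close>
  have "0 \<le> expectation (\<lambda>\<omega>. (l * Y 1 \<omega> - Y x \<omega>)\<^sup>2)" by simp
  also have "\<dots> = expectation (\<lambda>\<omega>. l\<^sup>2 * (Y 1 \<omega> * Y 1 \<omega>) - 2 * l * (Y 1 \<omega> * Y x \<omega>) + Y x \<omega> * Y x \<omega>)"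
    by (intro arg_cong[where f = expectation] ext) (simp add: power2_eq_square algebra_simps)
  also have "\<dots> = l\<^sup>2 - 2 * l * e + x powr \<alpha>" using assms by (simp add: E e_def)
  finally have "2 * e \<le> l + x powr \<alpha> / l" using assms by (simp add: field_simps power2_eq_square)
  moreover have "(1 - l) * (1 - x powr \<alpha> / l) = 1 - l - x powr \<alpha> / l + x powr \<alpha>"
    using assms by (simp add: field_simps)
  ultimately show ?thesis unfolding \<gamma> by simp
qed

lemma \<gamma>_1_upper:
  assumes "\<alpha> > 0" "0 \<le> x" "x \<le> 1" shows "\<gamma> 1 x \<le> 4"
proof -
  note [simp] = integrable_Y_mult[of 1 1] integrable_Y_mult[of 1 x] integrable_Y_mult[of x x]
  have E: "expectation (\<lambda>\<omega>. Y 1 \<omega> * Y 1 \<omega>) = 1" "expectation (\<lambda>\<omega>. Y x \<omega> * Y x \<omega>) = x powr \<alpha>"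
    using v_1 v_eq[OF assms(1,2)] by (simp_all add: v_def power2_eq_square)
  have "\<gamma> 1 x \<le> expectation (\<lambda>\<omega>. 2 * (Y 1 \<omega> * Y 1 \<omega>) + 2 * (Y x \<omega> * Y x \<omega>))"
    unfolding \<gamma>_def
  proof (rule integral_mono)
    show "integrable M (\<lambda>\<omega>. (Y 1 \<omega> - Y x \<omega>)\<^sup>2)"
      using assms by (intro linear_form_facts linear_forms_diff linear_forms_value) auto
    show "(Y 1 \<omega> - Y x \<omega>)\<^sup>2 \<le> 2 * (Y 1 \<omega> * Y 1 \<omega>) + 2 * (Y x \<omega> * Y x \<omega>)" for \<omega>
      using zero_le_power2[of "Y 1 \<omega> + Y x \<omega>"] by (simp add: power2_eq_square algebra_simps)
  qed (use assms in simp)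
  also have "\<dots> = 2 + 2 * x powr \<alpha>" using assms by (simp add: E)
  also have "x powr \<alpha> \<le> 1" using assms by (simp add: powr_le1)
  finally show ?thesis by simp
qed

lemma \<gamma>_1_asymp:
  "((\<lambda>x. \<gamma> 1 x / (1 - x) powr \<kappa>) \<longlongrightarrow> c) (at_left 1)"
proof -
  let ?V = "\<lambda>h. variance (\<lambda>\<omega>. Y 1 \<omega> - Y (1 - h) \<omega>)"
  have "((\<lambda>h. (?V h - c * \<bar>h\<bar> powr \<kappa>) / \<bar>h\<bar> powr \<kappa>) \<longlongrightarrow> 0) (at 0)"
    by (rule smalloD_tendsto[OF variance_increment])
  then have "((\<lambda>h. (?V h - c * \<bar>h\<bar> powr \<kappa>) / \<bar>h\<bar> powr \<kappa>) \<longlongrightarrow> 0) (at_right 0)"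
    by (rule tendsto_within_subset) auto
  then have "((\<lambda>h. (?V h - c * \<bar>h\<bar> powr \<kappa>) / \<bar>h\<bar> powr \<kappa> + c) \<longlongrightarrow> 0 + c) (at_right 0)"
    by (intro tendsto_intros)
  moreover have "\<forall>\<^sub>F h in at_right 0. (?V h - c * \<bar>h\<bar> powr \<kappa>) / \<bar>h\<bar> powr \<kappa> + c = \<gamma> 1 (1 - h) / h powr \<kappa>"
    using eventually_at_right_real[of 0 1, simplified]
  proof eventually_elim
    case (elim h)
    have "?V h = \<gamma> 1 (1 - h)"
      unfolding \<gamma>_def using elim
      by (intro variance_linear_form linear_forms_diff linear_forms_value) auto
    with elim show ?case by (simp add: field_simps)
  qed
  ultimately have "((\<lambda>h. \<gamma> 1 (1 - h) / h powr \<kappa>) \<longlongrightarrow> c) (at_right 0)"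
    by (simp add: tendsto_cong)
  moreover have "filterlim (\<lambda>x::real. 1 - x) (at_right 0) (at_left 1)"
    by real_asymp
  ultimately have "((\<lambda>x. \<gamma> 1 (1 - (1 - x)) / (1 - x) powr \<kappa>) \<longlongrightarrow> c) (at_left 1)"
    by (rule filterlim_compose)
  then show ?thesis by simp
qed

end

subsection \<open>The time change\<close>

locale class_S_pos = class_S M Y \<alpha> \<kappa> c
  for M :: "'a measure" and Y :: "real \<Rightarrow> 'a \<Rightarrow> real" and \<alpha> \<kappa> c :: real +
  assumes \<alpha>_pos: "\<alpha> > 0" and \<kappa>_pos: "\<kappa> > 0" and c_pos: "c > 0"
begin

text \<open>By scaling, \<gamma> t (t - h) is about c t^\<alpha> (h / t)^\<kappa>, the \<kappa>-th
  power of c^(1/\<kappa>) t^(\<alpha>/\<kappa> - 1) h. Integrating the coefficient of h from 0 to t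
  gives K t^(\<alpha>/\<kappa>).\<close>

definition K :: real where "K = \<kappa> / \<alpha> * c powr (1 / \<kappa>)"

lemma K_pos: "K > 0" using \<alpha>_pos \<kappa>_pos c_pos by (simp add: K_def)

lemma K_powr: "K powr \<kappa> = c * (\<kappa> / \<alpha>) powr \<kappa>"
  unfolding K_def using \<alpha>_pos \<kappa>_pos c_pos by (subst powr_mult) (auto simp: powr_powr)

text \<open>In the clock \<open>\<tau> = K t powr (\<alpha> / \<kappa>)\<close> the process has, locally, the variogram of fractional
  Brownian motion.\<close>

definition clock :: "real \<Rightarrow> real" where "clock \<tau> = (\<tau> / K) powr (\<kappa> / \<alpha>)"

definition X :: "real \<Rightarrow> 'a \<Rightarrow> real" where "X \<tau> = Y (clock \<tau>)"

lemma clock_nonneg [simp]: "clock \<tau> \<ge> 0" by (simp add: clock_def)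

lemma clock_powr: "\<tau> \<ge> 0 \<Longrightarrow> clock \<tau> powr \<alpha> = (\<tau> / K) powr \<kappa>"
  using \<alpha>_pos by (simp add: clock_def powr_powr)

lemma continuous_clock: "continuous_on {0..} clock"
  unfolding clock_def using K_pos \<alpha>_pos \<kappa>_pos by (intro continuous_on_powr' continuous_intros) auto

lemma clock_image:
  assumes "T \<ge> 0" shows "clock ` {0..K * T powr (\<alpha> / \<kappa>)} = {0..T}"
proof
  show "clock ` {0..K * T powr (\<alpha> / \<kappa>)} \<subseteq> {0..T}"
  proof clarify
    fix \<tau> assume "\<tau> \<in> {0..K * T powr (\<alpha> / \<kappa>)}"
    then have "clock \<tau> \<le> (T powr (\<alpha> / \<kappa>)) powr (\<kappa> / \<alpha>)"
      unfolding clock_def using K_pos \<alpha>_pos \<kappa>_pos by (intro powr_mono2) (auto simp: field_simps)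
    also have "\<dots> = T" using assms \<alpha>_pos \<kappa>_pos by (simp add: powr_powr)
    finally show "clock \<tau> \<in> {0..T}" by simp
  qed
  show "{0..T} \<subseteq> clock ` {0..K * T powr (\<alpha> / \<kappa>)}"
  proof
    fix t assume t: "t \<in> {0..T}"
    then have "t = clock (K * t powr (\<alpha> / \<kappa>))"
      using K_pos \<alpha>_pos \<kappa>_pos by (simp add: clock_def powr_powr)
    moreover have "t powr (\<alpha> / \<kappa>) \<le> T powr (\<alpha> / \<kappa>)"
      using t \<alpha>_pos \<kappa>_pos by (intro powr_mono2) auto
    then have "K * t powr (\<alpha> / \<kappa>) \<in> {0..K * T powr (\<alpha> / \<kappa>)}" using K_pos by simp
    ultimately show "t \<in> clock ` {0..K * T powr (\<alpha> / \<kappa>)}" by blast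
  qed
qed

sublocale X: centered_gaussian_process M X
proof
  fix F :: "real set" and a assume "finite F" "F \<subseteq> {0..}"
  then show "centered_gaussian_rv M (\<lambda>\<omega>. \<Sum>t\<in>F. a t * X t \<omega>)"
    unfolding X_def
    by (intro gaussian_linear_form linear_forms_sum linear_forms_mult linear_forms_value) auto
next
  show "AE \<omega> in M. continuous_on {0..} (\<lambda>t. X t \<omega>)"
    using continuous_paths
  proof eventually_elim
    case (elim \<omega>)
    show ?case
      unfolding X_def by (rule continuous_on_compose2[OF elim continuous_clock]) auto
  qed
qed

lemma X_v: "\<tau> \<ge> 0 \<Longrightarrow> X.v \<tau> = (\<tau> / K) powr \<kappa>"
  using v_eq[OF \<alpha>_pos, of "clock \<tau>"] by (simp add: X.v_def v_def X_def clock_powr)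

text \<open>The variogram of \<open>X\<close> divided by that of fractional Brownian motion;
  self-similarity makes it a function of the ratio x of the two times.\<close>

definition q :: "real \<Rightarrow> real" where
  "q x = \<gamma> 1 (x powr (\<kappa> / \<alpha>)) / (K * (1 - x)) powr \<kappa>"

lemma X_\<gamma>:
  assumes "0 \<le> s" "s < t" shows "X.\<gamma> s t = (t - s) powr \<kappa> * q (s / t)"
proof -
  have t: "t > 0" using assms by simp
  then have clock_t: "clock t > 0" using K_pos by (simp add: clock_def)
  have "clock s = clock t * (s / t) powr (\<kappa> / \<alpha>)"
    using assms t K_pos by (simp add: clock_def powr_mult[symmetric])
  then have "X.\<gamma> s t = \<gamma> (clock t * (s / t) powr (\<kappa> / \<alpha>)) (clock t * 1)"
    by (simp add: X.\<gamma>_def \<gamma>_def X_def)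
  also have "\<dots> = (t / K) powr \<kappa> * \<gamma> 1 ((s / t) powr (\<kappa> / \<alpha>))"
    using clock_t assms by (subst increment_scale) (auto simp: clock_powr \<gamma>_commute[of 1])
  also have "\<gamma> 1 ((s / t) powr (\<kappa> / \<alpha>)) = (K * (1 - s / t)) powr \<kappa> * q (s / t)"
    using K_pos assms t by (simp add: q_def)
  also have "(t / K) powr \<kappa> * ((K * (1 - s / t)) powr \<kappa> * q (s / t)) = (t / K * (K * (1 - s / t))) powr \<kappa> * q (s / t)"
    using K_pos assms t by (subst powr_mult) auto
  also have "t / K * (K * (1 - s / t)) = t - s"
    using K_pos t by (simp add: right_diff_distrib)
  finally show ?thesis .
qed

text \<open>With b = \<kappa> / \<alpha>, the numerator is asymptotic to c (1 - x^b)^\<kappa> and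
  hence to c b^\<kappa> (1 - x)^\<kappa>, where c b^\<kappa> is exactly K^\<kappa>.\<close>

lemma q_tendsto: "(q \<longlongrightarrow> 1) (at_left 1)"
proof -
  define b where "b = \<kappa> / \<alpha>"
  have "b > 0" using \<alpha>_pos \<kappa>_pos by (simp add: b_def)
  have lim: "filterlim (\<lambda>x::real. x powr b) (at_left 1) (at_left 1)"
  proof (rule tendsto_imp_filterlim_at_left)
    have "((\<lambda>x::real. x powr b) \<longlongrightarrow> 1 powr b) (at_left 1)" by (intro tendsto_intros) auto
    then show "((\<lambda>x::real. x powr b) \<longlongrightarrow> 1) (at_left 1)" by simp
    show "\<forall>\<^sub>F x::real in at_left 1. x powr b < 1"
      using eventually_at_left_real[of 0 1, simplified]
      by eventually_elim (use \<open>b > 0\<close> powr_less_mono2[of b _ 1] in auto)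
  qed
  have der: "((\<lambda>x::real. (1 - x powr b) / (1 - x)) \<longlongrightarrow> b) (at_left 1)"
    using \<open>b > 0\<close> by real_asymp
  have "((\<lambda>x. \<gamma> 1 (x powr b) / (1 - x powr b) powr \<kappa> * ((1 - x powr b) / (1 - x)) powr \<kappa> / K powr \<kappa>)
    \<longlongrightarrow> c * b powr \<kappa> / K powr \<kappa>) (at_left 1)"
    using \<open>b > 0\<close> K_pos by (intro tendsto_intros filterlim_compose[OF \<gamma>_1_asymp lim] der) auto
  moreover have "c * b powr \<kappa> / K powr \<kappa> = 1" using K_powr c_pos \<alpha>_pos \<kappa>_pos by (simp add: b_def)
  moreover have "\<forall>\<^sub>F x in at_left 1.
    \<gamma> 1 (x powr b) / (1 - x powr b) powr \<kappa> * ((1 - x powr b) / (1 - x)) powr \<kappa> / K powr \<kappa> = q x"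
    using eventually_at_left_real[of 0 1, simplified]
  proof eventually_elim
    case (elim x)
    then have "x powr b < 1" using \<open>b > 0\<close> powr_less_mono2[of b x 1] by auto
    then show ?case using elim K_pos by (simp add: q_def b_def powr_divide powr_mult)
  qed
  ultimately show ?thesis by (simp add: tendsto_cong)
qed

text \<open>Near 1 the limit provides the bounds; away from 1 they come from the explicit estimates
  of \<gamma> 1, in place of a compactness argument for \<open>q\<close>.\<close>

lemma q_bounds:
  obtains a b where "a > 0" "b > 0" "\<forall>x\<in>{0..<1}. a \<le> q x \<and> q x \<le> b"
proof -
  have "\<forall>\<^sub>F x in at_left 1. 1 / 2 < q x \<and> q x < 2"
    using order_tendstoD[OF q_tendsto, of "1 / 2"] order_tendstoD[OF q_tendsto, of 2]
    by (simp add: eventually_conj_iff)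
  then obtain y0 where y0: "y0 < 1" "\<And>x. y0 < x \<Longrightarrow> x < 1 \<Longrightarrow> 1 / 2 < q x \<and> q x < 2"
    unfolding eventually_at_left_field by auto
  define y where "y = max 0 y0"
  have y: "0 \<le> y" "y < 1" and qy: "\<And>x. y < x \<Longrightarrow> x < 1 \<Longrightarrow> 1 / 2 < q x \<and> q x < 2"
    using y0 by (auto simp: y_def)
  have y\<kappa>: "y powr \<kappa> < 1" using y \<kappa>_pos powr_less_mono2[of \<kappa> y 1] by auto
  \<comment> \<open>The midpoint between y powr \<kappa> and 1, so that both factors of the bound in
    \<open>\<gamma>_1_lower\<close> are positive.\<close>
  define l where "l = (1 + y powr \<kappa>) / 2"
  have l: "0 < l" "l < 1" "y powr \<kappa> < l" using y\<kappa> by (auto simp: l_def add_pos_nonneg)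
  define a where "a = (1 - l) * (1 - y powr \<kappa> / l) / K powr \<kappa>"
  define b where "b = 4 / (K * (1 - y)) powr \<kappa>"
  have "a > 0" "b > 0" using l y K_pos by (auto simp: a_def b_def)
  have far: "a \<le> q x \<and> q x \<le> b" if "0 \<le> x" "x \<le> y" for x
  proof -
    define z where "z = x powr (\<kappa> / \<alpha>)"
    have z: "0 \<le> z" "z \<le> 1" using that y \<alpha>_pos \<kappa>_pos by (auto simp: z_def powr_le1)
    have z\<alpha>: "z powr \<alpha> = x powr \<kappa>" using \<alpha>_pos by (simp add: z_def powr_powr)
    have x\<kappa>: "x powr \<kappa> \<le> y powr \<kappa>" using that \<kappa>_pos by (intro powr_mono2) auto
    have den: "(K * (1 - y)) powr \<kappa> \<le> (K * (1 - x)) powr \<kappa>" "(K * (1 - x)) powr \<kappa> \<le> K powr \<kappa>"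
      using that y K_pos \<kappa>_pos by (auto intro!: powr_mono2 simp: mult_left_le)
    have pos: "0 < (K * (1 - y)) powr \<kappa>" "0 < (K * (1 - x)) powr \<kappa>" using K_pos y that by auto
    have "(1 - l) * (1 - y powr \<kappa> / l) \<le> (1 - l) * (1 - z powr \<alpha> / l)"
      using l x\<kappa> by (intro mult_left_mono diff_left_mono divide_right_mono) (auto simp: z\<alpha>)
    also have "\<dots> \<le> \<gamma> 1 z" using \<alpha>_pos z l by (intro \<gamma>_1_lower) auto
    finally have "a \<le> q x"
      unfolding a_def q_def z_def[symmetric] using l den pos \<gamma>_nonneg by (intro frac_le) auto
    moreover have "q x \<le> b"
      unfolding b_def q_def z_def[symmetric] using \<gamma>_1_upper[OF \<alpha>_pos z] den pos by (intro frac_le) auto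
    ultimately show ?thesis by simp
  qed
  have "min a (1 / 2) \<le> q x \<and> q x \<le> max b 2" if "0 \<le> x" "x < 1" for x
    using far[of x] qy[of x] that by (cases "x \<le> y") auto
  moreover have "min a (1 / 2) > 0" "max b 2 > 0" using \<open>a > 0\<close> by auto
  ultimately show thesis by (intro that[of "min a (1 / 2)" "max b 2"]) auto
qed

text \<open>Bounds on \<open>q\<close> are global bounds on the variogram, since every pair of times
  enters through its ratio. The local limit holds because (s + u) / (s + u') tends to 1 from the
  left when u < u'.\<close>

lemma X_locally_fbm: "\<exists>a b. locally_fbm M X \<kappa> a b"
proof -
  obtain a b where ab: "a > 0" "b > 0" "\<forall>x\<in>{0..<1}. a \<le> q x \<and> q x \<le> b"
    by (rule q_bounds)
  have bounds: "a * \<bar>s - t\<bar> powr \<kappa> \<le> X.\<gamma> s t \<and> X.\<gamma> s t \<le> b * \<bar>s - t\<bar> powr \<kappa>" if "0 \<le> s" "s < t" for s t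
  proof -
    have "a \<le> q (s / t) \<and> q (s / t) \<le> b" using that ab by auto
    then have "(t - s) powr \<kappa> * a \<le> X.\<gamma> s t" "X.\<gamma> s t \<le> (t - s) powr \<kappa> * b"
      unfolding X_\<gamma>[OF that] by (auto intro: mult_left_mono)
    then show ?thesis using that by (simp add: mult.commute)
  qed
  have bounds': "a * \<bar>s - t\<bar> powr \<kappa> \<le> X.\<gamma> s t \<and> X.\<gamma> s t \<le> b * \<bar>s - t\<bar> powr \<kappa>" if "s \<ge> 0" "t \<ge> 0" for s t
    using bounds[of s t] bounds[of t s] that
    by (cases s t rule: linorder_cases) (auto simp: X.\<gamma>_commute[of s t] abs_minus_commute)
  have loc: "((\<lambda>s. X.\<gamma> (s + u) (s + u')) \<longlongrightarrow> \<bar>u - u'\<bar> powr \<kappa>) at_top" if "u < u'" for u u'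
  proof -
    have "filterlim (\<lambda>s. (s + u) / (s + u')) (at_left 1) at_top"
    proof (rule tendsto_imp_filterlim_at_left)
      show "((\<lambda>s. (s + u) / (s + u')) \<longlongrightarrow> 1) at_top" by real_asymp
      show "\<forall>\<^sub>F s in at_top. (s + u) / (s + u') < 1"
        using eventually_gt_at_top[of "- u'"] by eventually_elim (use that in auto)
    qed
    from filterlim_compose[OF q_tendsto this]
    have "((\<lambda>s. (u' - u) powr \<kappa> * q ((s + u) / (s + u'))) \<longlongrightarrow> (u' - u) powr \<kappa> * 1) at_top"
      by (intro tendsto_intros)
    moreover have "\<forall>\<^sub>F s in at_top. (u' - u) powr \<kappa> * q ((s + u) / (s + u')) = X.\<gamma> (s + u) (s + u')"
      using eventually_ge_at_top[of "- u"] by eventually_elim (use that in \<open>simp add: X_\<gamma>\<close>)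
    ultimately show ?thesis using that by (simp add: tendsto_cong)
  qed
  have "locally_fbm M X \<kappa> a b"
  proof unfold_locales
    show "((\<lambda>s. X.\<gamma> (s + u) (s + u')) \<longlongrightarrow> \<bar>u - u'\<bar> powr \<kappa>) at_top" for u u'
      using loc[of u u'] loc[of u' u]
      by (cases u u' rule: linorder_cases) (auto simp: X.\<gamma>_commute abs_minus_commute)
    have "continuous_on {0..} (\<lambda>\<tau>. (\<tau> / K) powr \<kappa>)"
      using \<kappa>_pos K_pos by (intro continuous_on_powr' continuous_intros) auto
    then show "continuous_on {0..} X.v"
      by (simp add: X_v cong: continuous_on_cong_simp)
  qed (use ab bounds' \<kappa>_pos in auto)
  then show ?thesis by blast
qed

text \<open>The clock maps the stretched interval onto {0..T} and turns t powr \<alpha> into the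
  variance of \<open>X\<close>, so the two suprema agree for every sample point.\<close>

lemma exp_sup_eq_h:
  assumes "T \<ge> 0" shows "exp_sup M Y \<alpha> T = X.h (K * T powr (\<alpha> / \<kappa>))"
proof -
  have "(SUP t\<in>{0..T}. sqrt 2 * Y t \<omega> - t powr \<alpha>) = (SUP \<tau>\<in>{0..K * T powr (\<alpha> / \<kappa>)}. X.Z \<tau> \<omega>)" for \<omega>
    unfolding clock_image[OF assms, symmetric] image_image
    by (intro SUP_cong) (auto simp: X.Z_def X_def X_v clock_powr)
  then show ?thesis by (simp add: exp_sup_def X.h_def)
qed

lemma exp_sup_tendsto:
  assumes lim: "((\<lambda>T. X.h T / ennreal T) \<longlongrightarrow> ennreal l) at_top"
  shows "((\<lambda>T. exp_sup M Y \<alpha> T / ennreal (T powr (\<alpha> / \<kappa>))) \<longlongrightarrow> ennreal K * ennreal l) at_top"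
proof -
  have "filterlim (\<lambda>T. K * T powr (\<alpha> / \<kappa>)) at_top at_top"
    using K_pos \<alpha>_pos \<kappa>_pos by real_asymp
  from filterlim_compose[OF lim this]
  have "((\<lambda>T. ennreal K * (X.h (K * T powr (\<alpha> / \<kappa>)) / ennreal (K * T powr (\<alpha> / \<kappa>)))) \<longlongrightarrow> ennreal K * ennreal l) at_top"
    by (intro ennreal_tendsto_cmult) auto
  moreover have "\<forall>\<^sub>F T in at_top. ennreal K * (X.h (K * T powr (\<alpha> / \<kappa>)) / ennreal (K * T powr (\<alpha> / \<kappa>))) =
    exp_sup M Y \<alpha> T / ennreal (T powr (\<alpha> / \<kappa>))"
    using eventually_gt_at_top[of 0]
  proof eventually_elim
    case (elim T)
    define x where "x = T powr (\<alpha> / \<kappa>)"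
    have "x > 0" using elim by (simp add: x_def)
    have "ennreal K * inverse (ennreal (K * x)) = inverse (ennreal x)"
      using \<open>x > 0\<close> K_pos by (simp add: inverse_ennreal ennreal_mult[symmetric])
    then have "ennreal K * (y / ennreal (K * x)) = y / ennreal x" for y
      unfolding divide_ennreal_def by (metis mult.left_commute)
    then show ?case using elim by (simp add: exp_sup_eq_h x_def)
  qed
  ultimately show ?thesis by (rule Lim_transform_eventually)
qed

end

theorem theorem3p4:
  fixes M :: "'a measure" and Y :: "real \<Rightarrow> 'a \<Rightarrow> real"
    and N :: "'b measure" and B :: "real \<Rightarrow> 'b \<Rightarrow> real"
    and \<alpha> \<kappa> c\<^sub>Y :: real
  assumes "\<alpha> > 0" and "0 < \<kappa>" and "\<kappa> \<le> 2" and "c\<^sub>Y > 0"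
    and "class_S M Y \<alpha> \<kappa> c\<^sub>Y"
    and "fractional_brownian_motion N B \<kappa>"
  shows "\<exists>H. ((\<lambda>T. exp_sup M Y \<alpha> T / ennreal (T powr (\<alpha> / \<kappa>))) \<longlongrightarrow> H) at_top \<and>
             0 < H \<and> H < \<infinity> \<and>
             H = ennreal (\<kappa> / \<alpha> * c\<^sub>Y powr (1 / \<kappa>)) * pickands_constant N B \<kappa>"
proof -
  interpret Y: class_S M Y \<alpha> \<kappa> c\<^sub>Y by fact
  interpret Y: class_S_pos M Y \<alpha> \<kappa> c\<^sub>Y by unfold_locales fact+
  interpret B: fractional_brownian_motion N B \<kappa> by fact
  obtain a b where X: "locally_fbm M Y.X \<kappa> a b" using Y.X_locally_fbm by blast
  obtain l where l: "l > 0" "((\<lambda>T. Y.X.h T / ennreal T) \<longlongrightarrow> ennreal l) at_top"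
    "((\<lambda>T. B.h T / ennreal T) \<longlongrightarrow> ennreal l) at_top"
    by (rule common_limit[OF X B.is_locally_fbm[OF \<open>0 < \<kappa>\<close>] B.\<gamma>_eq])
  \<comment> \<open>\<open>Lim\<close> is a definite description; it evaluates to \<open>l\<close>
    because convergence has been proved for \<open>B\<close> as well.\<close>
  have "pickands_constant N B \<kappa> = ennreal l"
    unfolding pickands_constant_def B.exp_sup_eq_h by (intro tendsto_Lim l) simp
  moreover have "0 < ennreal Y.K * ennreal l" "ennreal Y.K * ennreal l < \<infinity>"
    using Y.K_pos l(1) by (simp_all add: ennreal_mult[symmetric])
  ultimately show ?thesis
    using Y.exp_sup_tendsto[OF l(2)] by (auto simp: Y.K_def)
qed

end
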